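(* Let $g:\mathbb R\to\mathbb R$ be a derivator, let $a<b$ be real numbers, and let $(Y,\|\cdot\|_Y)$ be a Banach space with the Radon--Nikodým property. A function $u:[a,b]\to Y$ belongs to $AC_g([a,b];Y)$ if and only if all of the following conditions are satisfied: (1) the strong $g$-derivative $u'_g(t)\in Y$ exists for $g$-almost every $t\in[a,b)$; (2) $u'_g\in L_g^1([a,b);Y)$; (3) $u(t)=u(a)+\int_{[a,t)}u'_g(s)\,d\mu_g(s)$ for every $t\in[a,b]$. In this case the variation function $V_u(t):=\operatorname{Var}_{[a,t]}(u)$, $t\in[a,b]$, belongs to $AC_g([a,b];\mathbb R)$ and satisfies $(V_u)'_g(t)=\|u'_g(t)\|_Y$ for $g$-almost every $t\in[a,b)$.
   Context: A derivator is a nondecreasing, left-continuous function $g:\mathbb R\to\mathbb R$. Its Lebesgue--Stieltjes measure $\mu_g$ is fixed by $\mu_g([c,d))=g(d)-g(c)$ for $c<d$. "$g$-measurable" and "$g$-almost every" refer to (the completion of) $\mu_g$. $L_g^1([a,b);Y)$ is the Bochner space of ($\mu_g$-a.e. equivalence classes of) strongly $\mu_g$-measurable $f:[a,b)\to Y$ with $\int_{[a,b)}\|f\|_Y\,d\mu_g<\infty$; integrals of $Y$-valued functions are Bochner integrals. Values of $u'_g$ on the exceptional $\mu_g$-null set are irrelevant. $AC_g([a,b];Y)$: $u:[a,b]\to Y$ is $g$-absolutely continuous if for every $\varepsilon>0$ there is $\delta>0$ such that for every finite collection of pairwise disjoint open intervals $(a_i,b_i)$, $i=1,\dots,n$, with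 endpoints in $[a,b]$ and $\sum_i (g(b_i)-g(a_i))<\delta$, one has $\sum_i\|u(b_i)-u(a_i)\|_Y<\varepsilon$. Total variation: $\operatorname{Var}_{[a,t]}(u)=\sup\sum_{i=1}^n\|u(t_i)-u(t_{i-1})\|_Y$ over all partitions $a=t_0<\dots<t_n=t$ (and $\operatorname{Var}_{[a,a]}(u)=0$). Strong $g$-derivative: let $C_g$ be the set of $t\in\mathbb R$ such that $g$ is constant on some neighbourhood $(t-\varepsilon,t+\varepsilon)$; let $\Delta^+g(t)=g(t^+)-g(t)$ and $D_g=\{t:\Delta^+g(t)>0\}$. $C_g$ is open; let $N_g$ be the set of finite endpoints of connected components of $C_g$ that do not belong to $D_g$. (One has $\mu_g(C_g\cup N_g)=0$.) For $t\in[a,b)\setminus(C_g\cup N_g)$ put $$f'_g(t)=\lim_{s\to t}\frac{f(s)-f(t)}{g(s)-g(t)}\ \text{ if } t\notin D_g,\qquad f'_g(t)=\frac{f(t^+)-f(t)}{\Delta^+g(t)}\ \text{ if } t\in D_g,$$ provided the limit involved exists in the norm of $Y$; in the first case the limit is taken through $s\in[a,b]$ with $g(s)\neq g(t)$, and $f(t^+)$ denotes the right-hand limit. Radon--Nikodým property of $Y$: for every finite measure space $(X,\Sigma,\mu)$, every countably additive $\nu:\Sigma\to Y$ of bounded variation with $\nu\ll\mu$ has a density $v\in L^1(X,\mu;Y)$, i.e. $\nu(A)=\int_A v\,d\mu$ for all $A\in\Sigma$. *)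

theory Defs
  imports "HOL-Analysis.Analysis"
begin

section \<open>Bochner integration in arbitrary Banach spaces\<close>

text \<open>The library's \<open>has_bochner_integral\<close> and \<open>integrable\<close> are confined to
  second countable (separable) codomains. The definitions below follow the library ones, with Borel
  measurability replaced by strong measurability, and apply to every Banach space.\<close>

definition strongly_measurable :: "'a measure \<Rightarrow> ('a \<Rightarrow> 'b::real_normed_vector) \<Rightarrow> bool" where
  "strongly_measurable M f \<longleftrightarrow>
     (\<exists>s. (\<forall>i::nat. Bochner_Integration.simple_bochner_integrable M (s i)) \<and> (AE x in M. (\<lambda>i. s i x) \<longlonglongrightarrow> f x))"

definition Bochner_integrable :: "'a measure \<Rightarrow> ('a \<Rightarrow> 'b::real_normed_vector) \<Rightarrow> bool" where
  "Bochner_integrable M f \<longleftrightarrow>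
     strongly_measurable M f \<and> (\<integral>\<^sup>+x. ennreal (norm (f x)) \<partial>M) < \<infinity>"

definition has_Bochner_integral :: "'a measure \<Rightarrow> ('a \<Rightarrow> 'b::real_normed_vector) \<Rightarrow> 'b \<Rightarrow> bool" where
  "has_Bochner_integral M f y \<longleftrightarrow> strongly_measurable M f \<and>
     (\<exists>s. (\<forall>i::nat. Bochner_Integration.simple_bochner_integrable M (s i)) \<and>
          (\<lambda>i. \<integral>\<^sup>+x. ennreal (norm (f x - s i x)) \<partial>M) \<longlonglongrightarrow> 0 \<and>
          (\<lambda>i. Bochner_Integration.simple_bochner_integral M (s i)) \<longlonglongrightarrow> y)"

definition Bochner_integral :: "'a measure \<Rightarrow> ('a \<Rightarrow> 'b::real_normed_vector) \<Rightarrow> 'b" where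
  "Bochner_integral M f = (THE y. has_Bochner_integral M f y)"

section \<open>The Radon--Nikodym property\<close>

definition vector_measure :: "'a measure \<Rightarrow> ('a set \<Rightarrow> 'b::real_normed_vector) \<Rightarrow> bool" where
  "vector_measure M \<nu> \<longleftrightarrow>
     (\<forall>A::nat \<Rightarrow> 'a set. range A \<subseteq> sets M \<longrightarrow> disjoint_family A \<longrightarrow> (\<lambda>i. \<nu> (A i)) sums \<nu> (\<Union>i. A i))"

definition bounded_variation_measure :: "'a measure \<Rightarrow> ('a set \<Rightarrow> 'b::real_normed_vector) \<Rightarrow> bool" where
  "bounded_variation_measure M \<nu> \<longleftrightarrow>
     (\<exists>B. \<forall>P. finite P \<longrightarrow> P \<subseteq> sets M \<longrightarrow> disjoint P \<longrightarrow> (\<Sum>A\<in>P. norm (\<nu> A)) \<le> B)"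

text \<open>HOL cannot quantify over the carrier type of a measure space inside a formula, so the carriers
  range over all subsets of \<open>\<real>\<close>, with arbitrary \<open>\<sigma>\<close>-algebras and finite measures on them.
  This is implied by the property for all finite measure spaces, so assuming it is the weaker
  hypothesis. (It is also equivalent to it: the unit interval with Lebesgue measure already
  suffices.)\<close>

definition Radon_Nikodym_property :: "'b::banach itself \<Rightarrow> bool" where
  "Radon_Nikodym_property (_ :: 'b itself) \<longleftrightarrow>
     (\<forall>(M :: real measure) (\<nu> :: real set \<Rightarrow> 'b).
        finite_measure M \<longrightarrow> vector_measure M \<nu> \<longrightarrow> bounded_variation_measure M \<nu> \<longrightarrow>
        (\<forall>A \<in> null_sets M. \<nu> A = 0) \<longrightarrow>
        (\<exists>v. Bochner_integrable M v \<and>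
             (\<forall>A \<in> sets M. \<nu> A = Bochner_integral (restrict_space M A) v)))"

section \<open>Derivators and their Lebesgue--Stieltjes measures\<close>

definition derivator :: "(real \<Rightarrow> real) \<Rightarrow> bool" where
  "derivator g \<longleftrightarrow> mono g \<and> (\<forall>t. continuous (at_left t) g)"

text \<open>The library's \<open>interval_measure\<close> treats right-continuous functions and intervals
  \<open>{c<..d}\<close>; reflection at \<open>0\<close> yields the left-continuous version with \<open>{c..<d}\<close>
  (see \<open>emeasure_stieltjes_Ico\<close> below).\<close>

definition stieltjes_measure :: "(real \<Rightarrow> real) \<Rightarrow> real measure" where
  "stieltjes_measure g = completion (distr (interval_measure (\<lambda>x. - g (- x))) borel uminus)"

abbreviation stieltjes_on :: "(real \<Rightarrow> real) \<Rightarrow> real set \<Rightarrow> real measure" where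
  "stieltjes_on g A \<equiv> restrict_space (stieltjes_measure g) A"

lemma emeasure_stieltjes_Ico:
  assumes g: "derivator g" and cd: "c \<le> d"
  shows "emeasure (stieltjes_measure g) {c..<d} = ennreal (g d - g c)"
proof -
  have right: "continuous (at_right x) (\<lambda>x. - g (- x))" for x
  proof -
    have "(g \<longlongrightarrow> g (- x)) (at_left (- x))"
      using g by (simp add: derivator_def continuous_within)
    then have "((\<lambda>y. g (- y)) \<longlongrightarrow> g (- x)) (at_right x)"
      using filterlim_at_left_to_right[of g "nhds (g (- x))" "- x"] by simp
    then show ?thesis
      by (auto simp: continuous_within intro: tendsto_minus)
  qed
  have "emeasure (stieltjes_measure g) {c..<d}
      = emeasure (interval_measure (\<lambda>x. - g (- x))) (uminus -` {c..<d})"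
    unfolding stieltjes_measure_def by (subst emeasure_completion) (auto simp: emeasure_distr)
  also have "uminus -` {c..<d} = {- d<..- c}" by auto
  also have "emeasure (interval_measure (\<lambda>x. - g (- x))) {- d<..- c} = ennreal (g d - g c)"
    using g cd right by (subst emeasure_interval_measure_Ioc) (auto simp: derivator_def mono_def)
  finally show ?thesis .
qed

section \<open>Absolute continuity and variation\<close>

definition AC_g :: "(real \<Rightarrow> real) \<Rightarrow> real \<Rightarrow> real \<Rightarrow> (real \<Rightarrow> 'b::real_normed_vector) \<Rightarrow> bool" where
  "AC_g g a b u \<longleftrightarrow>
     (\<forall>\<epsilon>>0. \<exists>\<delta>>0. \<forall>(n::nat) l r.
        (\<forall>i<n. l i \<in> {a..b} \<and> r i \<in> {a..b} \<and> l i < r i) \<longrightarrow>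
        disjoint_family_on (\<lambda>i. {l i<..<r i}) {..<n} \<longrightarrow>
        (\<Sum>i<n. g (r i) - g (l i)) < \<delta> \<longrightarrow>
        (\<Sum>i<n. norm (u (r i) - u (l i))) < \<epsilon>)"

text \<open>The case \<open>n = 0\<close> only arises for \<open>t = a\<close>, where it gives the value \<open>0\<close>.\<close>

definition variation :: "real \<Rightarrow> real \<Rightarrow> (real \<Rightarrow> 'b::real_normed_vector) \<Rightarrow> ennreal" where
  "variation a t u =
     (SUP (n, p) \<in> {(n::nat, p). p 0 = a \<and> p n = t \<and> (\<forall>i<n. p i < p (Suc i))}.
        ennreal (\<Sum>i<n. norm (u (p (Suc i)) - u (p i))))"

section \<open>The strong derivative with respect to a derivator\<close>

definition const_set :: "(real \<Rightarrow> real) \<Rightarrow> real set" where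
  "const_set g = {t. \<exists>\<epsilon>>0. \<forall>s\<in>{t - \<epsilon><..<t + \<epsilon>}. g s = g t}"

definition right_jump :: "(real \<Rightarrow> real) \<Rightarrow> real \<Rightarrow> real" where
  "right_jump g t = Lim (at_right t) g - g t"

definition jump_set :: "(real \<Rightarrow> real) \<Rightarrow> real set" where
  "jump_set g = {t. right_jump g t > 0}"

definition const_endpoints :: "(real \<Rightarrow> real) \<Rightarrow> real set" where
  "const_endpoints g =
     {x. \<exists>K \<in> components (const_set g). bdd_below K \<and> x = Inf K \<or> bdd_above K \<and> x = Sup K}
     - jump_set g"

definition has_g_derivative ::
  "(real \<Rightarrow> real) \<Rightarrow> real \<Rightarrow> real \<Rightarrow> (real \<Rightarrow> 'b::real_normed_vector) \<Rightarrow> real \<Rightarrow> 'b \<Rightarrow> bool" where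
  "has_g_derivative g a b f t y \<longleftrightarrow>
     t \<in> {a..<b} - (const_set g \<union> const_endpoints g) \<and>
     (if t \<in> jump_set g
      then \<exists>l. (f \<longlongrightarrow> l) (at_right t) \<and> y = (l - f t) /\<^sub>R right_jump g t
      else ((\<lambda>s. (f s - f t) /\<^sub>R (g s - g t)) \<longlongrightarrow> y) (at t within {s \<in> {a..b}. g s \<noteq> g t}))"

text \<open>Unspecified where no derivative exists.\<close>

definition g_derivative ::
  "(real \<Rightarrow> real) \<Rightarrow> real \<Rightarrow> real \<Rightarrow> (real \<Rightarrow> 'b::real_normed_vector) \<Rightarrow> real \<Rightarrow> 'b" where
  "g_derivative g a b f t = (THE y. has_g_derivative g a b f t y)"

end

theory Submission
  imports Defs
begin

text \<open>
  If \<open>u\<close> is the indefinite integral of an integrable function, absolute continuity of the integral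
  makes \<open>u\<close> absolutely continuous. The work lies in the other direction, where a density has to be
  produced and then recognised as the derivative.

  Let \<open>\<nu>\<^sub>n(A)\<close> be the integral over \<open>A\<close> of the step function whose value on each of
  \<open>n + 1\<close> cells of equal length is the slope of \<open>u\<close> with respect to \<open>g\<close>. Since \<open>u\<close> has bounded
  variation (\<open>AC_g_bounded_variation\<close>), steep cells have small total measure, and absolute continuity
  makes the increments of \<open>u\<close> over them small. The set functions \<open>\<nu>\<^sub>n\<close> are therefore uniformly
  absolutely continuous (\<open>avg_uniformly_continuous\<close>). It follows that the sets on which \<open>\<nu>\<^sub>n\<close> converges
  form a Dynkin system. By left-continuity it contains all intervals \<open>[a,d)\<close>, so it contains every
  measurable set. The limit is a vector measure of bounded variation that vanishes on null sets
  and assigns \<open>u(d) - u(a)\<close> to \<open>[a,d)\<close>; this extends the increments of \<open>u\<close> to a measure without an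
  outer-measure construction. The Radon--Nikodym property of the codomain gives its density \<open>v\<close>
  (\<open>ex_density\<close>).

  Almost every point is a Lebesgue point of \<open>v\<close>. On the line this is true for every
  Stieltjes measure, doubling or not: a finite family of intervals has a subfamily with the same
  union that covers no point more than twice, which yields a comparison of measures
  (\<open>fine_interval_cover_measure_le\<close>). Applied to the measures with density \<open>\<parallel>v - q\<parallel>\<close>, where \<open>q\<close> runs
  through a countable set dense in the essential range of \<open>v\<close>, it gives \<open>AE_Lebesgue_point\<close> directly,
  without approximating \<open>v\<close> by continuous functions. At a Lebesgue point outside \<open>C\<^sub>g \<union> N\<^sub>g\<close> the
  indefinite integral has the strong derivative \<open>v(t)\<close>
  (\<open>has_g_derivative_at_Lebesgue_point\<close>).

  The norm inequality for integrals bounds the variation of \<open>u\<close> on \<open>[a,t]\<close> by the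
  integral of \<open>\<parallel>v\<parallel>\<close>. Conversely, the averaged slopes converge to \<open>v\<close> at every Lebesgue point, and
  Fatou's lemma bounds the integral by the variation (\<open>integral_le_variation\<close>). So \<open>V\<^sub>u\<close> is the
  indefinite integral of \<open>\<parallel>v\<parallel>\<close>, and its derivative is found at the same Lebesgue points.
\<close>

section \<open>Bochner integrals over complete measure spaces\<close>

text \<open>A strongly measurable function is only an almost everywhere limit of simple functions.
  Completeness of the measure absorbs the exceptional null set, so that norms of strongly measurable
  functions are measurable and their integrals additive.\<close>

lemma (in complete_measure) borel_measurable_AE_limit:
  fixes s :: "nat \<Rightarrow> 'a \<Rightarrow> real"
  assumes s: "\<And>i. s i \<in> borel_measurable M" and lim: "AE x in M. (\<lambda>i. s i x) \<longlonglongrightarrow> f x"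
  shows "f \<in> borel_measurable M"
proof (rule borel_measurableI)
  fix B :: "real set" assume "open B"
  let ?h = "\<lambda>x. lim (\<lambda>i. s i x)"
  have h: "?h \<in> borel_measurable M" using s by measurable
  show "f -` B \<inter> space M \<in> sets M"
  proof (rule in_sets_AE)
    show "?h -` B \<inter> space M \<in> sets M" using h \<open>open B\<close> by (intro measurable_sets) auto
    show "AE x in M. x \<in> ?h -` B \<inter> space M \<longleftrightarrow> x \<in> f -` B \<inter> space M"
      using lim by eventually_elim (auto dest: limI)
  qed auto
qed

lemma simple_bochner_integrable_diff:
  "Bochner_Integration.simple_bochner_integrable M f \<Longrightarrow> Bochner_Integration.simple_bochner_integrable M h \<Longrightarrow>
    Bochner_Integration.simple_bochner_integrable M (\<lambda>x. f x - h x)"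
  by (rule simple_bochner_integrable_compose2) auto

lemma simple_bochner_integrable_norm:
  assumes "Bochner_Integration.simple_bochner_integrable M f"
  shows "Bochner_Integration.simple_bochner_integrable M (\<lambda>x. norm (f x))"
  using simple_bochner_integrable_compose2[of "\<lambda>x y. norm x" M f f] assms by auto

lemma borel_measurable_simple_bochner_integrable:
  "Bochner_Integration.simple_bochner_integrable M f \<Longrightarrow> f \<in> borel_measurable M"
  by (auto intro: borel_measurable_simple_function elim: Bochner_Integration.simple_bochner_integrable.cases)

lemma norm_simple_bochner_integral_le_nn_integral:
  assumes "Bochner_Integration.simple_bochner_integrable M s"
  shows "ennreal (norm (Bochner_Integration.simple_bochner_integral M s)) \<le> (\<integral>\<^sup>+x. ennreal (norm (s x)) \<partial>M)"
proof -
  have "ennreal (norm (Bochner_Integration.simple_bochner_integral M s))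
      \<le> ennreal (Bochner_Integration.simple_bochner_integral M (\<lambda>x. norm (s x)))"
    by (intro ennreal_leI simple_bochner_integral_norm_bound assms)
  also have "\<dots> = (\<integral>\<^sup>+x. ennreal (norm (s x)) \<partial>M)"
    by (intro simple_bochner_integral_eq_nn_integral simple_bochner_integrable_norm assms) auto
  finally show ?thesis .
qed

lemma strongly_measurable_simple:
  "Bochner_Integration.simple_bochner_integrable M s \<Longrightarrow> strongly_measurable M s"
  unfolding strongly_measurable_def by (rule exI[of _ "\<lambda>_. s"]) auto

lemma strongly_measurable_diff:
  assumes "strongly_measurable M f" "strongly_measurable M h"
  shows "strongly_measurable M (\<lambda>x. f x - h x)"
proof -
  obtain s t where s: "\<And>i::nat. Bochner_Integration.simple_bochner_integrable M (s i)" "AE x in M. (\<lambda>i. s i x) \<longlonglongrightarrow> f x"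
    and t: "\<And>i::nat. Bochner_Integration.simple_bochner_integrable M (t i)" "AE x in M. (\<lambda>i. t i x) \<longlonglongrightarrow> h x"
    using assms unfolding strongly_measurable_def by blast
  have "AE x in M. (\<lambda>i. s i x - t i x) \<longlonglongrightarrow> f x - h x"
    using s(2) t(2) by eventually_elim (rule tendsto_diff)
  then show ?thesis
    unfolding strongly_measurable_def using s(1) t(1)
    by (intro exI[of _ "\<lambda>i x. s i x - t i x"]) (auto intro: simple_bochner_integrable_diff)
qed

lemma strongly_measurable_cong_AE:
  assumes "strongly_measurable M f" "AE x in M. f x = h x"
  shows "strongly_measurable M h"
proof -
  obtain s where s: "\<And>i::nat. Bochner_Integration.simple_bochner_integrable M (s i)" "AE x in M. (\<lambda>i. s i x) \<longlonglongrightarrow> f x"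
    using assms unfolding strongly_measurable_def by blast
  have "AE x in M. (\<lambda>i. s i x) \<longlonglongrightarrow> h x"
    using s(2) assms(2) by eventually_elim auto
  then show ?thesis using s(1) unfolding strongly_measurable_def by blast
qed

lemma Bochner_integrable_cong_AE:
  assumes "Bochner_integrable M f" "AE x in M. f x = h x"
  shows "Bochner_integrable M h"
proof -
  have "(\<integral>\<^sup>+x. ennreal (norm (h x)) \<partial>M) = (\<integral>\<^sup>+x. ennreal (norm (f x)) \<partial>M)"
    by (rule nn_integral_cong_AE) (use assms(2) in eventually_elim, simp)
  then show ?thesis
    using assms strongly_measurable_cong_AE unfolding Bochner_integrable_def by metis
qed

lemma has_Bochner_integral_cong_AE:
  assumes "has_Bochner_integral M f y" "AE x in M. f x = h x"
  shows "has_Bochner_integral M h y"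
proof -
  have eq: "(\<integral>\<^sup>+x. ennreal (norm (h x - s x)) \<partial>M) = (\<integral>\<^sup>+x. ennreal (norm (f x - s x)) \<partial>M)" for s
    by (rule nn_integral_cong_AE) (use assms(2) in eventually_elim, simp)
  show ?thesis
    using assms(1) strongly_measurable_cong_AE[OF _ assms(2)] unfolding has_Bochner_integral_def eq by blast
qed

lemma Bochner_integral_cong_AE:
  assumes "AE x in M. f x = h x"
  shows "Bochner_integral M f = Bochner_integral M h"
proof -
  have "AE x in M. h x = f x" using assms by eventually_elim simp
  then have "has_Bochner_integral M f = has_Bochner_integral M h"
    using has_Bochner_integral_cong_AE assms by blast
  then show ?thesis unfolding Bochner_integral_def by simp
qed

text \<open>The approximating simple functions together take only countably many values. The set \<open>D\<close> does the
  duty of a countable dense subset of the codomain, which need not be separable.\<close>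

lemma strongly_measurable_separable:
  assumes "strongly_measurable M f"
  obtains D where "countable D" "AE x in M. f x \<in> closure D"
proof -
  obtain s where s: "\<And>i::nat. Bochner_Integration.simple_bochner_integrable M (s i)" "AE x in M. (\<lambda>i. s i x) \<longlonglongrightarrow> f x"
    using assms unfolding strongly_measurable_def by blast
  let ?D = "\<Union>i. s i ` space M"
  have "finite (s i ` space M)" for i
    using s(1)[of i] by (auto elim!: Bochner_Integration.simple_bochner_integrable.cases dest: simple_functionD)
  then have "countable ?D" by (auto intro: countable_finite)
  moreover have "AE x in M. f x \<in> closure ?D"
    using s(2) AE_space
  proof eventually_elim
    case (elim x)
    then show ?case unfolding closure_sequential by (intro exI[of _ "\<lambda>i. s i x"]) auto
  qed
  ultimately show ?thesis by (rule that)
qed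

lemma (in complete_measure) borel_measurable_norm_strongly_measurable:
  assumes "strongly_measurable M f"
  shows "(\<lambda>x. norm (f x)) \<in> borel_measurable M"
proof -
  obtain s where s: "\<And>i::nat. Bochner_Integration.simple_bochner_integrable M (s i)" "AE x in M. (\<lambda>i. s i x) \<longlonglongrightarrow> f x"
    using assms unfolding strongly_measurable_def by blast
  show ?thesis
  proof (rule borel_measurable_AE_limit)
    show "(\<lambda>x. norm (s i x)) \<in> borel_measurable M" for i
      by (intro borel_measurable_simple_bochner_integrable simple_bochner_integrable_norm s)
    show "AE x in M. (\<lambda>i. norm (s i x)) \<longlonglongrightarrow> norm (f x)"
      using s(2) by eventually_elim (rule tendsto_norm)
  qed
qed

lemma strongly_measurable_const:
  "finite_measure M \<Longrightarrow> strongly_measurable M (\<lambda>x. c)"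
  by (intro strongly_measurable_simple Bochner_Integration.simple_bochner_integrable.intros)
    (auto simp: finite_measure.emeasure_finite)

lemma (in complete_measure) has_Bochner_integral_norm_bound:
  assumes "has_Bochner_integral M f y"
  shows "ennreal (norm y) \<le> (\<integral>\<^sup>+x. ennreal (norm (f x)) \<partial>M)"
proof -
  obtain s where sm: "strongly_measurable M f" and s: "\<And>i::nat. Bochner_Integration.simple_bochner_integrable M (s i)"
    and lim: "(\<lambda>i. \<integral>\<^sup>+x. ennreal (norm (f x - s i x)) \<partial>M) \<longlonglongrightarrow> 0"
    and y: "(\<lambda>i. Bochner_Integration.simple_bochner_integral M (s i)) \<longlonglongrightarrow> y"
    using assms unfolding has_Bochner_integral_def by blast
  note [measurable] = borel_measurable_norm_strongly_measurable[OF sm]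
    borel_measurable_norm_strongly_measurable[OF strongly_measurable_diff[OF sm strongly_measurable_simple[OF s]]]
  have "ennreal (norm (Bochner_Integration.simple_bochner_integral M (s i)))
      \<le> (\<integral>\<^sup>+x. ennreal (norm (f x)) \<partial>M) + (\<integral>\<^sup>+x. ennreal (norm (f x - s i x)) \<partial>M)" for i
  proof -
    have "ennreal (norm (Bochner_Integration.simple_bochner_integral M (s i))) \<le> (\<integral>\<^sup>+x. ennreal (norm (s i x)) \<partial>M)"
      by (rule norm_simple_bochner_integral_le_nn_integral[OF s])
    also have "\<dots> \<le> (\<integral>\<^sup>+x. ennreal (norm (f x)) + ennreal (norm (f x - s i x)) \<partial>M)"
    proof (rule nn_integral_mono)
      fix x
      have "norm (s i x) \<le> norm (f x) + norm (f x - s i x)"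
        by (metis norm_minus_commute norm_triangle_sub)
      then show "ennreal (norm (s i x)) \<le> ennreal (norm (f x)) + ennreal (norm (f x - s i x))"
        by (simp flip: ennreal_plus)
    qed
    also have "\<dots> = (\<integral>\<^sup>+x. ennreal (norm (f x)) \<partial>M) + (\<integral>\<^sup>+x. ennreal (norm (f x - s i x)) \<partial>M)"
      by (rule nn_integral_add) measurable
    finally show ?thesis .
  qed
  moreover have "(\<lambda>i. ennreal (norm (Bochner_Integration.simple_bochner_integral M (s i)))) \<longlonglongrightarrow> ennreal (norm y)"
    by (intro tendsto_ennrealI tendsto_norm y)
  moreover have "(\<lambda>i. (\<integral>\<^sup>+x. ennreal (norm (f x)) \<partial>M) + (\<integral>\<^sup>+x. ennreal (norm (f x - s i x)) \<partial>M))
      \<longlonglongrightarrow> (\<integral>\<^sup>+x. ennreal (norm (f x)) \<partial>M) + 0"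
    by (intro tendsto_add tendsto_const lim)
  ultimately have "ennreal (norm y) \<le> (\<integral>\<^sup>+x. ennreal (norm (f x)) \<partial>M) + 0"
    by (meson LIMSEQ_le)
  then show ?thesis by simp
qed

lemma (in complete_measure) has_Bochner_integral_diff:
  assumes "has_Bochner_integral M f y" "has_Bochner_integral M h z"
  shows "has_Bochner_integral M (\<lambda>x. f x - h x) (y - z)"
proof -
  let ?I = "Bochner_Integration.simple_bochner_integral M"
  obtain s where smf: "strongly_measurable M f" and s: "\<And>i::nat. Bochner_Integration.simple_bochner_integrable M (s i)"
    and slim: "(\<lambda>i. \<integral>\<^sup>+x. ennreal (norm (f x - s i x)) \<partial>M) \<longlonglongrightarrow> 0"
    and y: "(\<lambda>i. ?I (s i)) \<longlonglongrightarrow> y"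
    using assms(1) unfolding has_Bochner_integral_def by blast
  obtain t where smh: "strongly_measurable M h" and t: "\<And>i::nat. Bochner_Integration.simple_bochner_integrable M (t i)"
    and tlim: "(\<lambda>i. \<integral>\<^sup>+x. ennreal (norm (h x - t i x)) \<partial>M) \<longlonglongrightarrow> 0"
    and z: "(\<lambda>i. ?I (t i)) \<longlonglongrightarrow> z"
    using assms(2) unfolding has_Bochner_integral_def by blast
  note [measurable] = borel_measurable_norm_strongly_measurable[OF strongly_measurable_diff[OF smf strongly_measurable_simple[OF s]]]
    borel_measurable_norm_strongly_measurable[OF strongly_measurable_diff[OF smh strongly_measurable_simple[OF t]]]
  have bound: "(\<integral>\<^sup>+x. ennreal (norm ((f x - h x) - (s i x - t i x))) \<partial>M)
      \<le> (\<integral>\<^sup>+x. ennreal (norm (f x - s i x)) \<partial>M) + (\<integral>\<^sup>+x. ennreal (norm (h x - t i x)) \<partial>M)" for i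
  proof -
    have "norm ((f x - h x) - (s i x - t i x)) \<le> norm (f x - s i x) + norm (h x - t i x)" for x
      using norm_triangle_ineq4[of "f x - s i x" "h x - t i x"] by (simp add: algebra_simps)
    then have "(\<integral>\<^sup>+x. ennreal (norm ((f x - h x) - (s i x - t i x))) \<partial>M)
        \<le> (\<integral>\<^sup>+x. ennreal (norm (f x - s i x)) + ennreal (norm (h x - t i x)) \<partial>M)"
      by (intro nn_integral_mono) (simp flip: ennreal_plus)
    also have "\<dots> = (\<integral>\<^sup>+x. ennreal (norm (f x - s i x)) \<partial>M) + (\<integral>\<^sup>+x. ennreal (norm (h x - t i x)) \<partial>M)"
      by (rule nn_integral_add) measurable
    finally show ?thesis .
  qed
  have "(\<lambda>i. \<integral>\<^sup>+x. ennreal (norm ((f x - h x) - (s i x - t i x))) \<partial>M) \<longlonglongrightarrow> 0"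
  proof (rule tendsto_sandwich[OF _ _ tendsto_const])
    show "(\<lambda>i. (\<integral>\<^sup>+x. ennreal (norm (f x - s i x)) \<partial>M) + (\<integral>\<^sup>+x. ennreal (norm (h x - t i x)) \<partial>M)) \<longlonglongrightarrow> 0"
      using tendsto_add[OF slim tlim] by simp
  qed (use bound in auto)
  moreover have "(\<lambda>i. ?I (\<lambda>x. s i x - t i x)) \<longlonglongrightarrow> y - z"
    using tendsto_diff[OF y z] by (simp add: simple_bochner_integral_diff[OF s t])
  ultimately show ?thesis
    unfolding has_Bochner_integral_def
    using strongly_measurable_diff[OF smf smh] simple_bochner_integrable_diff[OF s t]
    by (intro conjI exI[of _ "\<lambda>i x. s i x - t i x"]) auto
qed

lemma has_Bochner_integral_simple:
  assumes "Bochner_Integration.simple_bochner_integrable M f"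
  shows "has_Bochner_integral M f (Bochner_Integration.simple_bochner_integral M f)"
  unfolding has_Bochner_integral_def using assms
  by (auto intro!: strongly_measurable_simple exI[of _ "\<lambda>_. f"])

lemma has_Bochner_integral_zero: "has_Bochner_integral M (\<lambda>x. 0) 0"
proof -
  have "Bochner_Integration.simple_bochner_integrable M (\<lambda>x. 0)"
    by (intro Bochner_Integration.simple_bochner_integrable.intros) auto
  note has_Bochner_integral_simple[OF this]
  also have "Bochner_Integration.simple_bochner_integral M (\<lambda>x. 0) = 0"
    unfolding Bochner_Integration.simple_bochner_integral_def by (rule sum.neutral) auto
  finally show ?thesis .
qed

lemma (in complete_measure) has_Bochner_integral_add:
  assumes "has_Bochner_integral M f y" "has_Bochner_integral M h z"
  shows "has_Bochner_integral M (\<lambda>x. f x + h x) (y + z)"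
  using has_Bochner_integral_diff[OF assms(1) has_Bochner_integral_diff[OF has_Bochner_integral_zero assms(2)]]
  by simp

lemma (in complete_measure) has_Bochner_integral_unique:
  assumes "has_Bochner_integral M f y" "has_Bochner_integral M f z"
  shows "y = z"
proof -
  have "ennreal (norm (y - z)) \<le> (\<integral>\<^sup>+x. ennreal (norm (f x - f x)) \<partial>M)"
    by (rule has_Bochner_integral_norm_bound[OF has_Bochner_integral_diff[OF assms]])
  then show ?thesis by simp
qed

lemma (in complete_measure) Bochner_integral_eq:
  "has_Bochner_integral M f y \<Longrightarrow> Bochner_integral M f = y"
  unfolding Bochner_integral_def using has_Bochner_integral_unique by blast

lemma (in finite_measure) has_Bochner_integral_const:
  "has_Bochner_integral M (\<lambda>x. c) (measure M (space M) *\<^sub>R c)"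
proof -
  have "Bochner_Integration.simple_bochner_integrable M (\<lambda>x. c)"
    by (intro Bochner_Integration.simple_bochner_integrable.intros) auto
  note has_Bochner_integral_simple[OF this]
  also have "Bochner_Integration.simple_bochner_integral M (\<lambda>x. c) = measure M (space M) *\<^sub>R c"
    unfolding Bochner_Integration.simple_bochner_integral_def
    by (cases "space M = {}") (auto simp: image_constant_conv)
  finally show ?thesis .
qed

text \<open>The approximating functions are cut off where they exceed twice the norm of the limit, so that
  dominated convergence applies; completeness of the codomain does the rest.\<close>

lemma (in complete_measure) Bochner_integrable_has_integral:
  fixes f :: "'a \<Rightarrow> 'b::banach"
  assumes "Bochner_integrable M f"
  shows "has_Bochner_integral M f (Bochner_integral M f)"
proof -
  let ?I = "Bochner_Integration.simple_bochner_integral M"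
  have sm: "strongly_measurable M f" and fin: "(\<integral>\<^sup>+x. ennreal (norm (f x)) \<partial>M) < \<infinity>"
    using assms unfolding Bochner_integrable_def by auto
  obtain s where s: "\<And>i::nat. Bochner_Integration.simple_bochner_integrable M (s i)" "AE x in M. (\<lambda>i. s i x) \<longlonglongrightarrow> f x"
    using sm unfolding strongly_measurable_def by blast
  note [measurable] = borel_measurable_norm_strongly_measurable[OF sm]
  define t where "t i x = (if norm (s i x) \<le> 2 * norm (f x) then s i x else 0)" for i x
  have t: "Bochner_Integration.simple_bochner_integrable M (t i)" for i
  proof
    have [measurable]: "(\<lambda>x. norm (s i x)) \<in> borel_measurable M"
      by (intro borel_measurable_simple_bochner_integrable simple_bochner_integrable_norm s)
    have "simple_function M (s i)" using s(1)[of i] by (auto elim: Bochner_Integration.simple_bochner_integrable.cases)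
    then show "simple_function M (t i)"
      unfolding t_def by (intro simple_function_If simple_function_const) measurable
    have "emeasure M {y \<in> space M. t i y \<noteq> 0} \<le> emeasure M {y \<in> space M. s i y \<noteq> 0}"
      using \<open>simple_function M (s i)\<close>
      by (intro emeasure_mono) (auto simp: t_def split: if_splits)
    moreover have "emeasure M {y \<in> space M. s i y \<noteq> 0} \<noteq> \<infinity>"
      using s(1)[of i] by (auto elim: Bochner_Integration.simple_bochner_integrable.cases)
    ultimately show "emeasure M {y \<in> space M. t i y \<noteq> 0} \<noteq> \<infinity>"
      by (auto simp: top_unique)
  qed
  have tlim: "AE x in M. (\<lambda>i. t i x) \<longlonglongrightarrow> f x"
    using s(2)
  proof eventually_elim
    fix x assume lim: "(\<lambda>i. s i x) \<longlonglongrightarrow> f x"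
    show "(\<lambda>i. t i x) \<longlonglongrightarrow> f x"
    proof (cases "f x = 0")
      case True
      then have "t i x = 0" for i by (auto simp: t_def)
      then show ?thesis using True by simp
    next
      case False
      then have "norm (f x) < 2 * norm (f x)" by simp
      with tendsto_norm[OF lim] have "\<forall>\<^sub>F i in sequentially. norm (s i x) < 2 * norm (f x)"
        by (rule order_tendstoD)
      then have "\<forall>\<^sub>F i in sequentially. s i x = t i x"
        by eventually_elim (auto simp: t_def)
      with lim show ?thesis by (rule Lim_transform_eventually)
    qed
  qed
  note [measurable] = borel_measurable_norm_strongly_measurable[OF strongly_measurable_diff[OF sm strongly_measurable_simple[OF t]]]
  have lim: "(\<lambda>i. \<integral>\<^sup>+x. ennreal (norm (f x - t i x)) \<partial>M) \<longlonglongrightarrow> (\<integral>\<^sup>+x. 0 \<partial>M)"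
  proof (rule nn_integral_dominated_convergence[where w="\<lambda>x. 3 * ennreal (norm (f x))"])
    show "(\<integral>\<^sup>+x. 3 * ennreal (norm (f x)) \<partial>M) < \<infinity>"
      using fin by (subst nn_integral_cmult) (auto simp: ennreal_mult_less_top)
    show "AE x in M. ennreal (norm (f x - t i x)) \<le> 3 * ennreal (norm (f x))" for i
    proof (rule AE_I2)
      fix x
      have "norm (f x - t i x) \<le> norm (f x) + norm (t i x)" by (rule norm_triangle_ineq4)
      also have "\<dots> \<le> 3 * norm (f x)" by (auto simp: t_def)
      finally have "ennreal (norm (f x - t i x)) \<le> ennreal (3 * norm (f x))" by (rule ennreal_leI)
      then show "ennreal (norm (f x - t i x)) \<le> 3 * ennreal (norm (f x))" by (simp add: ennreal_mult)
    qed
    show "AE x in M. (\<lambda>i. ennreal (norm (f x - t i x))) \<longlonglongrightarrow> 0"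
      using tlim
    proof eventually_elim
      case (elim x)
      have "(\<lambda>i. norm (f x - t i x)) \<longlonglongrightarrow> norm (f x - f x)"
        by (intro tendsto_intros elim)
      then show ?case using tendsto_ennrealI by fastforce
    qed
  qed auto
  then have lim: "(\<lambda>i. \<integral>\<^sup>+x. ennreal (norm (f x - t i x)) \<partial>M) \<longlonglongrightarrow> 0" by simp
  have "Cauchy (\<lambda>i. ?I (t i))"
  proof (rule metric_CauchyI)
    fix e :: real assume e: "e > 0"
    then have "\<forall>\<^sub>F i in sequentially. (\<integral>\<^sup>+x. ennreal (norm (f x - t i x)) \<partial>M) < ennreal (e/2)"
      by (intro order_tendstoD(2)[OF lim]) auto
    then obtain N where N: "\<And>i. i \<ge> N \<Longrightarrow> (\<integral>\<^sup>+x. ennreal (norm (f x - t i x)) \<partial>M) < ennreal (e/2)"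
      by (auto simp: eventually_sequentially)
    have "dist (?I (t i)) (?I (t j)) < e" if "i \<ge> N" "j \<ge> N" for i j
    proof -
      have "ennreal (norm (?I (t i) - ?I (t j))) = ennreal (norm (?I (\<lambda>x. t i x - t j x)))"
        by (simp add: simple_bochner_integral_diff[OF t t])
      also have "\<dots> \<le> (\<integral>\<^sup>+x. ennreal (norm (t i x - t j x)) \<partial>M)"
        by (intro norm_simple_bochner_integral_le_nn_integral simple_bochner_integrable_diff t)
      also have "\<dots> \<le> (\<integral>\<^sup>+x. ennreal (norm (f x - t i x)) + ennreal (norm (f x - t j x)) \<partial>M)"
      proof (rule nn_integral_mono)
        fix x
        have "norm (t i x - t j x) \<le> norm (f x - t i x) + norm (f x - t j x)"
          by (metis dual_order.refl norm_diff_triangle_le norm_minus_commute)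
        then show "ennreal (norm (t i x - t j x)) \<le> ennreal (norm (f x - t i x)) + ennreal (norm (f x - t j x))"
          by (simp flip: ennreal_plus)
      qed
      also have "\<dots> = (\<integral>\<^sup>+x. ennreal (norm (f x - t i x)) \<partial>M) + (\<integral>\<^sup>+x. ennreal (norm (f x - t j x)) \<partial>M)"
        by (rule nn_integral_add) measurable
      also have "\<dots> < ennreal (e/2) + ennreal (e/2)"
        using N that by (intro add_strict_mono) auto
      also have "\<dots> = ennreal e" using e by (simp flip: ennreal_plus)
      finally show ?thesis using e by (simp add: dist_norm ennreal_less_iff)
    qed
    then show "\<exists>N. \<forall>i\<ge>N. \<forall>j\<ge>N. dist (?I (t i)) (?I (t j)) < e" by blast
  qed
  then obtain y where "(\<lambda>i. ?I (t i)) \<longlonglongrightarrow> y"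
    using Cauchy_convergent convergent_def by blast
  then have "has_Bochner_integral M f y"
    unfolding has_Bochner_integral_def using sm t lim by blast
  then show ?thesis using Bochner_integral_eq[of f y] by simp
qed

lemma (in complete_measure) complete_measure_restrict_space:
  assumes "A \<in> sets M"
  shows "complete_measure (restrict_space M A)"
proof
  fix B C assume "B \<subseteq> C" "C \<in> null_sets (restrict_space M A)"
  then have "C \<in> null_sets M" "C \<subseteq> A"
    using assms null_sets_restrict_space[of A M C] by (auto simp: null_sets_def sets_restrict_space)
  then have "B \<in> sets M" "B \<subseteq> A" using complete \<open>B \<subseteq> C\<close> by auto
  then show "B \<in> sets (restrict_space M A)"
    by (auto simp: sets_restrict_space)
qed

lemma Int_space_in_sets: "A \<in> sets M \<Longrightarrow> A \<inter> space M \<in> sets M"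
  by auto

lemma strongly_measurable_indicator:
  assumes A: "A \<in> sets M" and f: "strongly_measurable (restrict_space M A) f"
  shows "strongly_measurable M (\<lambda>x. indicator A x *\<^sub>R f x)"
proof -
  obtain s where s: "\<And>i::nat. Bochner_Integration.simple_bochner_integrable (restrict_space M A) (s i)"
      "AE x in restrict_space M A. (\<lambda>i. s i x) \<longlonglongrightarrow> f x"
    using f unfolding strongly_measurable_def by blast
  have "AE x in M. x \<in> A \<longrightarrow> (\<lambda>i. s i x) \<longlonglongrightarrow> f x"
    using s(2) A by (subst (asm) AE_restrict_space_iff) auto
  then have "AE x in M. (\<lambda>i. indicator A x *\<^sub>R s i x) \<longlonglongrightarrow> indicator A x *\<^sub>R f x"
    by eventually_elim (auto split: split_indicator)
  then show ?thesis
    unfolding strongly_measurable_def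
    using s(1) simple_bochner_integrable_restrict_space[OF Int_space_in_sets[OF A]]
    by (intro exI[of _ "\<lambda>i x. indicator A x *\<^sub>R s i x"]) auto
qed

text \<open>Integrals over different sets are compared as integrals over the whole space; this is how they
  are added up in \<open>Bochner_integral_union\<close>.\<close>

lemma has_Bochner_integral_indicator:
  assumes A: "A \<in> sets M" and f: "has_Bochner_integral (restrict_space M A) f y"
  shows "has_Bochner_integral M (\<lambda>x. indicator A x *\<^sub>R f x) y"
proof -
  obtain s where sm: "strongly_measurable (restrict_space M A) f"
    and s: "\<And>i::nat. Bochner_Integration.simple_bochner_integrable (restrict_space M A) (s i)"
    and lim: "(\<lambda>i. \<integral>\<^sup>+x. ennreal (norm (f x - s i x)) \<partial>restrict_space M A) \<longlonglongrightarrow> 0"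
    and y: "(\<lambda>i. Bochner_Integration.simple_bochner_integral (restrict_space M A) (s i)) \<longlonglongrightarrow> y"
    using f unfolding has_Bochner_integral_def by blast
  note A' = Int_space_in_sets[OF A]
  have "(\<integral>\<^sup>+x. ennreal (norm (f x - s i x)) \<partial>restrict_space M A)
      = (\<integral>\<^sup>+x. ennreal (norm (indicator A x *\<^sub>R f x - indicator A x *\<^sub>R s i x)) \<partial>M)" for i
    unfolding nn_integral_restrict_space[OF A']
    by (rule nn_integral_cong) (auto split: split_indicator)
  then have "(\<lambda>i. \<integral>\<^sup>+x. ennreal (norm (indicator A x *\<^sub>R f x - indicator A x *\<^sub>R s i x)) \<partial>M) \<longlonglongrightarrow> 0"
    using lim by simp
  moreover have "(\<lambda>i. Bochner_Integration.simple_bochner_integral M (\<lambda>x. indicator A x *\<^sub>R s i x)) \<longlonglongrightarrow> y"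
    using y simple_bochner_integral_restrict_space[OF A' s] by simp
  ultimately show ?thesis
    unfolding has_Bochner_integral_def
    using strongly_measurable_indicator[OF A sm] s simple_bochner_integrable_restrict_space[OF A']
    by (intro conjI exI[of _ "\<lambda>i x. indicator A x *\<^sub>R s i x"]) auto
qed

lemma strongly_measurable_restrict:
  assumes A: "A \<in> sets M" and f: "strongly_measurable M f"
  shows "strongly_measurable (restrict_space M A) f"
proof -
  obtain s where s: "\<And>i::nat. Bochner_Integration.simple_bochner_integrable M (s i)"
      "AE x in M. (\<lambda>i. s i x) \<longlonglongrightarrow> f x"
    using f unfolding strongly_measurable_def by blast
  note A' = Int_space_in_sets[OF A]
  have "Bochner_Integration.simple_bochner_integrable (restrict_space M A) (s i)" for i
    unfolding simple_bochner_integrable_restrict_space[OF A']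
  proof -
    have "Bochner_Integration.simple_bochner_integrable M (s i)" by (rule s)
    then have sf: "simple_function M (s i)" and fin: "emeasure M {y\<in>space M. s i y \<noteq> 0} \<noteq> \<infinity>"
      by (auto elim: Bochner_Integration.simple_bochner_integrable.cases)
    have "simple_function M (\<lambda>x. if x \<in> A then s i x else 0)"
      using sf A by (intro simple_function_If_set simple_function_const) auto
    also have "(\<lambda>x. if x \<in> A then s i x else 0) = (\<lambda>x. indicator A x *\<^sub>R s i x)"
      by (auto split: split_indicator)
    finally have sf': "simple_function M (\<lambda>x. indicator A x *\<^sub>R s i x)" .
    have "emeasure M {y\<in>space M. indicator A y *\<^sub>R s i y \<noteq> 0} \<le> emeasure M {y\<in>space M. s i y \<noteq> 0}"
      using sf by (intro emeasure_mono) auto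
    then show "Bochner_Integration.simple_bochner_integrable M (\<lambda>x. indicator A x *\<^sub>R s i x)"
      using fin sf' by (intro Bochner_Integration.simple_bochner_integrable.intros) (auto simp: top_unique)
  qed
  moreover have "AE x in restrict_space M A. (\<lambda>i. s i x) \<longlonglongrightarrow> f x"
    using s(2) A' by (subst AE_restrict_space_iff) auto
  ultimately show ?thesis unfolding strongly_measurable_def by blast
qed

lemma Bochner_integrable_restrict:
  assumes A: "A \<in> sets M" and f: "Bochner_integrable M f"
  shows "Bochner_integrable (restrict_space M A) f"
proof -
  have "(\<integral>\<^sup>+x. ennreal (norm (f x)) \<partial>restrict_space M A) \<le> (\<integral>\<^sup>+x. ennreal (norm (f x)) \<partial>M)"
    unfolding nn_integral_restrict_space[OF Int_space_in_sets[OF A]]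
    by (rule nn_integral_mono) (auto split: split_indicator)
  with f strongly_measurable_restrict[OF A] show ?thesis
    unfolding Bochner_integrable_def by (metis order_le_less_trans)
qed

lemma (in complete_measure) Bochner_integral_union:
  fixes f :: "'a \<Rightarrow> 'b::banach"
  assumes f: "Bochner_integrable M f" and [measurable]: "A \<in> sets M" "B \<in> sets M" and disj: "A \<inter> B = {}"
  shows "Bochner_integral (restrict_space M (A \<union> B)) f
    = Bochner_integral (restrict_space M A) f + Bochner_integral (restrict_space M B) f"
proof -
  have *: "has_Bochner_integral M (\<lambda>x. indicator C x *\<^sub>R f x) (Bochner_integral (restrict_space M C) f)"
    if "C \<in> sets M" for C
    by (intro has_Bochner_integral_indicator that complete_measure.Bochner_integrable_has_integral
        complete_measure_restrict_space Bochner_integrable_restrict f)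
  have "has_Bochner_integral M (\<lambda>x. indicator A x *\<^sub>R f x + indicator B x *\<^sub>R f x)
    (Bochner_integral (restrict_space M A) f + Bochner_integral (restrict_space M B) f)"
    by (intro has_Bochner_integral_add *) measurable
  also have "(\<lambda>x. indicator A x *\<^sub>R f x + indicator B x *\<^sub>R f x) = (\<lambda>x. indicator (A \<union> B) x *\<^sub>R f x)"
    using disj by (auto simp: fun_eq_iff split: split_indicator)
  finally show ?thesis
    using *[of "A \<union> B"] has_Bochner_integral_unique by auto
qed

section \<open>A covering inequality for pairs of measures on the line\<close>

text \<open>Among three intervals with a common point, the one reaching furthest to the left and the one
  reaching furthest to the right cover the third. A subcover of minimal cardinality therefore meets
  every point at most twice.\<close>

lemma open_interval_subcover_multiplicity_2:
  fixes c d :: "'i \<Rightarrow> real"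
  assumes I: "finite I" and cover: "K \<subseteq> (\<Union>i\<in>I. {c i<..<d i})"
  obtains J where "J \<subseteq> I" "K \<subseteq> (\<Union>i\<in>J. {c i<..<d i})" "\<And>x. card {i \<in> J. x \<in> {c i<..<d i}} \<le> 2"
proof -
  define P where "P J \<longleftrightarrow> J \<subseteq> I \<and> K \<subseteq> (\<Union>i\<in>J. {c i<..<d i})" for J
  have "P I" using cover by (auto simp: P_def)
  then obtain J where J: "P J" and min: "\<And>J'. P J' \<Longrightarrow> card J \<le> card J'"
    using ex_has_least_nat[of P I card] by blast
  have fin: "finite J" using J I by (auto simp: P_def intro: finite_subset)
  have "card {i \<in> J. x \<in> {c i<..<d i}} \<le> 2" for x
  proof (rule ccontr)
    let ?L = "{i \<in> J. x \<in> {c i<..<d i}}"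
    assume "\<not> card ?L \<le> 2"
    then have card: "card ?L > 2" by simp
    have finL: "finite ?L" using fin by simp
    have ne: "?L \<noteq> {}" using card by (metis card.empty not_less_zero)
    have "Min (c ` ?L) \<in> c ` ?L" using finL ne by (intro Min_in finite_imageI) blast+
    then obtain p where p: "p \<in> ?L" "c p = Min (c ` ?L)" by (metis (no_types, lifting) imageE)
    have pmin: "c p \<le> c i" if "i \<in> ?L" for i
      unfolding p(2) using finL that by (intro Min_le finite_imageI imageI)
    have "Max (d ` ?L) \<in> d ` ?L" using finL ne by (intro Max_in finite_imageI) blast+
    then obtain q where q: "q \<in> ?L" "d q = Max (d ` ?L)" by (metis (no_types, lifting) imageE)
    have qmax: "d i \<le> d q" if "i \<in> ?L" for i
      unfolding q(2) using finL that by (intro Max_ge finite_imageI imageI)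
    have "?L - {p, q} \<noteq> {}"
    proof
      assume "?L - {p, q} = {}"
      then have "card ?L \<le> card {p, q}" by (intro card_mono) auto
      also have "\<dots> \<le> 2" by (simp add: card_insert_if)
      finally show False using card by simp
    qed
    then obtain k where k: "k \<in> ?L" "k \<noteq> p" "k \<noteq> q" by blast
    have "{c k<..<d k} \<subseteq> {c p<..<d p} \<union> {c q<..<d q}"
      using p(1) q(1) k(1) pmin[OF k(1)] qmax[OF k(1)] by auto
    moreover have "p \<in> J - {k}" "q \<in> J - {k}" using p(1) q(1) k by auto
    ultimately have "(\<Union>i\<in>J. {c i<..<d i}) \<subseteq> (\<Union>i\<in>J - {k}. {c i<..<d i})" by blast
    then have "P (J - {k})"
      using J unfolding P_def by (meson Diff_subset subset_trans)
    then have "card J \<le> card (J - {k})" by (rule min)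
    moreover have "card (J - {k}) < card J" using k fin by (intro psubset_card_mono) auto
    ultimately show False by simp
  qed
  with J that show ?thesis unfolding P_def by blast
qed

text \<open>Pass to a compact subset of almost full \<open>\<mu>\<close>-measure and an open superset of almost equal
  \<open>\<rho>\<close>-measure, and cover the former, inside the latter, by finitely many of the given intervals with
  multiplicity at most two. The factor \<open>2\<close> is this multiplicity. A disjoint selection of Vitali type
  would have to enlarge intervals, and an arbitrary measure gives no control over the enlargement.\<close>

lemma fine_interval_cover_measure_le:
  fixes \<mu> \<rho> :: "real measure"
  assumes \<mu>: "finite_measure \<mu>" "sets \<mu> = sets borel" and \<rho>: "finite_measure \<rho>" "sets \<rho> = sets borel"
    and B: "B \<in> sets borel" and lam: "0 \<le> lam"
    and fine: "\<And>t r. t \<in> B \<Longrightarrow> 0 < r \<Longrightarrow>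
      \<exists>c d. c < t \<and> t < d \<and> d - c < r \<and> lam * measure \<mu> {c<..<d} \<le> measure \<rho> {c<..<d}"
  shows "lam * measure \<mu> B \<le> 2 * measure \<rho> B"
proof (cases "measure \<mu> B = 0")
  case False
  interpret \<mu>: finite_measure \<mu> by fact
  interpret \<rho>: finite_measure \<rho> by fact
  have pos: "measure \<mu> B > 0" using False by (simp add: zero_less_measure_iff)
  have *: "lam * (measure \<mu> B - e) \<le> 2 * (measure \<rho> B + e)" if e: "e > 0" for e
  proof -
    have "ennreal (measure \<mu> B - e) < emeasure \<mu> B"
      using e pos by (simp add: \<mu>.emeasure_eq_measure ennreal_less_iff ennreal_lessI)
    then obtain K where K: "K \<subseteq> B" "compact K" "ennreal (measure \<mu> B - e) < emeasure \<mu> K"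
      unfolding inner_regular[OF \<mu>(2) \<mu>.emeasure_finite[of "space \<mu>", unfolded infinity_ennreal_def[symmetric]] B] less_SUP_iff by auto
    have muK: "measure \<mu> B - e \<le> measure \<mu> K"
      using K(3) by (cases "measure \<mu> B - e \<ge> 0") (auto simp: \<mu>.emeasure_eq_measure ennreal_less_iff intro: order_trans[of _ 0])
    have "emeasure \<rho> B < ennreal (measure \<rho> B + e)"
      using e by (simp add: \<rho>.emeasure_eq_measure ennreal_lessI add_nonneg_pos)
    then obtain U where U: "B \<subseteq> U" "open U" "emeasure \<rho> U < ennreal (measure \<rho> B + e)"
      unfolding outer_regular[OF \<rho>(2) \<rho>.emeasure_finite[of "space \<rho>", unfolded infinity_ennreal_def[symmetric]] B] INF_less_iff by auto
    have rhoU: "measure \<rho> U \<le> measure \<rho> B + e"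
      using U(3) by (simp add: \<rho>.emeasure_eq_measure ennreal_less_iff)
    have "\<forall>t\<in>K. \<exists>c d. c < t \<and> t < d \<and> {c<..<d} \<subseteq> U \<and> lam * measure \<mu> {c<..<d} \<le> measure \<rho> {c<..<d}"
    proof
      fix t assume t: "t \<in> K"
      then obtain r where r: "r > 0" "ball t r \<subseteq> U" using K U open_contains_ball by blast
      obtain c d where cd: "c < t" "t < d" "d - c < r" "lam * measure \<mu> {c<..<d} \<le> measure \<rho> {c<..<d}"
        using fine[of t r] t K(1) r(1) by blast
      have "{c<..<d} \<subseteq> ball t r" using cd by (auto simp: dist_real_def)
      then show "\<exists>c d. c < t \<and> t < d \<and> {c<..<d} \<subseteq> U \<and> lam * measure \<mu> {c<..<d} \<le> measure \<rho> {c<..<d}"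
        using cd r(2) by blast
    qed
    then obtain c d where cd: "\<And>t. t \<in> K \<Longrightarrow> c t < t \<and> t < d t \<and> {c t<..<d t} \<subseteq> U \<and>
        lam * measure \<mu> {c t<..<d t} \<le> measure \<rho> {c t<..<d t}"
      by metis
    have "K \<subseteq> (\<Union>t\<in>K. {c t<..<d t})" using cd by force
    then obtain I where I: "I \<subseteq> K" "finite I" "K \<subseteq> (\<Union>t\<in>I. {c t<..<d t})"
      using compactE_image[OF \<open>compact K\<close>, of K "\<lambda>t. {c t<..<d t}"] by auto
    obtain J where J: "J \<subseteq> I" "K \<subseteq> (\<Union>t\<in>J. {c t<..<d t})" and mult: "\<And>x. card {i \<in> J. x \<in> {c i<..<d i}} \<le> 2"
      using open_interval_subcover_multiplicity_2[OF I(2,3)] by blast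
    have finJ: "finite J" using I J by (auto intro: finite_subset)
    have "measure \<mu> K \<le> measure \<mu> (\<Union>t\<in>J. {c t<..<d t})"
      using J finJ by (intro \<mu>.finite_measure_mono) (auto simp: \<mu>)
    also have "\<dots> \<le> (\<Sum>t\<in>J. measure \<mu> {c t<..<d t})"
      using finJ by (intro \<mu>.finite_measure_subadditive_finite) (auto simp: \<mu>)
    finally have "lam * measure \<mu> K \<le> lam * (\<Sum>t\<in>J. measure \<mu> {c t<..<d t})"
      using lam by (rule mult_left_mono)
    also have "\<dots> \<le> (\<Sum>t\<in>J. measure \<rho> {c t<..<d t})"
      unfolding sum_distrib_left using cd J I by (intro sum_mono) blast
    also have "\<dots> = (\<integral>x. (\<Sum>t\<in>J. indicator {c t<..<d t} x) \<partial>\<rho>)"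
      using finJ by (subst Bochner_Integration.integral_sum) (auto simp: \<rho> \<rho>.emeasure_eq_measure sets_eq_imp_space_eq[OF \<rho>(2)])
    also have "\<dots> \<le> (\<integral>x. 2 * indicator U x \<partial>\<rho>)"
    proof (rule integral_mono)
      fix x
      have "(\<Sum>t\<in>J. indicator {c t<..<d t} x) = real (card {i \<in> J. x \<in> {c i<..<d i}})"
        unfolding indicator_def using finJ by (simp add: sum.If_cases Int_def)
      moreover have "{i \<in> J. x \<in> {c i<..<d i}} = {}" if "x \<notin> U"
        using that cd J I by blast
      ultimately show "(\<Sum>t\<in>J. indicator {c t<..<d t} x) \<le> 2 * (indicator U x :: real)"
        using mult[of x] by (auto split: split_indicator)
    qed (use U finJ in \<open>auto simp: \<rho> \<rho>.emeasure_eq_measure intro!: integrable_mult_right integrable_real_indicator\<close>)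
    also have "\<dots> = 2 * measure \<rho> U"
      using U by (simp add: sets_eq_imp_space_eq[OF \<rho>(2)])
    finally have "lam * measure \<mu> K \<le> 2 * measure \<rho> U" .
    moreover have "lam * (measure \<mu> B - e) \<le> lam * measure \<mu> K"
      using muK lam by (rule mult_left_mono)
    ultimately have "lam * (measure \<mu> B - e) \<le> 2 * measure \<rho> U" by (rule order_trans[rotated])
    also have "\<dots> \<le> 2 * (measure \<rho> B + e)" using rhoU by simp
    finally show ?thesis .
  qed
  show ?thesis
  proof (rule field_le_epsilon)
    fix e :: real assume "e > 0"
    then have "e / (lam + 2) > 0" using lam by simp
    note *[OF this]
    moreover have "lam * (m - x) = lam * m - (lam + 2) * x + 2 * x" for m x :: real
      by (simp add: algebra_simps)
    moreover have "(lam + 2) * (e / (lam + 2)) = e" using lam by simp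
    ultimately show "lam * measure \<mu> B \<le> 2 * measure \<rho> B + e" by simp
  qed
qed simp

section \<open>Stieltjes measures and Lebesgue points\<close>

lemma space_stieltjes [simp]: "space (stieltjes_measure g) = UNIV"
  by (simp add: stieltjes_measure_def)

lemma borel_sets_stieltjes [measurable, intro]: "A \<in> sets borel \<Longrightarrow> A \<in> sets (stieltjes_measure g)"
  by (simp add: stieltjes_measure_def)

lemma sets_stieltjesE:
  assumes "A \<in> sets (stieltjes_measure g)"
  obtains B N where "B \<in> sets borel" "B \<subseteq> A" "A - B \<subseteq> N" "N \<in> null_sets (stieltjes_measure g)" "N \<in> sets borel"
proof -
  from assms obtain B N N' where *: "A = B \<union> N" "N \<subseteq> N'"
      "N' \<in> null_sets (distr (interval_measure (\<lambda>x. - g (- x))) borel uminus)"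
      "B \<in> sets (distr (interval_measure (\<lambda>x. - g (- x))) borel uminus)"
    unfolding stieltjes_measure_def by (rule sets_completionE)
  from *(3) have "N' \<in> null_sets (stieltjes_measure g)" "N' \<in> sets borel"
    unfolding stieltjes_measure_def by (auto intro: null_sets_completionI)
  with * show ?thesis by (intro that[of B N']) auto
qed

lemma complete_stieltjes: "complete_measure (stieltjes_measure g)"
  unfolding stieltjes_measure_def by (rule completion.complete_measure_axioms)

lemma complete_stieltjes_on: "A \<in> sets borel \<Longrightarrow> complete_measure (stieltjes_on g A)"
  by (intro complete_measure.complete_measure_restrict_space complete_stieltjes borel_sets_stieltjes)

lemma derivatorD:
  assumes "derivator g"
  shows "x \<le> y \<Longrightarrow> g x \<le> g y" and "(g \<longlongrightarrow> g t) (at_left t)"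
  using assms by (auto simp: derivator_def mono_def continuous_within)

lemma measure_stieltjes_Ico:
  assumes "derivator g" "c \<le> d"
  shows "measure (stieltjes_measure g) {c..<d} = g d - g c"
  using emeasure_stieltjes_Ico[OF assms] derivatorD(1)[OF assms]
  by (simp add: measure_def)

lemma space_stieltjes_on [simp]: "space (stieltjes_on g A) = A"
  by (simp add: space_restrict_space)

lemma stieltjes_on_restrict:
  assumes "A \<in> sets borel" "B \<in> sets borel" "B \<subseteq> A"
  shows "restrict_space (stieltjes_on g A) B = stieltjes_on g B"
  using assms by (subst restrict_restrict_space) (auto simp: Int_absorb1)

lemma finite_stieltjes_on:
  assumes "derivator g"
  shows "finite_measure (stieltjes_on g {a..<b})"
proof
  have "emeasure (stieltjes_measure g) {a..<b} \<noteq> \<infinity>"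
    using emeasure_stieltjes_Ico[OF assms, of a b] by (cases "a \<le> b") auto
  then show "emeasure (stieltjes_on g {a..<b}) (space (stieltjes_on g {a..<b})) \<noteq> \<infinity>"
    by (simp add: emeasure_restrict_space)
qed

lemma Ico_in_sets_stieltjes_on: "{c..<d} \<subseteq> A \<Longrightarrow> {c..<d} \<in> sets (stieltjes_on g A)"
  by (auto simp: sets_restrict_space)

lemma id_measurable_stieltjes_on: "(\<lambda>x. x) \<in> measurable (stieltjes_on g A) borel"
  by (intro measurable_restrict_space1) (auto simp: measurable_def)

text \<open>For every \<open>q\<close> in a countable set dense in the essential range of \<open>f\<close>, the covering inequality
  for \<open>\<mu>\<^sub>g\<close> and the measure with density \<open>\<parallel>f - q\<parallel>\<close> shows that the points where
  \<open>\<parallel>f(t) - q\<parallel> < e\<close> but some arbitrarily short interval around \<open>t\<close> has mean of \<open>\<parallel>f - q\<parallel>\<close> at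
  least \<open>3e\<close> form a null set: the constant \<open>3\<close> exceeds the \<open>2\<close> of that inequality. At every other
  point, choose \<open>q\<close> close to \<open>f(t)\<close>. The half-open interval \<open>[x,y)\<close> is approximated by open ones from
  the left, which costs nothing because \<open>g\<close> is left-continuous.\<close>

theorem AE_Lebesgue_point:
  fixes f :: "real \<Rightarrow> 'b::real_normed_vector"
  assumes g: "derivator g" and f: "Bochner_integrable (stieltjes_on g {a..<b}) f"
  shows "AE t in stieltjes_on g {a..<b}. \<forall>\<epsilon>>0. \<exists>r>0. \<forall>x y. a \<le> x \<longrightarrow> x \<le> t \<longrightarrow> t < y \<longrightarrow> y \<le> b \<longrightarrow> y - x < r \<longrightarrow>
    (\<integral>\<^sup>+s. ennreal (norm (f s - f t)) \<partial>stieltjes_on g {x..<y}) \<le> ennreal (\<epsilon> * (g y - g x))"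
proof -
  let ?S = "stieltjes_measure g"
  let ?M = "stieltjes_on g {a..<b}"
  interpret M: finite_measure ?M by (rule finite_stieltjes_on[OF g])
  interpret M: complete_measure ?M by (rule complete_stieltjes_on) simp
  note [measurable] = id_measurable_stieltjes_on
  have sm: "strongly_measurable ?M f" and fin: "(\<integral>\<^sup>+x. ennreal (norm (f x)) \<partial>?M) < \<infinity>"
    using f by (auto simp: Bochner_integrable_def)
  obtain D where D: "countable D" "AE x in ?M. f x \<in> closure D"
    using strongly_measurable_separable[OF sm] .
  have meas [measurable]: "(\<lambda>s. norm (f s - q)) \<in> borel_measurable ?M" for q
    by (intro M.borel_measurable_norm_strongly_measurable strongly_measurable_diff sm
        strongly_measurable_const M.finite_measure_axioms)
  have fin_q: "(\<integral>\<^sup>+x. ennreal (norm (f x - q)) \<partial>?M) < \<infinity>" for q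
  proof -
    have [measurable]: "(\<lambda>s. norm (f s)) \<in> borel_measurable ?M" using meas[of 0] by simp
    have "(\<integral>\<^sup>+x. ennreal (norm (f x - q)) \<partial>?M) \<le> (\<integral>\<^sup>+x. ennreal (norm (f x)) + ennreal (norm q) \<partial>?M)"
      by (intro nn_integral_mono) (simp add: norm_triangle_ineq4 flip: ennreal_plus)
    also have "\<dots> = (\<integral>\<^sup>+x. ennreal (norm (f x)) \<partial>?M) + (\<integral>\<^sup>+x. ennreal (norm q) \<partial>?M)"
      by (rule nn_integral_add) auto
    also have "\<dots> < \<infinity>"
    proof -
      have "emeasure ?M {a..<b} < top" using M.emeasure_finite[of "{a..<b}"] by (subst less_top[symmetric]) simp
      then show ?thesis using fin by (simp add: ennreal_mult_less_top)
    qed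
    finally show ?thesis .
  qed
  define \<mu> where "\<mu> = distr ?M borel (\<lambda>x. x)"
  define \<rho> where "\<rho> q = distr (density ?M (\<lambda>s. ennreal (norm (f s - q)))) borel (\<lambda>x. x)" for q
  have sets: "sets \<mu> = sets borel" "sets (\<rho> q) = sets borel" for q by (auto simp: \<mu>_def \<rho>_def)
  have em_\<mu>: "emeasure \<mu> A = emeasure ?M (A \<inter> {a..<b})" if "A \<in> sets borel" for A
    using that by (simp add: \<mu>_def emeasure_distr)
  have int_sets: "A \<inter> {a..<b} \<in> sets ?M" if "A \<in> sets borel" for A
    using that by (auto simp: sets_restrict_space)
  have em_\<rho>: "emeasure (\<rho> q) A = (\<integral>\<^sup>+s. ennreal (norm (f s - q)) * indicator A s \<partial>?M)" if "A \<in> sets borel" for A q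
  proof -
    have "emeasure (\<rho> q) A = emeasure (density ?M (\<lambda>s. ennreal (norm (f s - q)))) (A \<inter> {a..<b})"
      using that by (simp add: \<rho>_def emeasure_distr)
    also have "\<dots> = (\<integral>\<^sup>+s. ennreal (norm (f s - q)) * indicator (A \<inter> {a..<b}) s \<partial>?M)"
      using that int_sets by (intro emeasure_density) auto
    also have "\<dots> = (\<integral>\<^sup>+s. ennreal (norm (f s - q)) * indicator A s \<partial>?M)"
      by (rule nn_integral_cong) (auto split: split_indicator)
    finally show ?thesis .
  qed
  interpret \<mu>: finite_measure \<mu>
    unfolding \<mu>_def by (rule M.finite_measure_distr) measurable
  have fin\<rho>: "finite_measure (\<rho> q)" for q
  proof
    show "emeasure (\<rho> q) (space (\<rho> q)) \<noteq> \<infinity>"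
      using fin_q[of q] em_\<rho>[of UNIV q] by (auto simp: \<rho>_def)
  qed
  define heavy where "heavy q e r c d \<longleftrightarrow> d - c < r \<and> 3 * e * measure \<mu> {c<..<d} \<le> measure (\<rho> q) {c<..<d}" for q e r c d
  \<comment> \<open>The second set is an intersection of countably many open sets; this gives measurability.\<close>
  define N where "N q n = {t \<in> space ?M. norm (f t - q) < 1 / Suc n} \<inter>
      (\<Inter>k. \<Union>{I. \<exists>c d. I = {c<..<d} \<and> heavy q (1 / Suc n) (1 / Suc k) c d})" for q and n :: nat
  have N_null: "N q n \<in> null_sets ?M" for q n
  proof -
    let ?e = "1 / real (Suc n)"
    let ?G = "\<Inter>k. \<Union>{I. \<exists>c d. I = {c<..<d} \<and> heavy q ?e (1 / Suc k) c d}"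
    have "\<Union>{I. \<exists>c d. I = {c<..<d} \<and> heavy q ?e (1 / Suc k) c d} \<in> sets borel" for k
      by (intro borel_open open_Union) auto
    then have "?G \<in> sets borel"
      by (intro sets.countable_INT) auto
    then have G: "?G \<inter> {a..<b} \<in> sets ?M" by (rule int_sets)
    have "{t \<in> space ?M. norm (f t - q) < 1 / Suc n} \<in> sets ?M" by measurable
    then have "{t \<in> space ?M. norm (f t - q) < 1 / Suc n} \<inter> (?G \<inter> {a..<b}) \<in> sets ?M"
      using G by (rule sets.Int)
    also have "{t \<in> space ?M. norm (f t - q) < 1 / Suc n} \<inter> (?G \<inter> {a..<b}) = N q n"
      by (auto simp: N_def)
    finally have Nsets: "N q n \<in> sets ?M" .
    then have "N q n \<in> sets ?S" by (auto simp: sets_restrict_space)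
    \<comment> \<open>Regularity is a property of Borel sets, so the set is first replaced by a Borel subset of full measure.\<close>
    then obtain B Z where B: "B \<in> sets borel" "B \<subseteq> N q n" "N q n - B \<subseteq> Z" "Z \<in> null_sets ?S" "Z \<in> sets borel"
      by (rule sets_stieltjesE)
    have "3 * ?e * measure \<mu> B \<le> 2 * measure (\<rho> q) B"
    proof (rule fine_interval_cover_measure_le[OF \<mu>.finite_measure_axioms sets(1) fin\<rho> sets(2) B(1)])
      fix t r :: real assume t: "t \<in> B" and r: "0 < r"
      obtain k where k: "1 / real (Suc k) < r"
        using reals_Archimedean[OF r] by (auto simp: inverse_eq_divide)
      have "t \<in> \<Union>{I. \<exists>c d. I = {c<..<d} \<and> heavy q ?e (1 / Suc k) c d}"
        using t B(2) unfolding N_def by auto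
      then obtain c d where "t \<in> {c<..<d}" "heavy q ?e (1 / Suc k) c d" by auto
      then show "\<exists>c d. c < t \<and> t < d \<and> d - c < r \<and> 3 * ?e * measure \<mu> {c<..<d} \<le> measure (\<rho> q) {c<..<d}"
        using k unfolding heavy_def by (intro exI[of _ c] exI[of _ d]) auto
    qed auto
    moreover have "measure (\<rho> q) B \<le> ?e * measure \<mu> B"
    proof -
      have "emeasure (\<rho> q) B = (\<integral>\<^sup>+s. ennreal (norm (f s - q)) * indicator B s \<partial>?M)"
        by (rule em_\<rho>[OF B(1)])
      also have "\<dots> \<le> (\<integral>\<^sup>+s. ennreal ?e * indicator (B \<inter> {a..<b}) s \<partial>?M)"
        using B(2) by (intro nn_integral_mono) (auto simp: N_def split: split_indicator intro!: ennreal_leI)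
      also have "\<dots> = ennreal ?e * emeasure \<mu> B"
        unfolding em_\<mu>[OF B(1)] by (rule nn_integral_cmult_indicator[OF int_sets[OF B(1)]])
      finally show ?thesis
        using fin\<rho>[of q]
        by (simp add: finite_measure.emeasure_eq_measure \<mu>.emeasure_eq_measure ennreal_mult[symmetric])
    qed
    ultimately have "?e * measure \<mu> B \<le> 0" by linarith
    then have "measure \<mu> B \<le> 0" by (simp add: field_simps)
    then have "emeasure \<mu> B = 0" by (simp add: \<mu>.emeasure_eq_measure ennreal_eq_0_iff)
    then have "B \<inter> {a..<b} \<in> null_sets ?M"
      unfolding em_\<mu>[OF B(1)] by (rule null_setsI[OF _ int_sets[OF B(1)]])
    moreover have "B \<inter> {a..<b} = B" using B(2) by (auto simp: N_def)
    ultimately have "B \<in> null_sets ?M" by simp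
    moreover have "Z \<inter> {a..<b} \<in> null_sets ?M"
      using B(4) by (subst null_sets_restrict_space) (auto intro!: null_set_Int2 borel_sets_stieltjes)
    ultimately have "B \<union> Z \<inter> {a..<b} \<in> null_sets ?M" by (rule null_sets.Un)
    moreover have "N q n \<subseteq> B \<union> Z \<inter> {a..<b}" using B(3) by (auto simp: N_def)
    ultimately show ?thesis using Nsets by (rule_tac null_sets_subset)
  qed
  have "AE t in ?M. \<forall>q\<in>D. \<forall>n. t \<notin> N q n"
    using D(1) N_null by (subst AE_ball_countable) (auto simp: AE_all_countable intro: AE_not_in)
  then show ?thesis
    using D(2) AE_space
  proof eventually_elim
    fix t assume good: "\<forall>q\<in>D. \<forall>n. t \<notin> N q n" and cl: "f t \<in> closure D" and t: "t \<in> space ?M"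
    show "\<forall>\<epsilon>>0. \<exists>r>0. \<forall>x y. a \<le> x \<longrightarrow> x \<le> t \<longrightarrow> t < y \<longrightarrow> y \<le> b \<longrightarrow> y - x < r \<longrightarrow>
      (\<integral>\<^sup>+s. ennreal (norm (f s - f t)) \<partial>stieltjes_on g {x..<y}) \<le> ennreal (\<epsilon> * (g y - g x))"
    proof (intro allI impI)
      fix \<epsilon> :: real assume \<epsilon>: "\<epsilon> > 0"
      then have "\<epsilon> / 4 > 0" by simp
      then obtain n where n: "1 / real (Suc n) < \<epsilon> / 4"
        using reals_Archimedean[of "\<epsilon> / 4"] by (auto simp: inverse_eq_divide)
      define e where "e = 1 / real (Suc n)"
      have e: "0 < e" "e < \<epsilon> / 4" using n by (auto simp: e_def)
      obtain q where q: "q \<in> D" "dist q (f t) < e"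
        using cl e(1) unfolding closure_approachable by blast
      have qt: "norm (f t - q) < e" using q(2) by (simp add: dist_norm norm_minus_commute)
      have "t \<notin> N q n" using good q(1) by blast
      then obtain k where k: "t \<notin> \<Union>{I. \<exists>c d. I = {c<..<d} \<and> heavy q e (1 / Suc k) c d}"
        using t qt unfolding N_def e_def by auto
      show "\<exists>r>0. \<forall>x y. a \<le> x \<longrightarrow> x \<le> t \<longrightarrow> t < y \<longrightarrow> y \<le> b \<longrightarrow> y - x < r \<longrightarrow>
        (\<integral>\<^sup>+s. ennreal (norm (f s - f t)) \<partial>stieltjes_on g {x..<y}) \<le> ennreal (\<epsilon> * (g y - g x))"
      proof (intro exI[of _ "1 / real (Suc k)"] conjI allI impI)
        fix x y assume xy: "a \<le> x" "x \<le> t" "t < y" "y \<le> b" "y - x < 1 / real (Suc k)"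
        have gxy: "g x \<le> g y" using xy derivatorD(1)[OF g] by simp
        have sub: "{x..<y} \<subseteq> {a..<b}" using xy by auto
        have Isets: "{x..<y} \<in> sets ?M" by (rule Ico_in_sets_stieltjes_on[OF sub])
        let ?J = "\<integral>\<^sup>+s. ennreal (norm (f s - q)) * indicator {x..<y} s \<partial>?M"
        have J_fin: "?J < \<infinity>"
          by (rule order_le_less_trans[OF _ fin_q[of q]]) (auto intro!: nn_integral_mono split: split_indicator)
        have "enn2real ?J \<le> 3 * e * (g y - g c)" if c: "c < x" "y - c < 1 / real (Suc k)" for c
        proof -
          have "t \<in> {c<..<y}" using c xy by simp
          then have "\<not> heavy q e (1 / Suc k) c y" using k by blast
          then have less: "measure (\<rho> q) {c<..<y} < 3 * e * measure \<mu> {c<..<y}"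
            using c by (simp add: heavy_def)
          have "measure \<mu> {c<..<y} \<le> g y - g c"
          proof -
            have "emeasure \<mu> {c<..<y} = emeasure ?S ({c<..<y} \<inter> {a..<b})"
              by (simp add: em_\<mu> emeasure_restrict_space)
            also have "\<dots> \<le> emeasure ?S {c..<y}" by (intro emeasure_mono) auto
            also have "\<dots> = ennreal (g y - g c)" using c xy by (intro emeasure_stieltjes_Ico g) auto
            finally show ?thesis
              using derivatorD(1)[OF g, of c y] c xy by (simp add: \<mu>.emeasure_eq_measure)
          qed
          then have "3 * e * measure \<mu> {c<..<y} \<le> 3 * e * (g y - g c)" using e by simp
          moreover have "?J \<le> ennreal (measure (\<rho> q) {c<..<y})"
          proof -
            have "?J \<le> (\<integral>\<^sup>+s. ennreal (norm (f s - q)) * indicator {c<..<y} s \<partial>?M)"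
              using c by (intro nn_integral_mono) (auto split: split_indicator)
            also have "\<dots> = emeasure (\<rho> q) {c<..<y}" by (simp add: em_\<rho>)
            also have "\<dots> = ennreal (measure (\<rho> q) {c<..<y})"
              by (rule finite_measure.emeasure_eq_measure[OF fin\<rho>])
            finally show ?thesis .
          qed
          then have "enn2real ?J \<le> measure (\<rho> q) {c<..<y}" by (simp add: enn2real_leI)
          ultimately show ?thesis using less by linarith
        qed
        then have "\<forall>\<^sub>F c in at_left x. enn2real ?J \<le> 3 * e * (g y - g c)"
          using xy(5) unfolding eventually_at_left_field
          by (intro exI[of _ "y - 1 / real (Suc k)"]) (auto simp: algebra_simps)
        moreover have "((\<lambda>c. 3 * e * (g y - g c)) \<longlongrightarrow> 3 * e * (g y - g x)) (at_left x)"
          by (intro tendsto_intros derivatorD(2)[OF g])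
        ultimately have "enn2real ?J \<le> 3 * e * (g y - g x)"
          by (intro tendsto_lowerbound[of "\<lambda>c. 3 * e * (g y - g c)" _ "at_left x"]) auto
        then have J: "?J \<le> ennreal (3 * e * (g y - g x))"
          using ennreal_enn2real[of ?J] J_fin ennreal_leI[of "enn2real ?J"] by (simp only: infinity_ennreal_def)
        have "(\<integral>\<^sup>+s. ennreal (norm (f s - f t)) \<partial>stieltjes_on g {x..<y})
            = (\<integral>\<^sup>+s. ennreal (norm (f s - f t)) * indicator {x..<y} s \<partial>?M)"
          using Isets sub
          by (subst stieltjes_on_restrict[of "{a..<b}" "{x..<y}" g, symmetric])
            (auto simp: nn_integral_restrict_space Int_absorb2)
        also have "\<dots> \<le> (\<integral>\<^sup>+s. ennreal (norm (f s - q)) * indicator {x..<y} s + ennreal e * indicator {x..<y} s \<partial>?M)"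
        proof (rule nn_integral_mono)
          fix s
          have "norm (f s - f t) \<le> norm (f s - q) + norm (f t - q)"
            using dist_triangle2[of "f s" "f t" q] by (simp add: dist_norm)
          then have "norm (f s - f t) \<le> norm (f s - q) + e" using qt by simp
          then show "ennreal (norm (f s - f t)) * indicator {x..<y} s
              \<le> ennreal (norm (f s - q)) * indicator {x..<y} s + ennreal e * indicator {x..<y} s"
            using e by (auto split: split_indicator simp flip: ennreal_plus)
        qed
        also have "\<dots> = ?J + (\<integral>\<^sup>+s. ennreal e * indicator {x..<y} s \<partial>?M)"
          using Isets by (intro nn_integral_add) auto
        also have "(\<integral>\<^sup>+s. ennreal e * indicator {x..<y} s \<partial>?M) = ennreal e * emeasure ?M {x..<y}"
          using Isets by (rule nn_integral_cmult_indicator)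
        also have "emeasure ?M {x..<y} = ennreal (g y - g x)"
          using sub xy by (subst emeasure_restrict_space) (auto intro!: emeasure_stieltjes_Ico g)
        also have "?J + ennreal e * ennreal (g y - g x) \<le> ennreal (3 * e * (g y - g x)) + ennreal (e * (g y - g x))"
          using J e gxy by (intro add_mono) (auto simp: ennreal_mult)
        also have "\<dots> = ennreal (4 * e * (g y - g x))"
          using e gxy by (simp flip: ennreal_plus)
        also have "\<dots> \<le> ennreal (\<epsilon> * (g y - g x))"
          using e gxy by (intro ennreal_leI mult_right_mono) auto
        finally show "(\<integral>\<^sup>+s. ennreal (norm (f s - f t)) \<partial>stieltjes_on g {x..<y}) \<le> ennreal (\<epsilon> * (g y - g x))" .
      qed simp
    qed
  qed
qed

section \<open>One-sided limits, exceptional points and uniqueness of the strong derivative\<close>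

lemma derivator_right_limit:
  assumes g: "derivator g"
  shows "(g \<longlongrightarrow> g t + right_jump g t) (at_right t)" and "0 \<le> right_jump g t"
proof -
  define L where "L = (INF s\<in>{t<..}. g s)"
  have bdd: "bdd_below (g ` {t<..})"
    by (rule bdd_belowI2[of _ "g t"]) (auto intro: derivatorD(1)[OF g])
  have lim: "(g \<longlongrightarrow> L) (at_right t)"
  proof (rule order_tendstoI)
    fix c assume "c < L"
    then have "c < g s" if "t < s" for s
      using cINF_lower[OF bdd, of s] that unfolding L_def by auto
    then show "\<forall>\<^sub>F s in at_right t. c < g s"
      using eventually_at_right_less[of t] by (auto elim: eventually_mono)
  next
    fix c assume "L < c"
    then obtain s where s: "t < s" "g s < c"
      unfolding L_def by (subst (asm) cINF_less_iff) (auto intro: bdd)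
    then have "g x < c" if "x \<in> {t<..<s}" for x
      using derivatorD(1)[OF g, of x s] that by simp
    then show "\<forall>\<^sub>F s in at_right t. g s < c"
      using s(1) eventually_at_right[of t s] by auto
  qed
  then have "Lim (at_right t) g = L" by (intro tendsto_Lim) auto
  then have *: "g t + right_jump g t = L" by (simp add: right_jump_def)
  with lim show "(g \<longlongrightarrow> g t + right_jump g t) (at_right t)" by simp
  have "g t \<le> L"
    unfolding L_def by (rule cINF_greatest) (auto intro: derivatorD(1)[OF g])
  with * show "0 \<le> right_jump g t" by simp
qed

lemma derivator_continuous_right:
  assumes g: "derivator g" and "t \<notin> jump_set g"
  shows "(g \<longlongrightarrow> g t) (at_right t)"
proof -
  have "right_jump g t = 0" using derivator_right_limit(2)[OF g, of t] assms(2) by (simp add: jump_set_def)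
  with derivator_right_limit(1)[OF g, of t] show ?thesis by simp
qed

lemma const_setI:
  assumes "x < t" "t < y" and eq: "\<And>s. x < s \<Longrightarrow> s < y \<Longrightarrow> g s = g t"
  shows "t \<in> const_set g"
proof -
  define m where "m = min (t - x) (y - t)"
  have "m > 0" using assms by (simp add: m_def)
  moreover have "g s = g t" if "s \<in> {t - m<..<t + m}" for s
    using that by (intro eq) (auto simp: m_def)
  ultimately show ?thesis unfolding const_set_def by blast
qed

lemma open_const_set: "open (const_set g)"
proof (subst open_subopen, rule ballI)
  fix t assume "t \<in> const_set g"
  then obtain e where e: "e > 0" "\<And>s. s \<in> {t - e<..<t + e} \<Longrightarrow> g s = g t"
    unfolding const_set_def by blast
  have "x \<in> const_set g" if x: "x \<in> {t - e<..<t + e}" for x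
  proof (rule const_setI)
    show "t - e < x" "x < t + e" using x by simp_all
    show "g s = g x" if "t - e < s" "s < t + e" for s
      using e(2)[of s] e(2)[OF x] that by simp
  qed
  then have "{t - e<..<t + e} \<subseteq> const_set g" by blast
  moreover have "t \<in> {t - e<..<t + e}" using e(1) by simp
  ultimately show "\<exists>T. open T \<and> t \<in> T \<and> T \<subseteq> const_set g"
    using open_greaterThanLessThan by blast
qed

text \<open>The component of \<open>C\<^sub>g\<close> that contains \<open>(t,y)\<close> is an interval. Unless \<open>t\<close> belongs to \<open>C\<^sub>g\<close>, it
  cannot reach past \<open>t\<close>, so \<open>t\<close> is its infimum.\<close>

lemma const_right_imp_exceptional:
  assumes y: "t < y" and eq: "\<And>s. t < s \<Longrightarrow> s < y \<Longrightarrow> g s = c" and t: "t \<notin> jump_set g"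
  shows "t \<in> const_set g \<union> const_endpoints g"
proof (cases "t \<in> const_set g")
  case False
  have sub: "{t<..<y} \<subseteq> const_set g"
    using eq by (auto intro!: const_setI[of t _ y])
  define m where "m = (t + y) / 2"
  have m: "m \<in> {t<..<y}" using y by (auto simp: m_def)
  define K where "K = connected_component_set (const_set g) m"
  have K: "K \<in> components (const_set g)"
    using sub m unfolding K_def by (intro componentsI) auto
  have "{t<..<y} \<subseteq> K"
    unfolding K_def using sub m by (intro connected_component_maximal) auto
  have above: "t < k" if k: "k \<in> K" for k
  proof (rule ccontr)
    assume "\<not> t < k"
    moreover have "connected K" using K by (rule in_components_connected)
    moreover have "m \<in> K" using \<open>{t<..<y} \<subseteq> K\<close> m by blast
    ultimately have "t \<in> K"
      using k m connectedD_interval[of K k m t] by auto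
    then show False using in_components_subset[OF K] False by blast
  qed
  have "bdd_below K" by (rule bdd_belowI[of _ t]) (use above in force)
  moreover have "Inf K = t"
  proof (rule cInf_eq_non_empty)
    show "K \<noteq> {}" using \<open>{t<..<y} \<subseteq> K\<close> m by blast
    show "t \<le> k" if "k \<in> K" for k using above[OF that] by simp
    fix z assume z: "\<And>k. k \<in> K \<Longrightarrow> z \<le> k"
    show "z \<le> t"
    proof (rule field_le_epsilon)
      fix e :: real assume e: "e > 0"
      have "t + min (e / 2) ((y - t) / 2) \<in> {t<..<y}" using e y by (auto simp: min_def field_simps)
      then have "z \<le> t + min (e / 2) ((y - t) / 2)" using z \<open>{t<..<y} \<subseteq> K\<close> by blast
      also have "\<dots> \<le> t + e" using e by auto
      finally show "z \<le> t + e" .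
    qed
  qed
  ultimately show ?thesis using K t unfolding const_endpoints_def by blast
qed simp

lemma countable_const_endpoints: "countable (const_endpoints g)"
proof -
  have "countable (components (const_set g))"
  proof (rule countable_disjoint_open_subsets)
    show "open S" if "S \<in> components (const_set g)" for S
      using that open_components[OF open_const_set] by blast
    show "disjoint (components (const_set g))"
      using pairwise_disjoint_components[of "const_set g"] by (simp add: disjoint_def pairwise_def disjnt_def)
  qed
  then have "countable (Inf ` components (const_set g) \<union> Sup ` components (const_set g))" by auto
  then show ?thesis
    by (rule countable_subset[rotated]) (auto simp: const_endpoints_def)
qed

text \<open>Countably many intervals with rational endpoints on which \<open>g\<close> does not increase cover \<open>C\<^sub>g\<close>, and
  \<open>N\<^sub>g\<close> is a countable set of points at which \<open>g\<close> does not jump.\<close>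

lemma AE_not_exceptional:
  assumes g: "derivator g" and A: "A \<in> sets borel"
  shows "AE t in stieltjes_on g A. t \<notin> const_set g \<union> const_endpoints g"
proof -
  let ?S = "stieltjes_measure g"
  have "{x} \<in> null_sets ?S" if x: "x \<in> const_endpoints g" for x
  proof -
    have "x \<notin> jump_set g" using x by (simp add: const_endpoints_def)
    then have "((\<lambda>y. ennreal (g y - g x)) \<longlongrightarrow> ennreal (g x - g x)) (at_right x)"
      by (intro tendsto_ennrealI tendsto_intros derivator_continuous_right g)
    moreover have "\<forall>\<^sub>F y in at_right x. emeasure ?S {x} \<le> ennreal (g y - g x)"
      using eventually_at_right_less[of x]
    proof eventually_elim
      case (elim y)
      have "emeasure ?S {x} \<le> emeasure ?S {x..<y}"
        using elim by (intro emeasure_mono) auto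
      also have "\<dots> = ennreal (g y - g x)" using elim by (intro emeasure_stieltjes_Ico g) simp
      finally show ?case .
    qed
    ultimately have "emeasure ?S {x} \<le> ennreal (g x - g x)"
      by (intro tendsto_lowerbound[of _ _ "at_right x"]) auto
    then show ?thesis by (intro null_setsI) auto
  qed
  then have "(\<Union>x\<in>const_endpoints g. {x}) \<in> null_sets ?S"
    by (intro null_sets_UN' countable_const_endpoints)
  then have N: "const_endpoints g \<in> null_sets ?S" by simp
  define R where "R = {p \<in> \<rat> \<times> \<rat>. fst p < snd p \<and> g (fst p) = g (snd p)}"
  have "countable R" unfolding R_def by (rule countable_subset[OF _ countable_SIGMA]) (auto intro: countable_rat)
  moreover have "{fst p..<snd p} \<in> null_sets ?S" if "p \<in> R" for p
    using that emeasure_stieltjes_Ico[OF g, of "fst p" "snd p"] by (intro null_setsI) (auto simp: R_def)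
  ultimately have "(\<Union>p\<in>R. {fst p..<snd p}) \<in> null_sets ?S"
    by (intro null_sets_UN') auto
  moreover have "const_set g \<subseteq> (\<Union>p\<in>R. {fst p..<snd p})"
  proof
    fix t assume "t \<in> const_set g"
    then obtain e where e: "e > 0" "\<And>s. s \<in> {t - e<..<t + e} \<Longrightarrow> g s = g t"
      unfolding const_set_def by blast
    obtain p where p: "p \<in> \<rat>" "t - e < p" "p < t" using Rats_dense_in_real[of "t - e" t] e(1) by auto
    obtain q where q: "q \<in> \<rat>" "t < q" "q < t + e" using Rats_dense_in_real[of t "t + e"] e(1) by auto
    have "g p = g t" "g q = g t" using e(2)[of p] e(2)[of q] p q by auto
    then have "(p, q) \<in> R" using p q by (auto simp: R_def)
    then show "t \<in> (\<Union>p\<in>R. {fst p..<snd p})" using p q by force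
  qed
  moreover have "const_set g \<in> sets ?S" by (intro borel_sets_stieltjes borel_open open_const_set)
  ultimately have "const_set g \<in> null_sets ?S" using null_sets_subset by blast
  with N have "const_set g \<union> const_endpoints g \<in> null_sets ?S" by (rule null_sets.Un[rotated])
  then have "AE t in ?S. t \<notin> const_set g \<union> const_endpoints g" by (rule AE_not_in)
  then show ?thesis using A by (subst AE_restrict_space_iff) (auto simp: borel_sets_stieltjes)
qed

text \<open>Outside \<open>C\<^sub>g \<union> N\<^sub>g\<close> the point \<open>t\<close> is a limit of points where \<open>g\<close> takes other values, so the limit
  defining the derivative is determined.\<close>

lemma has_g_derivative_unique:
  assumes "has_g_derivative g a b f t y" "has_g_derivative g a b f t z"
  shows "y = z"
proof (cases "t \<in> jump_set g")
  case True
  then obtain k l where "(f \<longlongrightarrow> k) (at_right t)" "y = (k - f t) /\<^sub>R right_jump g t"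
      "(f \<longlongrightarrow> l) (at_right t)" "z = (l - f t) /\<^sub>R right_jump g t"
    using assms unfolding has_g_derivative_def by auto
  moreover from this have "k = l" by (intro tendsto_unique[of "at_right t"]) auto
  ultimately show ?thesis by simp
next
  case False
  let ?A = "{s \<in> {a..b}. g s \<noteq> g t}"
  have t: "a \<le> t" "t < b" "t \<notin> const_set g" "t \<notin> const_endpoints g"
    using assms(1) by (auto simp: has_g_derivative_def)
  have "t islimpt ?A"
  proof (rule ccontr)
    assume "\<not> t islimpt ?A"
    then obtain e where e: "e > 0" "\<And>s. s \<in> ?A \<Longrightarrow> s \<noteq> t \<Longrightarrow> \<bar>s - t\<bar> < e \<Longrightarrow> False"
      unfolding islimpt_approachable_real by blast
    have eq: "g s = g t" if "a \<le> s" "s \<le> b" "\<bar>s - t\<bar> < e" for s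
      using e(2)[of s] that by auto
    have "t \<in> const_set g \<union> const_endpoints g"
    proof (rule const_right_imp_exceptional)
      show "t < min b (t + e)" using t e(1) by simp
      show "g s = g t" if "t < s" "s < min b (t + e)" for s
        using that t by (intro eq) auto
    qed (rule False)
    with t show False by simp
  qed
  then have "at t within ?A \<noteq> bot" using trivial_limit_within[of t ?A] by blast
  moreover have "((\<lambda>s. (f s - f t) /\<^sub>R (g s - g t)) \<longlongrightarrow> y) (at t within ?A)"
    "((\<lambda>s. (f s - f t) /\<^sub>R (g s - g t)) \<longlongrightarrow> z) (at t within ?A)"
    using assms False unfolding has_g_derivative_def by simp_all
  ultimately show ?thesis by (rule tendsto_unique)
qed

lemma g_derivative_eq:
  assumes "has_g_derivative g a b f t y"
  shows "g_derivative g a b f t = y"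
  unfolding g_derivative_def using assms has_g_derivative_unique by blast

section \<open>Differentiability at Lebesgue points\<close>

text \<open>In the applications \<open>J x y\<close> is the integral of \<open>\<parallel>f - f(t)\<parallel>\<close> over \<open>[x,y)\<close>. The smallness of \<open>J\<close>
  only concerns intervals that contain \<open>t\<close>. For a difference quotient from the left, the interval
  \<open>[x,t)\<close> is enlarged to \<open>[x,d)\<close> with \<open>d\<close> decreasing to \<open>t\<close>; this works because \<open>g\<close> has no jump at \<open>t\<close>.
  At a jump the estimate from the right alone gives the limit. The function \<open>F\<close> and the value \<open>c\<close> are
  kept apart from \<open>f\<close>, so that the lemma also covers the variation function, with \<open>c = \<parallel>f(t)\<parallel>\<close>.\<close>

lemma has_g_derivative_at_Lebesgue_point:
  fixes F :: "real \<Rightarrow> 'b::real_normed_vector"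
  assumes g: "derivator g" and t: "t \<in> {a..<b}" "t \<notin> const_set g \<union> const_endpoints g"
    and leb: "\<And>\<epsilon>. 0 < \<epsilon> \<Longrightarrow> \<exists>r>0. \<forall>x y. a \<le> x \<longrightarrow> x \<le> t \<longrightarrow> t < y \<longrightarrow> y \<le> b \<longrightarrow> y - x < r \<longrightarrow>
      J x y \<le> ennreal (\<epsilon> * (g y - g x))"
    and J_mono: "\<And>x y. a \<le> x \<Longrightarrow> x \<le> t \<Longrightarrow> t \<le> y \<Longrightarrow> y \<le> b \<Longrightarrow> J x t \<le> J x y"
    and F: "\<And>x y. a \<le> x \<Longrightarrow> x \<le> t \<Longrightarrow> t \<le> y \<Longrightarrow> y \<le> b \<Longrightarrow>
      ennreal (norm (F y - F x - (g y - g x) *\<^sub>R c)) \<le> J x y"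
  shows "has_g_derivative g a b F t c"
proof -
  have right: "\<exists>r>0. \<forall>y. t < y \<longrightarrow> y \<le> b \<longrightarrow> y - t < r \<longrightarrow>
      norm (F y - F t - (g y - g t) *\<^sub>R c) \<le> \<epsilon> * (g y - g t)" if \<epsilon>: "\<epsilon> > 0" for \<epsilon>
  proof -
    from leb[OF \<epsilon>] obtain r where r: "r > 0" "\<And>x y. a \<le> x \<Longrightarrow> x \<le> t \<Longrightarrow> t < y \<Longrightarrow> y \<le> b \<Longrightarrow> y - x < r \<Longrightarrow>
      J x y \<le> ennreal (\<epsilon> * (g y - g x))" by blast
    have "norm (F y - F t - (g y - g t) *\<^sub>R c) \<le> \<epsilon> * (g y - g t)" if y: "t < y" "y \<le> b" "y - t < r" for y
    proof -
      have "ennreal (norm (F y - F t - (g y - g t) *\<^sub>R c)) \<le> ennreal (\<epsilon> * (g y - g t))"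
        using F[of t y] r(2)[of t y] y t(1) by (auto intro: order_trans)
      moreover have "0 \<le> \<epsilon> * (g y - g t)" using \<epsilon> y derivatorD(1)[OF g, of t y] by simp
      ultimately show ?thesis by simp
    qed
    with r(1) show ?thesis by blast
  qed
  show ?thesis
  proof (cases "t \<in> jump_set g")
    case True
    let ?\<Delta> = "right_jump g t"
    have \<Delta>: "?\<Delta> > 0" using True by (simp add: jump_set_def)
    have glim: "((\<lambda>s. g s - g t) \<longlongrightarrow> ?\<Delta>) (at_right t)"
      using tendsto_diff[OF derivator_right_limit(1)[OF g, of t] tendsto_const[of "g t"]] by simp
    have "((\<lambda>s. F s - F t - (g s - g t) *\<^sub>R c) \<longlongrightarrow> 0) (at_right t)"
    proof (rule tendstoI)
      fix e :: real assume e: "e > 0"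
      define \<epsilon> where "\<epsilon> = e / (?\<Delta> + 1)"
      have \<epsilon>: "\<epsilon> > 0" using e \<Delta> by (simp add: \<epsilon>_def)
      obtain r where r: "r > 0" "\<And>y. t < y \<Longrightarrow> y \<le> b \<Longrightarrow> y - t < r \<Longrightarrow>
          norm (F y - F t - (g y - g t) *\<^sub>R c) \<le> \<epsilon> * (g y - g t)"
        using right[OF \<epsilon>] by blast
      have "\<forall>\<^sub>F s in at_right t. s \<in> {t<..<min b (t + r)}"
        using t(1) r(1) by (intro eventually_at_right_real) auto
      moreover have "\<forall>\<^sub>F s in at_right t. g s - g t < ?\<Delta> + 1"
        by (rule order_tendstoD(2)[OF glim]) simp
      ultimately show "\<forall>\<^sub>F s in at_right t. dist (F s - F t - (g s - g t) *\<^sub>R c) 0 < e"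
      proof eventually_elim
        case (elim s)
        have "norm (F s - F t - (g s - g t) *\<^sub>R c) \<le> \<epsilon> * (g s - g t)" using elim by (intro r(2)) auto
        also have "\<dots> < \<epsilon> * (?\<Delta> + 1)" using elim \<epsilon> by simp
        also have "\<dots> = e" using \<Delta> by (simp add: \<epsilon>_def)
        finally show ?case by simp
      qed
    qed
    from tendsto_add[OF this tendsto_add[OF tendsto_scaleR[OF glim tendsto_const[of c]] tendsto_const[of "F t"]]]
    have "(F \<longlongrightarrow> ?\<Delta> *\<^sub>R c + F t) (at_right t)" by simp
    then show ?thesis
      unfolding has_g_derivative_def using t True \<Delta> by (auto intro!: exI[of _ "?\<Delta> *\<^sub>R c + F t"])
  next
    case False
    have gr: "(g \<longlongrightarrow> g t) (at_right t)" by (rule derivator_continuous_right[OF g False])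
    have left: "\<exists>r>0. \<forall>x. a \<le> x \<longrightarrow> x < t \<longrightarrow> t - x < r \<longrightarrow>
        norm (F t - F x - (g t - g x) *\<^sub>R c) \<le> \<epsilon> * (g t - g x)" if \<epsilon>: "\<epsilon> > 0" for \<epsilon>
    proof -
      from leb[OF \<epsilon>] obtain r where r: "r > 0" "\<And>x y. a \<le> x \<Longrightarrow> x \<le> t \<Longrightarrow> t < y \<Longrightarrow> y \<le> b \<Longrightarrow> y - x < r \<Longrightarrow>
        J x y \<le> ennreal (\<epsilon> * (g y - g x))" by blast
      have "norm (F t - F x - (g t - g x) *\<^sub>R c) \<le> \<epsilon> * (g t - g x)" if x: "a \<le> x" "x < t" "t - x < r" for x
      proof (rule tendsto_lowerbound)
        show "((\<lambda>y. \<epsilon> * (g y - g x)) \<longlongrightarrow> \<epsilon> * (g t - g x)) (at_right t)"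
          by (intro tendsto_intros gr)
        have "\<forall>\<^sub>F y in at_right t. y \<in> {t<..<min b (x + r)}"
          using t(1) x by (intro eventually_at_right_real) auto
        then show "\<forall>\<^sub>F y in at_right t. norm (F t - F x - (g t - g x) *\<^sub>R c) \<le> \<epsilon> * (g y - g x)"
        proof eventually_elim
          case (elim y)
          have "ennreal (norm (F t - F x - (g t - g x) *\<^sub>R c)) \<le> J x t" using x t by (intro F) auto
          also have "\<dots> \<le> J x y" using x t elim by (intro J_mono) auto
          also have "\<dots> \<le> ennreal (\<epsilon> * (g y - g x))" using x t elim by (intro r(2)) auto
          finally show ?case using \<epsilon> x elim derivatorD(1)[OF g, of x y] by simp
        qed
      qed simp
      with r(1) show ?thesis by blast
    qed
    let ?A = "{s \<in> {a..b}. g s \<noteq> g t}"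
    have "((\<lambda>s. (F s - F t) /\<^sub>R (g s - g t)) \<longlongrightarrow> c) (at t within ?A)"
    proof (rule tendstoI)
      fix e :: real assume "e > 0"
      then have e: "e / 2 > 0" by simp
      obtain r where r: "r > 0" "\<And>y. t < y \<Longrightarrow> y \<le> b \<Longrightarrow> y - t < r \<Longrightarrow>
          norm (F y - F t - (g y - g t) *\<^sub>R c) \<le> e / 2 * (g y - g t)"
        using right[OF e] by blast
      obtain l where l: "l > 0" "\<And>x. a \<le> x \<Longrightarrow> x < t \<Longrightarrow> t - x < l \<Longrightarrow>
          norm (F t - F x - (g t - g x) *\<^sub>R c) \<le> e / 2 * (g t - g x)"
        using left[OF e] by blast
      have "dist ((F s - F t) /\<^sub>R (g s - g t)) c < e"
        if s: "s \<in> ?A" "s \<noteq> t" "dist s t < min r l" for s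
      proof -
        have ne: "g s - g t \<noteq> 0" using s by simp
        have "norm (F s - F t - (g s - g t) *\<^sub>R c) \<le> e / 2 * \<bar>g s - g t\<bar>"
        proof (cases "t < s")
          case True
          then show ?thesis using r(2)[of s] s derivatorD(1)[OF g, of t s] by (auto simp: dist_real_def)
        next
          case False
          then have "norm (F t - F s - (g t - g s) *\<^sub>R c) \<le> e / 2 * (g t - g s)"
            using l(2)[of s] s by (auto simp: dist_real_def)
          moreover have "F s - F t - (g s - g t) *\<^sub>R c = - (F t - F s - (g t - g s) *\<^sub>R c)"
            by (simp add: algebra_simps)
          then have "norm (F s - F t - (g s - g t) *\<^sub>R c) = norm (F t - F s - (g t - g s) *\<^sub>R c)"
            by (simp only: norm_minus_cancel)
          moreover have "\<bar>g s - g t\<bar> = g t - g s" using False derivatorD(1)[OF g, of s t] by simp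
          ultimately show ?thesis by simp
        qed
        then have le: "norm (F s - F t - (g s - g t) *\<^sub>R c) / \<bar>g s - g t\<bar> \<le> e / 2"
          using ne by (simp add: pos_divide_le_eq)
        have "(F s - F t) /\<^sub>R (g s - g t) - c = (F s - F t - (g s - g t) *\<^sub>R c) /\<^sub>R (g s - g t)"
          using ne by (simp add: scaleR_diff_right)
        then have "dist ((F s - F t) /\<^sub>R (g s - g t)) c = norm (F s - F t - (g s - g t) *\<^sub>R c) / \<bar>g s - g t\<bar>"
          by (simp add: dist_norm divide_inverse mult.commute)
        also have "\<dots> \<le> e / 2" by (rule le)
        finally show ?thesis using e by linarith
      qed
      then show "\<forall>\<^sub>F s in at t within ?A. dist ((F s - F t) /\<^sub>R (g s - g t)) c < e"
        unfolding eventually_at using r(1) l(1) by (intro exI[of _ "min r l"]) auto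
    qed
    then show ?thesis
      unfolding has_g_derivative_def using t False by simp
  qed
qed

lemma nn_integral_stieltjes_on:
  assumes "A \<in> sets borel"
  shows "(\<integral>\<^sup>+s. h s \<partial>stieltjes_on g A) = (\<integral>\<^sup>+s. h s * indicator A s \<partial>stieltjes_measure g)"
  using assms by (subst nn_integral_restrict_space) (auto simp: borel_sets_stieltjes)

lemma nn_integral_stieltjes_on_mono_set:
  assumes "A \<in> sets borel" "B \<in> sets borel" "A \<subseteq> B"
  shows "(\<integral>\<^sup>+s. h s \<partial>stieltjes_on g A) \<le> (\<integral>\<^sup>+s. h s \<partial>stieltjes_on g B)"
  unfolding nn_integral_stieltjes_on[OF assms(1)] nn_integral_stieltjes_on[OF assms(2)]
  using assms(3) by (intro nn_integral_mono) (auto split: split_indicator)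

lemma Bochner_integrable_stieltjes_on_subset:
  assumes "Bochner_integrable (stieltjes_on g B) f" "A \<in> sets borel" "B \<in> sets borel" "A \<subseteq> B"
  shows "Bochner_integrable (stieltjes_on g A) f"
proof -
  have "A \<in> sets (stieltjes_on g B)"
    using assms by (auto simp: sets_restrict_space borel_sets_stieltjes)
  from Bochner_integrable_restrict[OF this assms(1)] show ?thesis
    using assms by (simp add: stieltjes_on_restrict)
qed

lemma Bochner_integral_stieltjes_diff:
  fixes f :: "real \<Rightarrow> 'b::banach"
  assumes f: "Bochner_integrable (stieltjes_on g {a..<b}) f" and xy: "a \<le> x" "x \<le> y" "y \<le> b"
  shows "Bochner_integral (stieltjes_on g {a..<y}) f - Bochner_integral (stieltjes_on g {a..<x}) f
    = Bochner_integral (stieltjes_on g {x..<y}) f"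
proof -
  interpret complete_measure "stieltjes_on g {a..<b}" by (rule complete_stieltjes_on) simp
  have "Bochner_integral (restrict_space (stieltjes_on g {a..<b}) ({a..<x} \<union> {x..<y})) f
    = Bochner_integral (restrict_space (stieltjes_on g {a..<b}) {a..<x}) f
      + Bochner_integral (restrict_space (stieltjes_on g {a..<b}) {x..<y}) f"
    using xy by (intro Bochner_integral_union f Ico_in_sets_stieltjes_on) auto
  moreover have "{a..<x} \<union> {x..<y} = {a..<y}" using xy by auto
  ultimately show ?thesis
    using xy by (simp add: stieltjes_on_restrict)
qed

lemma norm_Bochner_integral_stieltjes_le:
  fixes f :: "real \<Rightarrow> 'b::banach"
  assumes g: "derivator g" and f: "Bochner_integrable (stieltjes_on g {x..<y}) f" and xy: "x \<le> y"
  shows "ennreal (norm (Bochner_integral (stieltjes_on g {x..<y}) f - (g y - g x) *\<^sub>R c))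
    \<le> (\<integral>\<^sup>+s. ennreal (norm (f s - c)) \<partial>stieltjes_on g {x..<y})"
proof -
  interpret complete_measure "stieltjes_on g {x..<y}" by (rule complete_stieltjes_on) simp
  interpret finite_measure "stieltjes_on g {x..<y}" by (rule finite_stieltjes_on[OF g])
  have "measure (stieltjes_on g {x..<y}) {x..<y} = g y - g x"
    using measure_stieltjes_Ico[OF g xy] by (simp add: measure_restrict_space borel_sets_stieltjes)
  then have "has_Bochner_integral (stieltjes_on g {x..<y}) (\<lambda>_. c) ((g y - g x) *\<^sub>R c)"
    using has_Bochner_integral_const[of c] by simp
  from has_Bochner_integral_norm_bound[OF has_Bochner_integral_diff[OF Bochner_integrable_has_integral[OF f] this]]
  show ?thesis .
qed

theorem AE_has_g_derivative_Bochner_integral: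
  fixes u f :: "real \<Rightarrow> 'b::banach"
  assumes g: "derivator g" and f: "Bochner_integrable (stieltjes_on g {a..<b}) f"
    and u: "\<And>t. t \<in> {a..b} \<Longrightarrow> u t = u a + Bochner_integral (stieltjes_on g {a..<t}) f"
  shows "AE t in stieltjes_on g {a..<b}. has_g_derivative g a b u t (f t)"
  using AE_Lebesgue_point[OF g f] AE_not_exceptional[OF g atLeastLessThan_borel[of a b]] AE_space
proof eventually_elim
  fix t
  assume leb: "\<forall>\<epsilon>>0. \<exists>r>0. \<forall>x y. a \<le> x \<longrightarrow> x \<le> t \<longrightarrow> t < y \<longrightarrow> y \<le> b \<longrightarrow> y - x < r \<longrightarrow>
      (\<integral>\<^sup>+s. ennreal (norm (f s - f t)) \<partial>stieltjes_on g {x..<y}) \<le> ennreal (\<epsilon> * (g y - g x))"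
    and exc: "t \<notin> const_set g \<union> const_endpoints g" and t: "t \<in> space (stieltjes_on g {a..<b})"
  show "has_g_derivative g a b u t (f t)"
  proof (rule has_g_derivative_at_Lebesgue_point[OF g, where J = "\<lambda>x y. \<integral>\<^sup>+s. ennreal (norm (f s - f t)) \<partial>stieltjes_on g {x..<y}"])
    fix x y assume xy: "a \<le> x" "x \<le> t" "t \<le> y" "y \<le> b"
    have "u y - u x = Bochner_integral (stieltjes_on g {x..<y}) f"
      using Bochner_integral_stieltjes_diff[OF f, of x y] u[of x] u[of y] xy by simp
    moreover have "Bochner_integrable (stieltjes_on g {x..<y}) f"
      using xy by (intro Bochner_integrable_stieltjes_on_subset[OF f]) auto
    ultimately show "ennreal (norm (u y - u x - (g y - g x) *\<^sub>R f t))
        \<le> (\<integral>\<^sup>+s. ennreal (norm (f s - f t)) \<partial>stieltjes_on g {x..<y})"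
      using norm_Bochner_integral_stieltjes_le[OF g, of x y f "f t"] xy by simp
  next
    fix \<epsilon> :: real assume "0 < \<epsilon>"
    with leb show "\<exists>r>0. \<forall>x y. a \<le> x \<longrightarrow> x \<le> t \<longrightarrow> t < y \<longrightarrow> y \<le> b \<longrightarrow> y - x < r \<longrightarrow>
      (\<integral>\<^sup>+s. ennreal (norm (f s - f t)) \<partial>stieltjes_on g {x..<y}) \<le> ennreal (\<epsilon> * (g y - g x))"
      by blast
  next
    fix x y assume "t \<le> y"
    then show "(\<integral>\<^sup>+s. ennreal (norm (f s - f t)) \<partial>stieltjes_on g {x..<t})
        \<le> (\<integral>\<^sup>+s. ennreal (norm (f s - f t)) \<partial>stieltjes_on g {x..<y})"
      by (intro nn_integral_stieltjes_on_mono_set) auto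
  qed (use exc t in simp_all)
qed

section \<open>Absolutely continuous functions have bounded variation\<close>

text \<open>These are the partitions over which \<^const>\<open>variation\<close> takes its supremum.\<close>

definition partition :: "real \<Rightarrow> real \<Rightarrow> nat \<Rightarrow> (nat \<Rightarrow> real) \<Rightarrow> bool" where
  "partition a b n p \<longleftrightarrow> p 0 = a \<and> p n = b \<and> (\<forall>i<n. p i < p (Suc i))"

lemma partition_less:
  assumes "partition a b n p" "i < j" "j \<le> n"
  shows "p i < p j"
  using assms(2,3)
proof (induction j)
  case (Suc j)
  have "p j < p (Suc j)" using assms(1) Suc.prems by (simp add: partition_def)
  then show ?case using Suc by (cases "i = j") auto
qed simp

lemma partition_le:
  assumes "partition a b n p" "i \<le> j" "j \<le> n"
  shows "p i \<le> p j"
  using partition_less[OF assms(1), of i j] assms(2,3) by (cases "i = j") auto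

lemma partition_bounds:
  assumes "partition a b n p" "i \<le> n"
  shows "p i \<in> {a..b}"
  using partition_le[OF assms(1), of 0 i] partition_le[OF assms(1), of i n] assms
  by (simp add: partition_def)

lemma AC_g_partition:
  assumes "AC_g g a b u" "0 < \<epsilon>"
  obtains \<delta> where "0 < \<delta>" "\<And>c d n p I. a \<le> c \<Longrightarrow> d \<le> b \<Longrightarrow> partition c d n p \<Longrightarrow> I \<subseteq> {..<n} \<Longrightarrow>
      (\<Sum>i\<in>I. g (p (Suc i)) - g (p i)) < \<delta> \<Longrightarrow> (\<Sum>i\<in>I. norm (u (p (Suc i)) - u (p i))) < \<epsilon>"
proof -
  from assms obtain \<delta> where \<delta>: "\<delta> > 0" "\<And>(n::nat) l r. (\<And>i. i < n \<Longrightarrow> l i \<in> {a..b} \<and> r i \<in> {a..b} \<and> l i < r i) \<Longrightarrow>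
        disjoint_family_on (\<lambda>i. {l i<..<r i}) {..<n} \<Longrightarrow>
        (\<Sum>i<n. g (r i) - g (l i)) < \<delta> \<Longrightarrow> (\<Sum>i<n. norm (u (r i) - u (l i))) < \<epsilon>"
    unfolding AC_g_def by blast
  show ?thesis
  proof (rule that[OF \<delta>(1)])
    fix c d n p and I :: "nat set"
    assume cd: "a \<le> c" "d \<le> b" and p: "partition c d n p" and I: "I \<subseteq> {..<n}"
      and less: "(\<Sum>i\<in>I. g (p (Suc i)) - g (p i)) < \<delta>"
    have "finite I" using I finite_subset by blast
    then obtain h where h: "bij_betw h {..<card I} I"
      using ex_bij_betw_nat_finite[of I] by (auto simp: lessThan_atLeast0)
    have hI: "h j < n" if "j < card I" for j using h I that by (auto simp: bij_betw_def)
    have reindex: "(\<Sum>j<card I. f (h j)) = (\<Sum>i\<in>I. f i)" for f :: "nat \<Rightarrow> real"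
      by (rule sum.reindex_bij_betw[OF h])
    have "(\<Sum>j<card I. norm (u (p (Suc (h j))) - u (p (h j)))) < \<epsilon>"
    proof (rule \<delta>(2))
      show "p (h j) \<in> {a..b} \<and> p (Suc (h j)) \<in> {a..b} \<and> p (h j) < p (Suc (h j))" if "j < card I" for j
        using partition_bounds[OF p, of "h j"] partition_bounds[OF p, of "Suc (h j)"] hI[OF that] cd p
        by (auto simp: partition_def)
      show "disjoint_family_on (\<lambda>j. {p (h j)<..<p (Suc (h j))}) {..<card I}"
        unfolding disjoint_family_on_def
      proof (intro ballI impI)
        fix i j assume ij: "i \<in> {..<card I}" "j \<in> {..<card I}" "i \<noteq> j"
        then have "h i \<noteq> h j" using h by (auto simp: bij_betw_def inj_on_def)
        then consider "Suc (h i) \<le> h j" | "Suc (h j) \<le> h i" by linarith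
        then show "{p (h i)<..<p (Suc (h i))} \<inter> {p (h j)<..<p (Suc (h j))} = {}"
        proof cases
          case 1
          then have "p (Suc (h i)) \<le> p (h j)" using hI[of j] ij by (intro partition_le[OF p]) auto
          then show ?thesis by auto
        next
          case 2
          then have "p (Suc (h j)) \<le> p (h i)" using hI[of i] ij by (intro partition_le[OF p]) auto
          then show ?thesis by auto
        qed
      qed
      show "(\<Sum>j<card I. g (p (Suc (h j))) - g (p (h j))) < \<delta>"
        using less reindex[of "\<lambda>i. g (p (Suc i)) - g (p i)"] by simp
    qed
    then show "(\<Sum>i\<in>I. norm (u (p (Suc i)) - u (p i))) < \<epsilon>"
      using reindex[of "\<lambda>i. norm (u (p (Suc i)) - u (p i))"] by simp
  qed
qed

lemma AC_g_increment:
  assumes "AC_g g a b u" "0 < \<epsilon>"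
  obtains \<delta> where "0 < \<delta>" "\<And>x y. a \<le> x \<Longrightarrow> x \<le> y \<Longrightarrow> y \<le> b \<Longrightarrow> g y - g x < \<delta> \<Longrightarrow> norm (u y - u x) < \<epsilon>"
proof -
  obtain \<delta> where \<delta>: "\<delta> > 0" "\<And>c d n p I. a \<le> c \<Longrightarrow> d \<le> b \<Longrightarrow> partition c d n p \<Longrightarrow> I \<subseteq> {..<n} \<Longrightarrow>
      (\<Sum>i\<in>I. g (p (Suc i)) - g (p i)) < \<delta> \<Longrightarrow> (\<Sum>i\<in>I. norm (u (p (Suc i)) - u (p i))) < \<epsilon>"
    using AC_g_partition[OF assms] by blast
  show ?thesis
  proof (rule that[OF \<delta>(1)])
    fix x y assume xy: "a \<le> x" "x \<le> y" "y \<le> b" "g y - g x < \<delta>"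
    show "norm (u y - u x) < \<epsilon>"
    proof (cases "x = y")
      case False
      have "partition x y 1 (\<lambda>i. if i = 0 then x else y)" using xy False by (simp add: partition_def)
      from \<delta>(2)[OF _ _ this, of "{0}"] xy show ?thesis by simp
    qed (use assms in simp)
  qed
qed

text \<open>Cut the range of \<open>g\<close> into finitely many classes of length below \<open>\<delta>\<close>. The increments of a partition
  that stay within one class have total norm below \<open>1\<close>, because the corresponding increments of
  \<open>g\<close> sum to at most the length of the class. The others change the class index, which happens only
  boundedly often, and each of them is bounded because \<open>u\<close> is.\<close>

lemma AC_g_bounded_variation:
  assumes g: "derivator g" and ab: "a \<le> b" and ac: "AC_g g a b u"
  obtains C where "0 \<le> C" "\<And>n p. partition a b n p \<Longrightarrow> (\<Sum>i<n. norm (u (p (Suc i)) - u (p i))) \<le> C"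
proof -
  obtain \<delta> where \<delta>: "\<delta> > 0" "\<And>c d n p I. a \<le> c \<Longrightarrow> d \<le> b \<Longrightarrow> partition c d n p \<Longrightarrow> I \<subseteq> {..<n} \<Longrightarrow>
      (\<Sum>i\<in>I. g (p (Suc i)) - g (p i)) < \<delta> \<Longrightarrow> (\<Sum>i\<in>I. norm (u (p (Suc i)) - u (p i))) < 1"
    using AC_g_partition[OF ac, of 1] by auto
  obtain \<eta> where \<eta>: "\<eta> > 0" "\<And>x y. a \<le> x \<Longrightarrow> x \<le> y \<Longrightarrow> y \<le> b \<Longrightarrow> g y - g x < \<eta> \<Longrightarrow> norm (u y - u x) < 1"
    using AC_g_increment[OF ac, of 1] by auto
  define h where "h = min \<delta> \<eta> / 2"
  have h: "h > 0" "h < \<delta>" "h < \<eta>" using \<delta>(1) \<eta>(1) by (auto simp: h_def)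
  \<comment> \<open>the index of the class that contains \<open>g(t)\<close>\<close>
  define \<kappa> where "\<kappa> t = nat \<lfloor>(g t - g a) / h\<rfloor>" for t
  have \<kappa>_mono: "\<kappa> x \<le> \<kappa> y" if "x \<le> y" for x y
    unfolding \<kappa>_def using derivatorD(1)[OF g that] h(1)
    by (intro nat_mono floor_mono divide_right_mono) auto
  have cls: "g a + real k * h \<le> g t \<and> g t < g a + real k * h + h" if "a \<le> t" "\<kappa> t = k" for t k
  proof -
    have "0 \<le> (g t - g a) / h" using derivatorD(1)[OF g that(1)] h(1) by simp
    then have "real k \<le> (g t - g a) / h" "(g t - g a) / h < real k + 1"
      using that(2) unfolding \<kappa>_def by linarith+
    then show ?thesis using h(1) by (simp add: field_simps)
  qed
  define N where "N = \<kappa> b"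
  have \<kappa>_le: "\<kappa> t \<le> N" if "t \<le> b" for t unfolding N_def by (rule \<kappa>_mono[OF that])
  define r where "r k = (SOME t. t \<in> {a..b} \<and> \<kappa> t = k)" for k
  have close: "norm (u t - u s) < 1" if st: "s \<in> {a..b}" "t \<in> {a..b}" "s \<le> t" "\<kappa> s = \<kappa> t" for s t
  proof (rule \<eta>(2))
    show "g t - g s < \<eta>" using cls[of s "\<kappa> s"] cls[of t "\<kappa> s"] st h by simp
  qed (use st in auto)
  define r where "r k = (SOME t. t \<in> {a..b} \<and> \<kappa> t = k)" for k
  define B where "B = (\<Sum>k\<le>N. norm (u (r k))) + 1"
  have bounded: "norm (u t) \<le> B" if t: "t \<in> {a..b}" for t
  proof -
    have r: "r (\<kappa> t) \<in> {a..b} \<and> \<kappa> (r (\<kappa> t)) = \<kappa> t"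
      unfolding r_def by (rule someI[of _ t]) (use t in simp)
    have "norm (u t - u (r (\<kappa> t))) < 1"
    proof (cases "t \<le> r (\<kappa> t)")
      case True
      then show ?thesis using close[of t "r (\<kappa> t)"] r t by (simp add: norm_minus_commute)
    next
      case False
      then show ?thesis using close[of "r (\<kappa> t)" t] r t by simp
    qed
    moreover have "norm (u t) \<le> norm (u (r (\<kappa> t))) + norm (u t - u (r (\<kappa> t)))"
      by (rule norm_triangle_sub)
    moreover have "norm (u (r (\<kappa> t))) \<le> (\<Sum>k\<le>N. norm (u (r k)))"
      using \<kappa>_le[of t] t by (intro member_le_sum) auto
    ultimately show ?thesis unfolding B_def by linarith
  qed
  have B0: "0 \<le> B" unfolding B_def by (simp add: sum_nonneg)
  show ?thesis
  proof (rule that)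
    show "0 \<le> real (Suc N) + 2 * B * real N" using B0 by simp
    fix n p assume p: "partition a b n p"
    let ?d = "\<lambda>i. norm (u (p (Suc i)) - u (p i))"
    let ?I = "\<lambda>k. {i \<in> {..<n}. \<kappa> (p i) = k \<and> \<kappa> (p (Suc i)) = k}"
    have pin: "p i \<in> {a..b}" "p (Suc i) \<in> {a..b}" "p i < p (Suc i)" if "i < n" for i
      using partition_bounds[OF p] p that by (auto simp: partition_def)
    have same: "(\<Sum>i\<in>?I k. ?d i) \<le> 1" for k
    proof -
      \<comment> \<open>Truncating \<open>g\<close> to class \<open>k\<close> keeps the increments within the class, and now all increments
        of the partition may be added, so that the sum telescopes.\<close>
      define G where "G t = max (g a + real k * h) (min (g t) (g a + real k * h + h))" for t
      have G_mono: "G x \<le> G y" if "x \<le> y" for x y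
        using derivatorD(1)[OF g that] by (auto simp: G_def)
      have G_eq: "G t = g t" if "a \<le> t" "\<kappa> t = k" for t
        using cls[OF that] by (auto simp: G_def)
      have "(\<Sum>i\<in>?I k. g (p (Suc i)) - g (p i)) = (\<Sum>i\<in>?I k. G (p (Suc i)) - G (p i))"
        using pin by (intro sum.cong refl) (auto simp: G_eq)
      also have "\<dots> \<le> (\<Sum>i<n. G (p (Suc i)) - G (p i))"
      proof (rule sum_mono2)
        show "0 \<le> G (p (Suc i)) - G (p i)" if "i \<in> {..<n} - ?I k" for i
          using G_mono[of "p i" "p (Suc i)"] pin(3)[of i] that by simp
      qed auto
      also have "\<dots> = G (p n) - G (p 0)" by (rule sum_lessThan_telescope)
      also have "\<dots> \<le> h" using h(1) by (auto simp: G_def)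
      also have "\<dots> < \<delta>" by (rule h)
      finally have "(\<Sum>i\<in>?I k. ?d i) < 1" by (intro \<delta>(2)[OF _ _ p]) auto
      then show ?thesis by simp
    qed
    have "?d i \<le> (\<Sum>k\<le>N. if i \<in> ?I k then ?d i else 0) + 2 * B * (real (\<kappa> (p (Suc i))) - real (\<kappa> (p i)))"
      if i: "i < n" for i
    proof (cases "\<kappa> (p i) = \<kappa> (p (Suc i))")
      case True
      have "(\<Sum>k\<le>N. if i \<in> ?I k then ?d i else 0) = (\<Sum>k\<le>N. if k = \<kappa> (p i) then ?d i else 0)"
        using True i by (intro sum.cong) auto
      also have "\<dots> = ?d i" using \<kappa>_le[of "p i"] pin[OF i] by simp
      finally show ?thesis using True by simp
    next
      case False
      have "(\<Sum>k\<le>N. if i \<in> ?I k then ?d i else 0) = 0" using False by (intro sum.neutral) auto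
      moreover have "\<kappa> (p i) \<le> \<kappa> (p (Suc i))" using pin(3)[OF i] by (intro \<kappa>_mono) simp
      then have "1 \<le> real (\<kappa> (p (Suc i))) - real (\<kappa> (p i))" using False by linarith
      then have "2 * B * 1 \<le> 2 * B * (real (\<kappa> (p (Suc i))) - real (\<kappa> (p i)))"
        using B0 by (intro mult_left_mono) auto
      moreover have "?d i \<le> 2 * B"
        using norm_triangle_ineq4[of "u (p (Suc i))" "u (p i)"] bounded[OF pin(1)[OF i]] bounded[OF pin(2)[OF i]]
        by linarith
      ultimately show ?thesis by linarith
    qed
    then have "(\<Sum>i<n. ?d i) \<le> (\<Sum>i<n. (\<Sum>k\<le>N. if i \<in> ?I k then ?d i else 0)
        + 2 * B * (real (\<kappa> (p (Suc i))) - real (\<kappa> (p i))))"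
      by (intro sum_mono) simp
    also have "\<dots> = (\<Sum>i<n. \<Sum>k\<le>N. if i \<in> ?I k then ?d i else 0)
        + 2 * B * (\<Sum>i<n. real (\<kappa> (p (Suc i))) - real (\<kappa> (p i)))"
      by (simp add: sum.distrib sum_distrib_left)
    also have "(\<Sum>i<n. real (\<kappa> (p (Suc i))) - real (\<kappa> (p i))) = real (\<kappa> (p n)) - real (\<kappa> (p 0))"
      by (rule sum_lessThan_telescope)
    also have "\<dots> = real N" using p by (simp add: partition_def N_def \<kappa>_def)
    also have "(\<Sum>i<n. \<Sum>k\<le>N. if i \<in> ?I k then ?d i else 0) = (\<Sum>k\<le>N. \<Sum>i<n. if i \<in> ?I k then ?d i else 0)"
      by (rule sum.swap)
    also have "\<dots> = (\<Sum>k\<le>N. \<Sum>i\<in>?I k. ?d i)"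
    proof (rule sum.cong[OF refl])
      show "(\<Sum>i<n. if i \<in> ?I k then ?d i else 0) = (\<Sum>i\<in>?I k. ?d i)" for k
        by (rule sum.mono_neutral_cong_right) auto
    qed
    also have "\<dots> \<le> (\<Sum>k\<le>N. 1)" by (intro sum_mono same)
    finally show "(\<Sum>i<n. ?d i) \<le> real (Suc N) + 2 * B * real N" by simp
  qed
qed

section \<open>The vector measure of an absolutely continuous function\<close>

definition node :: "real \<Rightarrow> real \<Rightarrow> nat \<Rightarrow> nat \<Rightarrow> real" where
  "node a b n i = a + (b - a) * (real i / real (Suc n))"

definition cell :: "real \<Rightarrow> real \<Rightarrow> nat \<Rightarrow> nat \<Rightarrow> real set" where
  "cell a b n i = {node a b n i..<node a b n (Suc i)}"

lemma node_0 [simp]: "node a b n 0 = a"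
  by (simp add: node_def)

lemma node_last [simp]: "node a b n (Suc n) = b"
  by (simp add: node_def)

lemma node_diff: "node a b n (Suc i) - node a b n i = (b - a) / real (Suc n)"
  by (simp add: node_def add_divide_distrib[symmetric] right_diff_distrib[symmetric] diff_divide_distrib[symmetric])

lemma partition_node:
  assumes "a < b"
  shows "partition a b (Suc n) (node a b n)"
proof -
  have "(b - a) / real (Suc n) > 0" using assms by simp
  then have "node a b n i < node a b n (Suc i)" for i
    using node_diff[of a b n i] by linarith
  then show ?thesis by (simp add: partition_def)
qed

lemma cell_subset:
  assumes "a < b" "i < Suc n"
  shows "cell a b n i \<subseteq> {a..<b}"
  using partition_bounds[OF partition_node[OF assms(1)], of i n] partition_bounds[OF partition_node[OF assms(1)], of "Suc i" n] assms
  by (auto simp: cell_def)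

lemma cell_disjoint:
  assumes "a < b"
  shows "disjoint_family_on (cell a b n) {..<Suc n}"
  unfolding disjoint_family_on_def
proof (intro ballI impI)
  fix i j assume ij: "i \<in> {..<Suc n}" "j \<in> {..<Suc n}" "i \<noteq> j"
  then consider "Suc i \<le> j" | "Suc j \<le> i" by linarith
  then show "cell a b n i \<inter> cell a b n j = {}"
  proof cases
    case 1
    then show ?thesis
      using partition_le[OF partition_node[OF assms], of "Suc i" j n] ij by (auto simp: cell_def)
  next
    case 2
    then show ?thesis
      using partition_le[OF partition_node[OF assms], of "Suc j" i n] ij by (auto simp: cell_def)
  qed
qed

lemma ex_cell:
  assumes "a < b" "t \<in> {a..<b}"
  obtains i where "i < Suc n" "t \<in> cell a b n i"
proof -
  define i where "i = Max {i. i < Suc n \<and> node a b n i \<le> t}"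
  let ?A = "{i. i < Suc n \<and> node a b n i \<le> t}"
  have "finite ?A" "0 \<in> ?A" using assms by auto
  then have i: "i \<in> ?A" "\<And>j. j \<in> ?A \<Longrightarrow> j \<le> i"
    using Max_in[of ?A] Max_ge[of ?A] unfolding i_def by blast+
  have "t < node a b n (Suc i)"
  proof (cases "i = n")
    case True
    then show ?thesis using assms by simp
  next
    case False
    then have "Suc i < Suc n" using i(1) by simp
    then show ?thesis using i(2)[of "Suc i"] by force
  qed
  then show ?thesis using that i(1) by (auto simp: cell_def)
qed

text \<open>\<open>avg_measure g a b u n A\<close> is the integral over \<open>A\<close> of the step function that equals the slope of
  \<open>u\<close> with respect to \<open>g\<close> on each of the \<open>n + 1\<close> cells of equal length. A cell of measure zero
  contributes nothing.\<close>

definition avg_measure ::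
  "(real \<Rightarrow> real) \<Rightarrow> real \<Rightarrow> real \<Rightarrow> (real \<Rightarrow> 'b::real_normed_vector) \<Rightarrow> nat \<Rightarrow> real set \<Rightarrow> 'b" where
  "avg_measure g a b u n A = (\<Sum>i<Suc n.
     (measure (stieltjes_on g {a..<b}) (A \<inter> cell a b n i) / measure (stieltjes_on g {a..<b}) (cell a b n i))
       *\<^sub>R (u (node a b n (Suc i)) - u (node a b n i)))"

locale AC_function =
  fixes g :: "real \<Rightarrow> real" and a b :: real and u :: "real \<Rightarrow> 'b::banach"
  assumes derivator: "derivator g" and ab: "a < b" and ac: "AC_g g a b u"
begin

abbreviation "M \<equiv> stieltjes_on g {a..<b}"
abbreviation "\<nu> \<equiv> avg_measure g a b u"
abbreviation "incr n i \<equiv> u (node a b n (Suc i)) - u (node a b n i)"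

sublocale finite_measure M
  by (rule finite_stieltjes_on[OF derivator])

lemma cell_sets [simp]: "i < Suc n \<Longrightarrow> cell a b n i \<in> sets M"
  using cell_subset[OF ab, of i n] unfolding cell_def by (rule Ico_in_sets_stieltjes_on)

lemma measure_M_Ico:
  assumes "a \<le> x" "x \<le> y" "y \<le> b"
  shows "measure M {x..<y} = g y - g x"
  using assms measure_stieltjes_Ico[OF derivator assms(2)]
  by (subst measure_restrict_space) (auto simp: borel_sets_stieltjes)

lemma measure_cell:
  assumes "i < Suc n"
  shows "measure M (cell a b n i) = g (node a b n (Suc i)) - g (node a b n i)"
  unfolding cell_def
  using partition_bounds[OF partition_node[OF ab], of i n] partition_bounds[OF partition_node[OF ab], of "Suc i" n]
    partition_le[OF partition_node[OF ab], of i "Suc i" n] assms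
  by (intro measure_M_Ico) auto

lemma incr_null_cell:
  assumes i: "i < Suc n" and "measure M (cell a b n i) = 0"
  shows "incr n i = 0"
proof -
  have "norm (incr n i) < \<epsilon>" if \<epsilon>: "\<epsilon> > 0" for \<epsilon>
  proof -
    obtain \<delta> where \<delta>: "\<delta> > 0" "\<And>x y. a \<le> x \<Longrightarrow> x \<le> y \<Longrightarrow> y \<le> b \<Longrightarrow> g y - g x < \<delta> \<Longrightarrow> norm (u y - u x) < \<epsilon>"
      using AC_g_increment[OF ac \<epsilon>] by blast
    show ?thesis
      using partition_bounds[OF partition_node[OF ab], of i n] partition_bounds[OF partition_node[OF ab], of "Suc i" n]
        partition_le[OF partition_node[OF ab], of i "Suc i" n] assms measure_cell[OF i] \<delta>(1)
      by (intro \<delta>(2)) auto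
  qed
  then show ?thesis by (meson less_irrefl zero_less_norm_iff)
qed

lemma sum_cells_le:
  assumes "A \<in> sets M" "I \<subseteq> {..<Suc n}"
  shows "(\<Sum>i\<in>I. measure M (A \<inter> cell a b n i)) \<le> measure M A"
proof -
  have fin: "finite I" using assms(2) finite_subset by blast
  have "(\<Sum>i\<in>I. measure M (A \<inter> cell a b n i)) = measure M (\<Union>i\<in>I. A \<inter> cell a b n i)"
  proof (rule finite_measure_finite_Union[OF fin, symmetric])
    have "i < Suc n" if "i \<in> I" for i using assms(2) that by auto
    then show "(\<lambda>i. A \<inter> cell a b n i) ` I \<subseteq> sets M"
      using assms(1) cell_sets by (blast intro: sets.Int)
    show "disjoint_family_on (\<lambda>i. A \<inter> cell a b n i) I"
      using cell_disjoint[OF ab, of n] assms(2) unfolding disjoint_family_on_def by blast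
  qed
  also have "\<dots> \<le> measure M A" using assms by (intro finite_measure_mono) auto
  finally show ?thesis .
qed

lemma avg_union:
  assumes "A \<in> sets M" "B \<in> sets M" "A \<inter> B = {}"
  shows "\<nu> n (A \<union> B) = \<nu> n A + \<nu> n B"
proof -
  have "measure M ((A \<union> B) \<inter> cell a b n i) = measure M (A \<inter> cell a b n i) + measure M (B \<inter> cell a b n i)"
    if "i < Suc n" for i
    unfolding Int_Un_distrib2 using assms cell_sets[OF that]
    by (intro finite_measure_Union) auto
  then show ?thesis
    unfolding avg_measure_def sum.distrib[symmetric]
    by (intro sum.cong refl) (simp add: add_divide_distrib scaleR_add_left)
qed

lemma avg_finite_union:
  assumes "finite F" "\<And>i. i \<in> F \<Longrightarrow> A i \<in> sets M" "disjoint_family_on A F"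
  shows "\<nu> n (\<Union>i\<in>F. A i) = (\<Sum>i\<in>F. \<nu> n (A i))"
  using assms
proof (induction F rule: finite_induct)
  case empty
  show ?case by (simp add: avg_measure_def)
next
  case (insert x F)
  have "\<nu> n (A x \<union> (\<Union>i\<in>F. A i)) = \<nu> n (A x) + \<nu> n (\<Union>i\<in>F. A i)"
    using insert.prems insert.hyps
    by (intro avg_union) (auto simp: disjoint_family_on_def)
  moreover have "disjoint_family_on A F"
    using insert.prems by (auto simp: disjoint_family_on_def)
  ultimately show ?case using insert by simp
qed

lemma norm_avg_le:
  "norm (\<nu> n A) \<le> (\<Sum>i<Suc n. measure M (A \<inter> cell a b n i) / measure M (cell a b n i) * norm (incr n i))"
  unfolding avg_measure_def by (rule order_trans[OF norm_sum]) (simp add: sum_nonneg)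

lemma measure_Int_cell_le:
  assumes "A \<in> sets M" "i < Suc n"
  shows "measure M (A \<inter> cell a b n i) / measure M (cell a b n i) \<le> 1"
proof -
  have "measure M (A \<inter> cell a b n i) \<le> measure M (cell a b n i)"
    using assms by (intro finite_measure_mono) auto
  then show ?thesis by (simp add: divide_le_eq_1 zero_less_measure_iff)
qed

text \<open>The averaged slopes are uniformly integrable: the cells on which the slope exceeds \<open>R\<close> have
  total measure at most \<open>C/R\<close>, where \<open>C\<close> bounds the variation, and by absolute continuity the
  increments over them are then negligible.\<close>

lemma avg_uniformly_continuous:
  assumes \<epsilon>: "0 < \<epsilon>"
  obtains R where "0 < R" "\<And>n A. A \<in> sets M \<Longrightarrow> norm (\<nu> n A) \<le> \<epsilon> + R * measure M A"
proof -
  obtain C where C: "0 \<le> C" "\<And>n p. partition a b n p \<Longrightarrow> (\<Sum>i<n. norm (u (p (Suc i)) - u (p i))) \<le> C"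
    using AC_g_bounded_variation[OF derivator _ ac] ab by (metis less_imp_le)
  obtain \<delta> where \<delta>: "\<delta> > 0" "\<And>c d n p I. a \<le> c \<Longrightarrow> d \<le> b \<Longrightarrow> partition c d n p \<Longrightarrow> I \<subseteq> {..<n} \<Longrightarrow>
      (\<Sum>i\<in>I. g (p (Suc i)) - g (p i)) < \<delta> \<Longrightarrow> (\<Sum>i\<in>I. norm (u (p (Suc i)) - u (p i))) < \<epsilon>"
    using AC_g_partition[OF ac \<epsilon>] by blast
  \<comment> \<open>Any \<open>R > C / \<delta>\<close> gives the cells steeper than \<open>R\<close> a total measure below \<open>\<delta>\<close>.\<close>
  define R where "R = C / \<delta> + 1"
  have R: "R > 0" using C(1) \<delta>(1) by (simp add: R_def add_nonneg_pos)
  show ?thesis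
  proof (rule that[OF R])
    fix n A assume A: "A \<in> sets M"
    let ?m = "\<lambda>i. measure M (cell a b n i)"
    let ?r = "\<lambda>i. measure M (A \<inter> cell a b n i) / ?m i"
    let ?q = "\<lambda>i. norm (incr n i)"
    define I where "I = {i \<in> {..<Suc n}. R * ?m i < ?q i}"
    have "R * (\<Sum>i\<in>I. ?m i) \<le> (\<Sum>i\<in>I. ?q i)"
      unfolding sum_distrib_left by (intro sum_mono) (auto simp: I_def)
    also have "\<dots> \<le> (\<Sum>i<Suc n. ?q i)" by (intro sum_mono2) (auto simp: I_def)
    also have "\<dots> \<le> C" by (rule C(2)[OF partition_node[OF ab]])
    also have "\<dots> < R * \<delta>" using \<delta>(1) by (simp add: R_def algebra_simps)
    finally have "(\<Sum>i\<in>I. ?m i) < \<delta>" using R by simp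
    moreover have "(\<Sum>i\<in>I. ?m i) = (\<Sum>i\<in>I. g (node a b n (Suc i)) - g (node a b n i))"
      by (intro sum.cong measure_cell) (auto simp: I_def)
    ultimately have qI: "(\<Sum>i\<in>I. ?q i) < \<epsilon>"
      by (intro \<delta>(2)[OF _ _ partition_node[OF ab], of I n]) (auto simp: I_def)
    have cell_term: "?r i * ?q i \<le> (if i \<in> I then ?q i else 0) + R * measure M (A \<inter> cell a b n i)" if i: "i < Suc n" for i
    proof (cases "i \<in> I")
      case True
      have "?r i * ?q i \<le> 1 * ?q i" by (intro mult_right_mono measure_Int_cell_le A i) simp
      with True R show ?thesis by (simp add: add_increasing2)
    next
      case False
      then have "?q i \<le> R * ?m i" using i by (simp add: I_def)
      then have "?r i * ?q i \<le> ?r i * (R * ?m i)" by (intro mult_left_mono) auto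
      also have "\<dots> \<le> R * measure M (A \<inter> cell a b n i)" using R by (cases "?m i = 0") auto
      finally show ?thesis using False by simp
    qed
    have "norm (\<nu> n A) \<le> (\<Sum>i<Suc n. ?r i * ?q i)" by (rule norm_avg_le)
    also have "\<dots> \<le> (\<Sum>i<Suc n. (if i \<in> I then ?q i else 0) + R * measure M (A \<inter> cell a b n i))"
      by (intro sum_mono cell_term) simp
    also have "\<dots> = (\<Sum>i\<in>I. ?q i) + R * (\<Sum>i<Suc n. measure M (A \<inter> cell a b n i))"
    proof -
      have "{..<Suc n} \<inter> I = I" by (auto simp: I_def)
      then show ?thesis by (simp add: sum.distrib sum_distrib_left sum.If_cases del: sum.lessThan_Suc)
    qed
    also have "\<dots> \<le> \<epsilon> + R * measure M A"
      using qI R sum_cells_le[OF A, of "{..<Suc n}" n] by (intro add_mono mult_left_mono) auto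
    finally show "norm (\<nu> n A) \<le> \<epsilon> + R * measure M A" .
  qed
qed

text \<open>Disjoint sets share the increment over each cell in proportion to their measures.\<close>

lemma avg_bounded_variation:
  obtains C where "\<And>n P. finite P \<Longrightarrow> P \<subseteq> sets M \<Longrightarrow> disjoint P \<Longrightarrow> (\<Sum>A\<in>P. norm (\<nu> n A)) \<le> C"
proof -
  obtain C where C: "0 \<le> C" "\<And>n p. partition a b n p \<Longrightarrow> (\<Sum>i<n. norm (u (p (Suc i)) - u (p i))) \<le> C"
    using AC_g_bounded_variation[OF derivator _ ac] ab by (metis less_imp_le)
  show ?thesis
  proof (rule that)
    fix n P assume P: "finite P" "P \<subseteq> sets M" "disjoint P"
    let ?m = "\<lambda>i. measure M (cell a b n i)"
    have "(\<Sum>A\<in>P. norm (\<nu> n A)) \<le> (\<Sum>A\<in>P. \<Sum>i<Suc n. measure M (A \<inter> cell a b n i) / ?m i * norm (incr n i))"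
      by (intro sum_mono norm_avg_le)
    also have "\<dots> = (\<Sum>i<Suc n. (\<Sum>A\<in>P. measure M (A \<inter> cell a b n i)) / ?m i * norm (incr n i))"
      unfolding sum_divide_distrib sum_distrib_right by (rule sum.swap)
    also have "\<dots> \<le> (\<Sum>i<Suc n. 1 * norm (incr n i))"
    proof (intro sum_mono mult_right_mono)
      fix i assume "i \<in> {..<Suc n}"
      then have i: "cell a b n i \<in> sets M" by (intro cell_sets) simp
      have "(\<Sum>A\<in>P. measure M (A \<inter> cell a b n i)) = measure M (\<Union>A\<in>P. A \<inter> cell a b n i)"
        using P i by (intro finite_measure_finite_Union[symmetric]) (auto simp: disjoint_family_on_def disjoint_def)
      also have "\<dots> \<le> ?m i"
        using P i by (intro finite_measure_mono) auto
      finally show "(\<Sum>A\<in>P. measure M (A \<inter> cell a b n i)) / ?m i \<le> 1"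
        by (simp add: divide_le_eq_1 zero_less_measure_iff)
    qed simp
    also have "\<dots> \<le> C" using C(2)[OF partition_node[OF ab, of n]] by simp
    finally show "(\<Sum>A\<in>P. norm (\<nu> n A)) \<le> C" .
  qed
qed

lemma left_continuous:
  assumes d: "d \<in> {a..b}" and \<epsilon>: "0 < \<epsilon>"
  obtains \<eta> where "0 < \<eta>" "\<And>x. a \<le> x \<Longrightarrow> x \<le> d \<Longrightarrow> d - \<eta> < x \<Longrightarrow> g d - g x < \<epsilon> \<and> norm (u d - u x) < \<epsilon>"
proof -
  obtain \<delta> where \<delta>: "\<delta> > 0" "\<And>x y. a \<le> x \<Longrightarrow> x \<le> y \<Longrightarrow> y \<le> b \<Longrightarrow> g y - g x < \<delta> \<Longrightarrow> norm (u y - u x) < \<epsilon>"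
    using AC_g_increment[OF ac \<epsilon>] by blast
  have "g d - min \<delta> \<epsilon> < g d" using \<delta>(1) \<epsilon> by simp
  with derivatorD(2)[OF derivator, of d] have "\<forall>\<^sub>F x in at_left d. g d - min \<delta> \<epsilon> < g x"
    by (rule order_tendstoD)
  then obtain c where c: "c < d" "\<And>x. c < x \<Longrightarrow> x < d \<Longrightarrow> g d - min \<delta> \<epsilon> < g x"
    unfolding eventually_at_left_field by blast
  show ?thesis
  proof (rule that[of "d - c"])
    fix x assume x: "a \<le> x" "x \<le> d" "d - (d - c) < x"
    have "g d - g x < min \<delta> \<epsilon>"
    proof (cases "x = d")
      case False
      then have "g d - min \<delta> \<epsilon> < g x" using c(2)[of x] x by simp
      then show ?thesis by linarith
    qed (use \<delta>(1) \<epsilon> in simp)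
    then show "g d - g x < \<epsilon> \<and> norm (u d - u x) < \<epsilon>"
      using \<delta>(2)[of x d] x d by simp
  qed (use c in simp)
qed

lemma avg_initial_cells:
  assumes k: "k \<le> Suc n"
  shows "\<nu> n {a..<node a b n k} = u (node a b n k) - u a"
proof -
  have ratio: "(measure M ({a..<node a b n k} \<inter> cell a b n i) / measure M (cell a b n i)) *\<^sub>R incr n i
      = (if i < k then incr n i else 0)" if i: "i < Suc n" for i
  proof (cases "i < k")
    case True
    have "a \<le> node a b n i" using partition_bounds[OF partition_node[OF ab], of i n] i by simp
    moreover have "node a b n (Suc i) \<le> node a b n k"
      using True k by (intro partition_le[OF partition_node[OF ab]]) auto
    ultimately have "{a..<node a b n k} \<inter> cell a b n i = cell a b n i"
      by (auto simp: cell_def)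
    then show ?thesis
      using True incr_null_cell[OF i] by (cases "measure M (cell a b n i) = 0") auto
  next
    case False
    have "node a b n k \<le> node a b n i"
      using False i by (intro partition_le[OF partition_node[OF ab]]) auto
    then have "{a..<node a b n k} \<inter> cell a b n i = {}" by (auto simp: cell_def)
    then show ?thesis using False by simp
  qed
  have "\<nu> n {a..<node a b n k} = (\<Sum>i<Suc n. if i < k then incr n i else 0)"
    unfolding avg_measure_def by (intro sum.cong refl ratio) simp
  also have "\<dots> = (\<Sum>i<k. incr n i)"
    using k by (intro sum.mono_neutral_cong_right) auto
  also have "\<dots> = u (node a b n k) - u (node a b n 0)" by (rule sum_lessThan_telescope)
  finally show ?thesis by simp
qed

text \<open>Up to the last node before \<open>d\<close> the sum telescopes; the remaining piece of a single cell has
  small measure, since \<open>g\<close> is left-continuous at \<open>d\<close>.\<close>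

lemma avg_Ico_tendsto:
  assumes d: "d \<in> {a..b}"
  shows "(\<lambda>n. \<nu> n {a..<d}) \<longlonglongrightarrow> u d - u a"
proof (rule LIMSEQ_I)
  fix e :: real assume e: "0 < e"
  then have "e / 3 > 0" by simp
  then obtain R where R: "0 < R" "\<And>n A. A \<in> sets M \<Longrightarrow> norm (\<nu> n A) \<le> e / 3 + R * measure M A"
    using avg_uniformly_continuous by blast
  have "min (e / 3) (e / (3 * R)) > 0" using e R(1) by simp
  then obtain \<eta> where \<eta>: "0 < \<eta>" "\<And>x. a \<le> x \<Longrightarrow> x \<le> d \<Longrightarrow> d - \<eta> < x \<Longrightarrow>
      g d - g x < min (e / 3) (e / (3 * R)) \<and> norm (u d - u x) < min (e / 3) (e / (3 * R))"
    using left_continuous[OF d] by blast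
  obtain N :: nat where N: "(b - a) / \<eta> < real N" using reals_Archimedean2 by blast
  have "norm (\<nu> n {a..<d} - (u d - u a)) < e" if n: "n \<ge> N" for n
  proof -
    let ?z = "(d - a) * real (Suc n) / (b - a)"
    define k where "k = nat \<lfloor>?z\<rfloor>"
    \<comment> \<open>the last node that does not exceed \<open>d\<close>\<close>
    define x where "x = node a b n k"
    have z0: "0 \<le> ?z" using d ab by simp
    have kz: "real k \<le> ?z" "?z < real k + 1" using z0 unfolding k_def by linarith+
    have zn: "?z \<le> real (Suc n)" using d ab by (simp add: pos_divide_le_eq mult.commute mult_left_mono)
    then have kn: "k \<le> Suc n" using kz(1) by linarith
    have "real k * (b - a) \<le> (d - a) * real (Suc n)" using kz(1) ab by (simp add: pos_le_divide_eq)
    then have "x \<le> d" using ab by (simp add: x_def node_def field_simps)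
    have "(d - a) * real (Suc n) < (real k + 1) * (b - a)" using kz(2) ab by (simp add: pos_divide_less_eq)
    then have "d - a < (real k + 1) * (b - a) / real (Suc n)" by (simp only: pos_less_divide_eq of_nat_0_less_iff zero_less_Suc)
    also have "\<dots> = (b - a) * (real k / real (Suc n)) + (b - a) / real (Suc n)"
      using add_divide_distrib[of "real k * (b - a)" "b - a" "real (Suc n)"]
      by (simp only: distrib_right mult_1 mult.commute[of "b - a"] times_divide_eq_left)
    finally have "d - x < (b - a) / real (Suc n)" by (simp add: x_def node_def)
    also have "\<dots> < \<eta>"
    proof -
      have "(b - a) / \<eta> < real (Suc n)" using N n by linarith
      then show ?thesis using \<eta>(1) by (simp add: field_simps)
    qed
    finally have "d - \<eta> < x" by simp
    have ax: "a \<le> x" using partition_bounds[OF partition_node[OF ab] kn] by (simp add: x_def)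
    note close = \<eta>(2)[OF ax \<open>x \<le> d\<close> \<open>d - \<eta> < x\<close>]
    have sets: "{a..<x} \<in> sets M" "{x..<d} \<in> sets M"
      using ax \<open>x \<le> d\<close> d by (auto intro!: Ico_in_sets_stieltjes_on)
    have "{a..<d} = {a..<x} \<union> {x..<d}" using ax \<open>x \<le> d\<close> by auto
    then have "\<nu> n {a..<d} = u x - u a + \<nu> n {x..<d}"
      using avg_union[OF sets] avg_initial_cells[OF kn] by (auto simp: x_def)
    then have "\<nu> n {a..<d} - (u d - u a) = \<nu> n {x..<d} - (u d - u x)" by simp
    then have "norm (\<nu> n {a..<d} - (u d - u a)) \<le> norm (\<nu> n {x..<d}) + norm (u d - u x)"
      by (simp only: norm_triangle_ineq4)
    also have "norm (\<nu> n {x..<d}) \<le> e / 3 + R * measure M {x..<d}" by (rule R(2)[OF sets(2)])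
    also have "measure M {x..<d} = g d - g x" using ax \<open>x \<le> d\<close> d by (intro measure_M_Ico) auto
    finally have "norm (\<nu> n {a..<d} - (u d - u a)) \<le> e / 3 + R * (g d - g x) + norm (u d - u x)" by simp
    moreover have "R * (g d - g x) < R * (e / (3 * R))" using close R(1) by (intro mult_strict_left_mono) auto
    moreover have "R * (e / (3 * R)) = e / 3" using R(1) by simp
    ultimately show ?thesis using close by linarith
  qed
  then show "\<exists>N. \<forall>n\<ge>N. norm (\<nu> n {a..<d} - (u d - u a)) < e" by blast
qed

lemma measure_tail_tendsto:
  fixes A :: "nat \<Rightarrow> real set"
  assumes A: "range A \<subseteq> sets M" "disjoint_family A"
  shows "(\<lambda>k. measure M (\<Union>i. A (i + k))) \<longlonglongrightarrow> 0"
proof -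
  have "(\<lambda>k. measure M (\<Union>i. A (i + k))) \<longlonglongrightarrow> measure M (\<Inter>k. \<Union>i. A (i + k))"
  proof (rule finite_Lim_measure_decseq)
    show "range (\<lambda>k. \<Union>i. A (i + k)) \<subseteq> sets M" using A(1) by auto
    show "decseq (\<lambda>k. \<Union>i. A (i + k))"
    proof (rule decseq_SucI)
      fix k
      have "A (i + Suc k) \<subseteq> (\<Union>i. A (i + k))" for i
        using UN_upper[of "Suc i" UNIV "\<lambda>i. A (i + k)"] by simp
      then show "(\<Union>i. A (i + Suc k)) \<subseteq> (\<Union>i. A (i + k))" by blast
    qed
  qed
  also have "(\<Inter>k. \<Union>i. A (i + k)) = {}"
  proof (rule equals0I)
    fix x assume x: "x \<in> (\<Inter>k. \<Union>i. A (i + k))"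
    then obtain j where j: "x \<in> A j" by auto
    from x obtain i where "x \<in> A (i + Suc j)" by blast
    with j A(2) have "j = i + Suc j" unfolding disjoint_family_on_def by blast
    then show False by simp
  qed
  finally show ?thesis by simp
qed

lemma union_split_tail:
  fixes A :: "nat \<Rightarrow> 'x set"
  shows "(\<Union>i. A i) = (\<Union>i<k. A i) \<union> (\<Union>i. A (i + k))"
proof -
  have "x \<in> (\<Union>i<k. A i) \<union> (\<Union>i. A (i + k))" if "x \<in> A i" for x i
  proof (cases "i < k")
    case False
    then have "i = (i - k) + k" by simp
    then show ?thesis using that by (metis UN_I UNIV_I UnI2)
  qed (use that in auto)
  then show ?thesis by blast
qed

lemma avg_UN:
  fixes A :: "nat \<Rightarrow> real set"
  assumes A: "range A \<subseteq> sets M" "disjoint_family A"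
  shows "\<nu> n (\<Union>i. A i) = (\<Sum>i<k. \<nu> n (A i)) + \<nu> n (\<Union>i. A (i + k))"
proof -
  have "\<nu> n (\<Union>i. A i) = \<nu> n (\<Union>i<k. A i) + \<nu> n (\<Union>i. A (i + k))"
    unfolding union_split_tail[of A k]
  proof (rule avg_union)
    show "(\<Union>i<k. A i) \<inter> (\<Union>i. A (i + k)) = {}"
    proof (rule equals0I)
      fix x assume "x \<in> (\<Union>i<k. A i) \<inter> (\<Union>i. A (i + k))"
      then obtain i j where ij: "i < k" "x \<in> A i" "x \<in> A (j + k)" by blast
      then have "i = j + k" using A(2) unfolding disjoint_family_on_def by blast
      with ij(1) show False by simp
    qed
  qed (use A(1) in auto)
  also have "\<nu> n (\<Union>i<k. A i) = (\<Sum>i<k. \<nu> n (A i))"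
    using A by (intro avg_finite_union) (auto simp: disjoint_family_on_def)
  finally show ?thesis .
qed

text \<open>Uniform absolute continuity makes the tails of a disjoint union negligible uniformly in \<open>n\<close>, so
  that limit and sum can be interchanged.\<close>

lemma avg_small_tail:
  fixes A :: "nat \<Rightarrow> real set"
  assumes A: "range A \<subseteq> sets M" "disjoint_family A" and e: "0 < e"
  obtains N where "\<And>n k. N \<le> k \<Longrightarrow> norm (\<nu> n (\<Union>i. A (i + k))) < e"
proof -
  have "e / 2 > 0" using e by simp
  then obtain R where R: "0 < R" "\<And>n A. A \<in> sets M \<Longrightarrow> norm (\<nu> n A) \<le> e / 2 + R * measure M A"
    using avg_uniformly_continuous by blast
  have "e / (2 * R) > 0" using e R(1) by simp
  with measure_tail_tendsto[OF A] have "\<forall>\<^sub>F k in sequentially. measure M (\<Union>i. A (i + k)) < e / (2 * R)"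
    by (rule order_tendstoD)
  then obtain N where N: "\<And>k. N \<le> k \<Longrightarrow> measure M (\<Union>i. A (i + k)) < e / (2 * R)"
    by (auto simp: eventually_sequentially)
  show ?thesis
  proof (rule that)
    fix n k assume "N \<le> k"
    have "norm (\<nu> n (\<Union>i. A (i + k))) \<le> e / 2 + R * measure M (\<Union>i. A (i + k))"
      using A(1) by (intro R(2)) auto
    also have "R * measure M (\<Union>i. A (i + k)) < R * (e / (2 * R))"
      using N[OF \<open>N \<le> k\<close>] R(1) by (intro mult_strict_left_mono)
    also have "R * (e / (2 * R)) = e / 2" using R(1) by simp
    finally show "norm (\<nu> n (\<Union>i. A (i + k))) < e" by simp
  qed
qed

lemma avg_convergent_UN:
  fixes A :: "nat \<Rightarrow> real set"
  assumes A: "range A \<subseteq> sets M" "disjoint_family A" and conv: "\<And>i. convergent (\<lambda>n. \<nu> n (A i))"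
  shows "convergent (\<lambda>n. \<nu> n (\<Union>i. A i))"
proof -
  have "Cauchy (\<lambda>n. \<nu> n (\<Union>i. A i))"
  proof (rule metric_CauchyI)
    fix e :: real assume e: "0 < e"
    then have "e / 3 > 0" by simp
    then obtain k where k: "\<And>n j. k \<le> j \<Longrightarrow> norm (\<nu> n (\<Union>i. A (i + j))) < e / 3"
      using avg_small_tail[OF A] by blast
    have "convergent (\<lambda>n. \<Sum>i<k. \<nu> n (A i))" by (intro convergent_sum conv)
    then have "Cauchy (\<lambda>n. \<Sum>i<k. \<nu> n (A i))" by (rule convergent_Cauchy)
    then obtain N where N: "\<And>m n. m \<ge> N \<Longrightarrow> n \<ge> N \<Longrightarrow> norm ((\<Sum>i<k. \<nu> m (A i)) - (\<Sum>i<k. \<nu> n (A i))) < e / 3"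
      using \<open>e / 3 > 0\<close> unfolding Cauchy_def dist_norm by meson
    have "dist (\<nu> m (\<Union>i. A i)) (\<nu> n (\<Union>i. A i)) < e" if "m \<ge> N" "n \<ge> N" for m n
    proof -
      have triangle: "norm ((p + q) - (p' + q')) \<le> norm (p - p') + norm q + norm q'" for p q p' q' :: 'b
        using norm_triangle_ineq[of "p - p'" "q - q'"] norm_triangle_ineq4[of q q']
        by (simp add: algebra_simps)
      show ?thesis
        unfolding dist_norm avg_UN[OF A, of m k] avg_UN[OF A, of n k]
        using triangle[of "\<Sum>i<k. \<nu> m (A i)" "\<nu> m (\<Union>i. A (i + k))" "\<Sum>i<k. \<nu> n (A i)" "\<nu> n (\<Union>i. A (i + k))"]
          N[OF that] k[OF order_refl, of m] k[OF order_refl, of n] by linarith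
    qed
    then show "\<exists>N. \<forall>m\<ge>N. \<forall>n\<ge>N. dist (\<nu> m (\<Union>i. A i)) (\<nu> n (\<Union>i. A i)) < e" by blast
  qed
  then show ?thesis by (rule Cauchy_convergent)
qed

lemma avg_lim_sums:
  fixes A :: "nat \<Rightarrow> real set"
  assumes A: "range A \<subseteq> sets M" "disjoint_family A"
    and lim: "\<And>i. (\<lambda>n. \<nu> n (A i)) \<longlonglongrightarrow> V i" and limU: "(\<lambda>n. \<nu> n (\<Union>i. A i)) \<longlonglongrightarrow> W"
  shows "V sums W"
  unfolding sums_def
proof (rule LIMSEQ_I)
  fix e :: real assume e: "0 < e"
  then have "e / 2 > 0" by simp
  then obtain N where N: "\<And>n k. N \<le> k \<Longrightarrow> norm (\<nu> n (\<Union>i. A (i + k))) < e / 2"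
    using avg_small_tail[OF A] by blast
  have "norm ((\<Sum>i<k. V i) - W) < e" if k: "k \<ge> N" for k
  proof -
    have "(\<lambda>n. norm ((\<Sum>i<k. \<nu> n (A i)) - \<nu> n (\<Union>i. A i))) \<longlonglongrightarrow> norm ((\<Sum>i<k. V i) - W)"
      by (intro tendsto_norm tendsto_diff tendsto_sum lim limU)
    moreover have "norm ((\<Sum>i<k. \<nu> n (A i)) - \<nu> n (\<Union>i. A i)) \<le> e / 2" for n
      using N[OF k, of n] avg_UN[OF A, of n k] by (simp add: norm_minus_commute)
    ultimately have "norm ((\<Sum>i<k. V i) - W) \<le> e / 2"
      by (intro LIMSEQ_le_const2) auto
    then show ?thesis using e by simp
  qed
  then show "\<exists>N. \<forall>k\<ge>N. norm ((\<Sum>i<k. V i) - W) < e" by blast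
qed

lemma avg_null:
  assumes "A \<in> null_sets M"
  shows "\<nu> n A = 0"
proof -
  have "measure M (A \<inter> cell a b n i) = 0" if "i < Suc n" for i
    using null_set_Int2[OF assms cell_sets[OF that]] by (simp add: measure_def null_setsD1)
  then show ?thesis unfolding avg_measure_def by (intro sum.neutral) auto
qed

lemma borel_Int_sets: "A \<in> sets borel \<Longrightarrow> A \<inter> {a..<b} \<in> sets M"
  by (auto simp: sets_restrict_space borel_sets_stieltjes)

text \<open>The sets on which the averages converge form a Dynkin system that contains all half-lines.\<close>

lemma avg_convergent_borel:
  assumes A: "A \<in> sets borel"
  shows "convergent (\<lambda>n. \<nu> n (A \<inter> {a..<b}))"
proof -
  have borel: "sets borel = sigma_sets UNIV (range (lessThan :: real \<Rightarrow> real set))"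
    using borel_Iio[where 'a=real] by (metis Pow_UNIV UNIV_I sets_measure_of subset_UNIV)
  have "{..<x} \<inter> {..<y} = {..<min x y}" for x y :: real by auto
  then have "Int_stable (range (lessThan :: real \<Rightarrow> real set))"
    by (auto simp: Int_stable_def)
  moreover have "range (lessThan :: real \<Rightarrow> real set) \<subseteq> Pow UNIV" by simp
  moreover note A[unfolded borel]
  ultimately show ?thesis
  proof (induction A rule: sigma_sets_induct_disjoint)
    case (basic A)
    then obtain d where d: "A = {..<d}" by auto
    define d' where "d' = max a (min d b)"
    have "A \<inter> {a..<b} = {a..<d'}" using ab by (auto simp: d d'_def)
    moreover have "d' \<in> {a..b}" using ab by (auto simp: d'_def)
    ultimately show ?case using avg_Ico_tendsto[of d'] by (auto simp: convergent_def)
  next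
    case empty
    have "\<nu> n ({} \<inter> {a..<b}) = 0" for n by (intro avg_null) simp
    then show ?case by (simp only: convergent_const)
  next
    case (compl A)
    have Am: "A \<inter> {a..<b} \<in> sets M"
      using compl(1) unfolding borel[symmetric] by (rule borel_Int_sets)
    have full: "{a..<b} \<in> sets M" by (rule Ico_in_sets_stieltjes_on) simp
    have eq: "(UNIV - A) \<inter> {a..<b} = {a..<b} - (A \<inter> {a..<b})" by blast
    have "\<nu> n ((UNIV - A) \<inter> {a..<b}) = \<nu> n {a..<b} - \<nu> n (A \<inter> {a..<b})" for n
    proof -
      have "\<nu> n ((A \<inter> {a..<b}) \<union> ({a..<b} - (A \<inter> {a..<b})))
          = \<nu> n (A \<inter> {a..<b}) + \<nu> n ({a..<b} - (A \<inter> {a..<b}))"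
        by (rule avg_union[OF Am sets.Diff[OF full Am]]) blast
      moreover have "(A \<inter> {a..<b}) \<union> ({a..<b} - (A \<inter> {a..<b})) = {a..<b}" by blast
      ultimately show ?thesis unfolding eq by (metis add_diff_cancel_left')
    qed
    moreover have "convergent (\<lambda>n. \<nu> n {a..<b})"
      using avg_Ico_tendsto[of b] ab by (auto simp: convergent_def)
    ultimately show ?case using compl(2) by (simp only: convergent_diff)
  next
    case (union A)
    have "convergent (\<lambda>n. \<nu> n (\<Union>i. A i \<inter> {a..<b}))"
    proof (rule avg_convergent_UN)
      show "range (\<lambda>i. A i \<inter> {a..<b}) \<subseteq> sets M"
        using union(2) unfolding borel[symmetric] by (auto intro: borel_Int_sets)
      show "disjoint_family (\<lambda>i. A i \<inter> {a..<b})"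
        using union(1) by (auto simp: disjoint_family_on_def)
    qed (rule union(3))
    then show ?case by (simp only: UN_extend_simps)
  qed
qed

text \<open>A set in the completion differs from a Borel set by a null set, which the averages ignore.\<close>

lemma avg_convergent:
  assumes A: "A \<in> sets M"
  shows "convergent (\<lambda>n. \<nu> n A)"
proof -
  from A obtain A' where A': "A = {a..<b} \<inter> A'" "A' \<in> sets (stieltjes_measure g)"
    unfolding sets_restrict_space by blast
  have "A \<in> sets (stieltjes_measure g)"
    unfolding A'(1) by (intro sets.Int borel_sets_stieltjes A'(2)) measurable
  moreover have sub: "A \<subseteq> {a..<b}" unfolding A'(1) by blast
  ultimately obtain B Z where B: "B \<in> sets borel" "B \<subseteq> A" "A - B \<subseteq> Z" "Z \<in> null_sets (stieltjes_measure g)" "Z \<in> sets borel"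
    using sets_stieltjesE by blast
  have B_eq: "B \<inter> {a..<b} = B" using B(2) sub by blast
  have Bm: "B \<in> sets M" using borel_Int_sets[OF B(1)] B_eq by simp
  have "Z \<inter> {a..<b} \<in> null_sets M"
    using B(4) by (subst null_sets_restrict_space) (auto intro!: null_set_Int2 borel_sets_stieltjes)
  moreover have "A - B \<subseteq> Z \<inter> {a..<b}" using B(3) sub by blast
  ultimately have "A - B \<in> null_sets M" using null_sets_subset sets.Diff[OF A Bm] by blast
  then have "\<nu> n A = \<nu> n B" for n
  proof -
    have "\<nu> n (B \<union> (A - B)) = \<nu> n B + \<nu> n (A - B)"
      by (rule avg_union[OF Bm sets.Diff[OF A Bm]]) blast
    moreover have "B \<union> (A - B) = A" using B(2) by blast
    ultimately show ?thesis using avg_null[OF \<open>A - B \<in> null_sets M\<close>, of n] by simp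
  qed
  then show ?thesis using avg_convergent_borel[OF B(1)] unfolding B_eq by simp
qed

text \<open>The limit of the averages satisfies the hypotheses of the Radon--Nikodym property. Evaluating the
  density over the intervals \<open>[a,t)\<close> recovers \<open>u\<close>.\<close>

theorem ex_density:
  assumes rnp: "Radon_Nikodym_property TYPE('b)"
  obtains v where "Bochner_integrable M v"
    "\<And>t. t \<in> {a..b} \<Longrightarrow> u t = u a + Bochner_integral (stieltjes_on g {a..<t}) v"
proof -
  define V where "V A = lim (\<lambda>n. \<nu> n A)" for A
  have V: "(\<lambda>n. \<nu> n A) \<longlonglongrightarrow> V A" if "A \<in> sets M" for A
    unfolding V_def using avg_convergent[OF that] by (simp add: convergent_LIMSEQ_iff)
  have "vector_measure M V"
    unfolding vector_measure_def
  proof (intro allI impI)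
    fix A :: "nat \<Rightarrow> real set" assume A: "range A \<subseteq> sets M" "disjoint_family A"
    then have "A i \<in> sets M" "(\<Union>i. A i) \<in> sets M" for i by auto
    then show "(\<lambda>i. V (A i)) sums V (\<Union>i. A i)"
      using avg_lim_sums[OF A V V] by blast
  qed
  moreover have "bounded_variation_measure M V"
  proof -
    obtain C where C: "\<And>n P. finite P \<Longrightarrow> P \<subseteq> sets M \<Longrightarrow> disjoint P \<Longrightarrow> (\<Sum>A\<in>P. norm (\<nu> n A)) \<le> C"
      using avg_bounded_variation by blast
    have "(\<Sum>A\<in>P. norm (V A)) \<le> C" if P: "finite P" "P \<subseteq> sets M" "disjoint P" for P
    proof (rule LIMSEQ_le_const2)
      show "(\<lambda>n. \<Sum>A\<in>P. norm (\<nu> n A)) \<longlonglongrightarrow> (\<Sum>A\<in>P. norm (V A))"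
        using P(2) by (intro tendsto_sum tendsto_norm V) auto
    qed (use C P in blast)
    then show ?thesis unfolding bounded_variation_measure_def by blast
  qed
  moreover have "\<forall>A\<in>null_sets M. V A = 0"
  proof
    fix A assume "A \<in> null_sets M"
    then show "V A = 0" by (simp add: V_def avg_null)
  qed
  ultimately obtain v where v: "Bochner_integrable M v" "\<And>A. A \<in> sets M \<Longrightarrow> V A = Bochner_integral (restrict_space M A) v"
    using rnp finite_measure_axioms unfolding Radon_Nikodym_property_def by blast
  show ?thesis
  proof (rule that[OF v(1)])
    fix t assume t: "t \<in> {a..b}"
    have m: "{a..<t} \<in> sets M" using t by (intro Ico_in_sets_stieltjes_on) auto
    have "V {a..<t} = u t - u a"
      using LIMSEQ_unique[OF V[OF m] avg_Ico_tendsto[OF t]] .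
    moreover have "restrict_space M {a..<t} = stieltjes_on g {a..<t}"
      using t by (intro stieltjes_on_restrict) auto
    ultimately show "u t = u a + Bochner_integral (stieltjes_on g {a..<t}) v"
      using v(2)[OF m] by simp
  qed
qed

end

section \<open>Indefinite integrals and their variation\<close>

locale indefinite_integral =
  fixes g :: "real \<Rightarrow> real" and a b :: real and u f :: "real \<Rightarrow> 'b::banach"
  assumes derivator: "derivator g" and ab: "a < b"
    and integrable: "Bochner_integrable (stieltjes_on g {a..<b}) f"
    and u: "\<And>t. t \<in> {a..b} \<Longrightarrow> u t = u a + Bochner_integral (stieltjes_on g {a..<t}) f"
begin

abbreviation "M \<equiv> stieltjes_on g {a..<b}"

sublocale finite_measure M
  by (rule finite_stieltjes_on[OF derivator])

definition "\<rho> = density M (\<lambda>s. ennreal (norm (f s)))"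

lemma norm_f_measurable [measurable]: "(\<lambda>s. norm (f s)) \<in> borel_measurable M"
proof -
  have "complete_measure M" by (rule complete_stieltjes_on) simp
  then show ?thesis
    using integrable unfolding Bochner_integrable_def
    by (intro complete_measure.borel_measurable_norm_strongly_measurable) auto
qed

lemma emeasure_\<rho>:
  assumes "A \<in> sets M"
  shows "emeasure \<rho> A = (\<integral>\<^sup>+s. ennreal (norm (f s)) * indicator A s \<partial>M)"
  unfolding \<rho>_def using assms by (intro emeasure_density) auto

lemma finite_\<rho>: "finite_measure \<rho>"
proof
  have "emeasure \<rho> (space M) = (\<integral>\<^sup>+s. ennreal (norm (f s)) \<partial>M)"
    unfolding emeasure_\<rho>[OF sets.top] by (intro nn_integral_cong) simp
  also have "\<dots> < \<infinity>" using integrable by (simp add: Bochner_integrable_def)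
  finally show "emeasure \<rho> (space \<rho>) \<noteq> \<infinity>" by (simp add: \<rho>_def)
qed

lemma sets_\<rho>: "sets \<rho> = sets M"
  by (simp add: \<rho>_def)

lemma Ico_sets: "a \<le> x \<Longrightarrow> y \<le> b \<Longrightarrow> {x..<y} \<in> sets M"
  by (intro Ico_in_sets_stieltjes_on) auto

lemma emeasure_\<rho>_Ico:
  assumes "a \<le> x" "y \<le> b"
  shows "emeasure \<rho> {x..<y} = (\<integral>\<^sup>+s. ennreal (norm (f s)) \<partial>stieltjes_on g {x..<y})"
proof -
  have "restrict_space M {x..<y} = stieltjes_on g {x..<y}"
    using assms by (intro stieltjes_on_restrict) auto
  moreover have "(\<integral>\<^sup>+s. ennreal (norm (f s)) \<partial>restrict_space M {x..<y})
      = (\<integral>\<^sup>+s. ennreal (norm (f s)) * indicator {x..<y} s \<partial>M)"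
    by (rule nn_integral_restrict_space[OF Int_space_in_sets[OF Ico_sets[OF assms]]])
  ultimately show ?thesis
    using emeasure_\<rho>[OF Ico_sets[OF assms]] by simp
qed

text \<open>This will turn out to be the variation function of \<open>u\<close>.\<close>

definition "W t = measure \<rho> {a..<t}"

lemma W_diff:
  assumes "a \<le> x" "x \<le> y" "y \<le> b"
  shows "measure \<rho> {x..<y} = W y - W x"
proof -
  interpret \<rho>: finite_measure \<rho> by (rule finite_\<rho>)
  have "{a..<y} = {a..<x} \<union> {x..<y}" using assms by auto
  moreover have "measure \<rho> ({a..<x} \<union> {x..<y}) = measure \<rho> {a..<x} + measure \<rho> {x..<y}"
    using assms by (intro \<rho>.finite_measure_Union) (auto simp: sets_\<rho> intro!: Ico_sets)
  ultimately show ?thesis by (simp add: W_def)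
qed

lemma u_diff:
  assumes "a \<le> x" "x \<le> y" "y \<le> b"
  shows "u y - u x = Bochner_integral (stieltjes_on g {x..<y}) f"
  using Bochner_integral_stieltjes_diff[OF integrable assms] u[of x] u[of y] assms by simp

lemma integrable_Ico:
  assumes "a \<le> x" "y \<le> b"
  shows "Bochner_integrable (stieltjes_on g {x..<y}) f"
  using assms by (intro Bochner_integrable_stieltjes_on_subset[OF integrable]) auto

lemma norm_increment_le:
  assumes "a \<le> x" "x \<le> y" "y \<le> b"
  shows "norm (u y - u x) \<le> W y - W x"
proof -
  interpret \<rho>: finite_measure \<rho> by (rule finite_\<rho>)
  have "ennreal (norm (u y - u x)) \<le> (\<integral>\<^sup>+s. ennreal (norm (f s)) \<partial>stieltjes_on g {x..<y})"
    using norm_Bochner_integral_stieltjes_le[OF derivator integrable_Ico[OF assms(1,3)] assms(2), of 0]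
    by (simp add: u_diff[OF assms])
  also have "\<dots> = ennreal (measure \<rho> {x..<y})"
    using emeasure_\<rho>_Ico[OF assms(1,3)] by (simp add: \<rho>.emeasure_eq_measure)
  finally show ?thesis
    using W_diff[OF assms] measure_nonneg[of \<rho> "{x..<y}"] by (simp add: ennreal_le_iff)
qed

text \<open>Cutting the density off at a large constant shows that \<open>\<rho>\<close> is small on sets of small
  \<open>\<mu>\<^sub>g\<close>-measure.\<close>

lemma density_absolutely_continuous:
  assumes e: "0 < e"
  obtains \<delta> where "0 < \<delta>" "\<And>A. A \<in> sets M \<Longrightarrow> measure M A < \<delta> \<Longrightarrow> measure \<rho> A < e"
proof -
  interpret \<rho>: finite_measure \<rho> by (rule finite_\<rho>)
  let ?T = "\<lambda>n s. if real n < norm (f s) then ennreal (norm (f s)) else 0"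
  have "(\<lambda>n. \<integral>\<^sup>+s. ?T n s \<partial>M) \<longlonglongrightarrow> (\<integral>\<^sup>+s. 0 \<partial>M)"
  proof (rule nn_integral_dominated_convergence[where w="\<lambda>s. ennreal (norm (f s))"])
    show "(\<integral>\<^sup>+s. ennreal (norm (f s)) \<partial>M) < \<infinity>" using integrable by (simp add: Bochner_integrable_def)
    show "AE s in M. (\<lambda>n. ?T n s) \<longlonglongrightarrow> 0"
    proof (rule AE_I2)
      fix s
      obtain N :: nat where N: "norm (f s) < real N" using reals_Archimedean2 by blast
      have "\<forall>\<^sub>F n in sequentially. ?T n s = 0"
        using eventually_ge_at_top[of N] by eventually_elim (use N in auto)
      then show "(\<lambda>n. ?T n s) \<longlonglongrightarrow> 0" by (rule tendsto_eventually)
    qed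
  qed auto
  then have lim: "(\<lambda>n. \<integral>\<^sup>+s. ?T n s \<partial>M) \<longlonglongrightarrow> 0" by simp
  have "0 < ennreal (e / 2)" using e by simp
  with lim have "\<forall>\<^sub>F n in sequentially. (\<integral>\<^sup>+s. ?T n s \<partial>M) < ennreal (e / 2)"
    by (rule order_tendstoD)
  then obtain n where n: "(\<integral>\<^sup>+s. ?T n s \<partial>M) < ennreal (e / 2)"
    by (auto simp: eventually_sequentially)
  define \<delta> where "\<delta> = e / (2 * (real n + 1))"
  have \<delta>: "0 < \<delta>" using e by (simp add: \<delta>_def)
  show ?thesis
  proof (rule that[OF \<delta>])
    fix A assume A: "A \<in> sets M" "measure M A < \<delta>"
    have "emeasure \<rho> A \<le> (\<integral>\<^sup>+s. ?T n s + ennreal (real n) * indicator A s \<partial>M)"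
      unfolding emeasure_\<rho>[OF A(1)]
      by (intro nn_integral_mono) (auto split: split_indicator simp: ennreal_leI)
    also have "\<dots> = (\<integral>\<^sup>+s. ?T n s \<partial>M) + (\<integral>\<^sup>+s. ennreal (real n) * indicator A s \<partial>M)"
      using A(1) by (intro nn_integral_add) auto
    also have "(\<integral>\<^sup>+s. ennreal (real n) * indicator A s \<partial>M) = ennreal (real n) * emeasure M A"
      by (rule nn_integral_cmult_indicator[OF A(1)])
    also have "\<dots> = ennreal (real n * measure M A)"
      by (simp add: emeasure_eq_measure ennreal_mult)
    also have "\<dots> \<le> ennreal (e / 2)"
    proof (rule ennreal_leI)
      have "real n * measure M A \<le> (real n + 1) * \<delta>"
        using A(2) by (intro mult_mono) auto
      also have "\<dots> = e / 2" by (simp add: \<delta>_def field_simps)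
      finally show "real n * measure M A \<le> e / 2" .
    qed
    finally have "emeasure \<rho> A \<le> (\<integral>\<^sup>+s. ?T n s \<partial>M) + ennreal (e / 2)" by (simp add: add_left_mono)
    also have "\<dots> < ennreal (e / 2) + ennreal (e / 2)"
      using n by (simp add: ennreal_add_left_cancel_less add.commute)
    also have "\<dots> = ennreal e" using e by (simp flip: ennreal_plus)
    finally show "measure \<rho> A < e" by (simp add: \<rho>.emeasure_eq_measure ennreal_less_iff)
  qed
qed

text \<open>Both \<open>u\<close> and its variation function satisfy the hypothesis.\<close>

lemma AC_g_dominated:
  fixes F :: "real \<Rightarrow> 'c::real_normed_vector"
  assumes F: "\<And>x y. a \<le> x \<Longrightarrow> x \<le> y \<Longrightarrow> y \<le> b \<Longrightarrow> norm (F y - F x) \<le> W y - W x"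
  shows "AC_g g a b F"
  unfolding AC_g_def
proof (intro allI impI)
  interpret \<rho>: finite_measure \<rho> by (rule finite_\<rho>)
  fix e :: real assume e: "0 < e"
  then obtain \<delta> where \<delta>: "0 < \<delta>" "\<And>A. A \<in> sets M \<Longrightarrow> measure M A < \<delta> \<Longrightarrow> measure \<rho> A < e"
    using density_absolutely_continuous by blast
  have "(\<Sum>i<n. norm (F (r i) - F (l i))) < e"
    if lr: "\<forall>i<n. l i \<in> {a..b} \<and> r i \<in> {a..b} \<and> l i < r i"
      and disj: "disjoint_family_on (\<lambda>i. {l i<..<r i}) {..<n}"
      and less: "(\<Sum>i<n. g (r i) - g (l i)) < \<delta>" for n :: nat and l r
  proof -
    let ?U = "\<Union>i<n. {l i..<r i}"
    have I: "{l i..<r i} \<in> sets M" if "i < n" for i using lr that by (intro Ico_sets) auto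
    \<comment> \<open>Two half-open intervals with a common point share all points slightly to its right.\<close>
    have disj': "disjoint_family_on (\<lambda>i. {l i..<r i}) {..<n}"
      unfolding disjoint_family_on_def
    proof (intro ballI impI equals0I)
      fix i j x assume ij: "i \<in> {..<n}" "j \<in> {..<n}" "i \<noteq> j" and x: "x \<in> {l i..<r i} \<inter> {l j..<r j}"
      then obtain y where "x < y" "y < min (r i) (r j)" using dense[of x "min (r i) (r j)"] by auto
      then have "y \<in> {l i<..<r i} \<inter> {l j<..<r j}" using x by auto
      with disj ij show False unfolding disjoint_family_on_def by blast
    qed
    have "measure M ?U = (\<Sum>i<n. measure M {l i..<r i})"
      using I by (intro finite_measure_finite_Union disj') auto
    also have "\<dots> = (\<Sum>i<n. g (r i) - g (l i))"
    proof (rule sum.cong[OF refl])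
      fix i assume "i \<in> {..<n}"
      then show "measure M {l i..<r i} = g (r i) - g (l i)"
        using lr measure_stieltjes_Ico[OF derivator, of "l i" "r i"]
        by (subst measure_restrict_space) (auto simp: borel_sets_stieltjes)
    qed
    finally have "measure \<rho> ?U < e" using less I by (intro \<delta>(2)) auto
    moreover have "measure \<rho> ?U = (\<Sum>i<n. measure \<rho> {l i..<r i})"
      using I by (intro \<rho>.finite_measure_finite_Union disj') (auto simp: sets_\<rho>)
    moreover have "(\<Sum>i<n. norm (F (r i) - F (l i))) \<le> (\<Sum>i<n. measure \<rho> {l i..<r i})"
    proof (rule sum_mono)
      fix i assume "i \<in> {..<n}"
      then have "a \<le> l i" "l i \<le> r i" "r i \<le> b" using lr by (auto intro: less_imp_le)
      then show "norm (F (r i) - F (l i)) \<le> measure \<rho> {l i..<r i}"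
        unfolding W_diff[OF \<open>a \<le> l i\<close> \<open>l i \<le> r i\<close> \<open>r i \<le> b\<close>] by (rule F)
    qed
    ultimately show ?thesis by linarith
  qed
  with \<delta>(1) show "\<exists>\<delta>>0. \<forall>(n::nat) l r. (\<forall>i<n. l i \<in> {a..b} \<and> r i \<in> {a..b} \<and> l i < r i) \<longrightarrow>
      disjoint_family_on (\<lambda>i. {l i<..<r i}) {..<n} \<longrightarrow>
      (\<Sum>i<n. g (r i) - g (l i)) < \<delta> \<longrightarrow> (\<Sum>i<n. norm (F (r i) - F (l i))) < e"
    by blast
qed

theorem AC_g_indefinite_integral: "AC_g g a b u"
  by (intro AC_g_dominated norm_increment_le)

lemma variation_le:
  assumes t: "t \<in> {a..b}"
  shows "variation a t u \<le> ennreal (W t)"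
  unfolding variation_def
proof (rule SUP_least)
  fix z assume "z \<in> {(n::nat, p). p 0 = a \<and> p n = t \<and> (\<forall>i<n. p i < p (Suc i))}"
  then obtain n p where z: "z = (n, p)" and part: "partition a t n p"
    unfolding partition_def by blast
  have "(\<Sum>i<n. norm (u (p (Suc i)) - u (p i))) \<le> (\<Sum>i<n. W (p (Suc i)) - W (p i))"
  proof (rule sum_mono)
    fix i assume "i \<in> {..<n}"
    then show "norm (u (p (Suc i)) - u (p i)) \<le> W (p (Suc i)) - W (p i)"
      using partition_bounds[OF part, of i] partition_bounds[OF part, of "Suc i"]
        partition_le[OF part, of i "Suc i"] t
      by (intro norm_increment_le) auto
  qed
  also have "\<dots> = W (p n) - W (p 0)" by (rule sum_lessThan_telescope)
  also have "\<dots> = W t" using part by (simp add: partition_def W_def)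
  finally show "(case z of (n, p) \<Rightarrow> ennreal (\<Sum>i<n. norm (u (p (Suc i)) - u (p i)))) \<le> ennreal (W t)"
    unfolding z prod.case by (rule ennreal_leI)
qed

text \<open>At almost every point \<open>s\<close> the slopes of \<open>u\<close> over the cells containing \<open>s\<close> converge to \<open>f(s)\<close>.
  The integral of their norms over all cells is a sum of the kind that defines the variation, so
  Fatou's lemma gives the inequality.\<close>

lemma integral_le_variation: "(\<integral>\<^sup>+s. ennreal (norm (f s)) \<partial>M) \<le> variation a b u"
proof -
  let ?q = "\<lambda>n i. norm (u (node a b n (Suc i)) - u (node a b n i))"
  let ?m = "\<lambda>n i. g (node a b n (Suc i)) - g (node a b n i)"
  define \<phi> where "\<phi> n s = (\<Sum>i<Suc n. ennreal (?q n i / ?m n i) * indicator (cell a b n i) s)" for n s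
  have nodes: "a \<le> node a b n i" "node a b n i \<le> node a b n (Suc i)" "node a b n (Suc i) \<le> b" if "i < Suc n" for n i
    using partition_bounds[OF partition_node[OF ab], of i n] partition_bounds[OF partition_node[OF ab], of "Suc i" n]
      partition_le[OF partition_node[OF ab], of i "Suc i" n] that by auto
  have cells: "cell a b n i \<in> sets M" if "i < Suc n" for n i
    unfolding cell_def using nodes[OF that] by (intro Ico_sets)
  have em_cell: "emeasure M (cell a b n i) = ennreal (?m n i)" if "i < Suc n" for n i
  proof -
    have "emeasure M (cell a b n i) = emeasure (stieltjes_measure g) (cell a b n i)"
      using cell_subset[OF ab that] by (intro emeasure_restrict_space) auto
    also have "\<dots> = ennreal (?m n i)"
      unfolding cell_def by (rule emeasure_stieltjes_Ico[OF derivator nodes(2)[OF that]])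
    finally show ?thesis .
  qed
  have m0: "0 \<le> ?m n i" if "i < Suc n" for n i
    using derivatorD(1)[OF derivator nodes(2)[OF that]] by simp
  have int_\<phi>: "(\<integral>\<^sup>+s. \<phi> n s \<partial>M) \<le> variation a b u" for n
  proof -
    have "(\<integral>\<^sup>+s. \<phi> n s \<partial>M) = (\<Sum>i<Suc n. \<integral>\<^sup>+s. ennreal (?q n i / ?m n i) * indicator (cell a b n i) s \<partial>M)"
      unfolding \<phi>_def using cells by (intro nn_integral_sum) auto
    also have "\<dots> \<le> (\<Sum>i<Suc n. ennreal (?q n i))"
    proof (rule sum_mono)
      fix i assume "i \<in> {..<Suc n}"
      then have i: "i < Suc n" by simp
      have "(\<integral>\<^sup>+s. ennreal (?q n i / ?m n i) * indicator (cell a b n i) s \<partial>M)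
          = ennreal (?q n i / ?m n i) * ennreal (?m n i)"
        unfolding nn_integral_cmult_indicator[OF cells[OF i]] em_cell[OF i] by (rule refl)
      also have "\<dots> = ennreal (?q n i / ?m n i * ?m n i)"
        using m0[OF i] by (intro ennreal_mult[symmetric]) auto
      also have "\<dots> \<le> ennreal (?q n i)" by (intro ennreal_leI) simp
      finally show "(\<integral>\<^sup>+s. ennreal (?q n i / ?m n i) * indicator (cell a b n i) s \<partial>M) \<le> ennreal (?q n i)" .
    qed
    also have "\<dots> = ennreal (\<Sum>i<Suc n. ?q n i)" by (intro sum_ennreal) simp
    also have "\<dots> \<le> variation a b u"
    proof -
      have "(Suc n, node a b n) \<in> {(n, p). p 0 = a \<and> p n = b \<and> (\<forall>i<n. p i < p (Suc i))}"
        using partition_node[OF ab, of n] by (simp add: partition_def)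
      then show ?thesis unfolding variation_def by (rule SUP_upper2) simp
    qed
    finally show ?thesis .
  qed
  have "AE s in M. \<forall>n i. i < Suc n \<longrightarrow> s \<in> cell a b n i \<longrightarrow> 0 < ?m n i"
  proof (subst AE_all_countable, rule allI, subst AE_all_countable, rule allI)
    fix n i
    show "AE s in M. i < Suc n \<longrightarrow> s \<in> cell a b n i \<longrightarrow> 0 < ?m n i"
    proof (cases "i < Suc n \<and> ?m n i = 0")
      case True
      then have "cell a b n i \<in> null_sets M"
        using em_cell[of i n] cells[of i n] by (intro null_setsI) auto
      then have "AE s in M. s \<notin> cell a b n i" by (rule AE_not_in)
      then show ?thesis by eventually_elim simp
    next
      case False
      then show ?thesis using m0[of i n] by (intro AE_I2) auto
    qed
  qed
  then have "AE s in M. ennreal (norm (f s)) \<le> liminf (\<lambda>n. \<phi> n s)"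
    using AE_Lebesgue_point[OF derivator integrable] AE_space
  proof eventually_elim
    fix s
    assume pos: "\<forall>n i. i < Suc n \<longrightarrow> s \<in> cell a b n i \<longrightarrow> 0 < ?m n i"
      and leb: "\<forall>\<epsilon>>0. \<exists>r>0. \<forall>x y. a \<le> x \<longrightarrow> x \<le> s \<longrightarrow> s < y \<longrightarrow> y \<le> b \<longrightarrow> y - x < r \<longrightarrow>
        (\<integral>\<^sup>+z. ennreal (norm (f z - f s)) \<partial>stieltjes_on g {x..<y}) \<le> ennreal (\<epsilon> * (g y - g x))"
      and "s \<in> space M"
    then have s: "s \<in> {a..<b}" by simp
    have "\<forall>n. \<exists>i. i < Suc n \<and> s \<in> cell a b n i" using ex_cell[OF ab s] by metis
    then obtain k where k: "\<And>n. k n < Suc n" "\<And>n. s \<in> cell a b n (k n)" by metis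
    have \<phi>_eq: "\<phi> n s = ennreal (?q n (k n) / ?m n (k n))" for n
    proof -
      have "s \<notin> cell a b n i" if "i < Suc n" "i \<noteq> k n" for i
        using cell_disjoint[OF ab, of n] that k(1)[of n] k(2)[of n] unfolding disjoint_family_on_def by blast
      then have "\<phi> n s = (\<Sum>i<Suc n. if i = k n then ennreal (?q n i / ?m n i) else 0)"
        unfolding \<phi>_def using k(2)[of n] by (intro sum.cong refl) auto
      also have "\<dots> = ennreal (?q n (k n) / ?m n (k n))"
        using k(1)[of n] by (subst sum.delta) auto
      finally show ?thesis .
    qed
    have "(\<lambda>n. ?q n (k n) / ?m n (k n)) \<longlonglongrightarrow> norm (f s)"
    proof (rule LIMSEQ_I)
      fix e :: real assume "0 < e"
      then have e: "0 < e / 2" by simp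
      obtain r where r: "0 < r" "\<And>x y. a \<le> x \<Longrightarrow> x \<le> s \<Longrightarrow> s < y \<Longrightarrow> y \<le> b \<Longrightarrow> y - x < r \<Longrightarrow>
          (\<integral>\<^sup>+z. ennreal (norm (f z - f s)) \<partial>stieltjes_on g {x..<y}) \<le> ennreal (e / 2 * (g y - g x))"
        using leb[rule_format, OF e] by blast
      obtain N :: nat where N: "(b - a) / r < real N" using reals_Archimedean2 by blast
      have "norm (?q n (k n) / ?m n (k n) - norm (f s)) < e" if n: "n \<ge> N" for n
      proof -
        define x where "x = node a b n (k n)"
        define y where "y = node a b n (Suc (k n))"
        have xy: "a \<le> x" "x \<le> y" "y \<le> b" using nodes[OF k(1)[of n]] by (simp_all add: x_def y_def)
        have sxy: "x \<le> s" "s < y" using k(2)[of n] by (simp_all add: cell_def x_def y_def)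
        have m: "0 < g y - g x" using pos k[of n] by (auto simp: x_def y_def)
        have "(b - a) / r < real (Suc n)" using N n by linarith
        then have "(b - a) / real (Suc n) < r" using r(1) by (simp add: field_simps)
        then have "y - x < r" using node_diff[of a b n "k n"] by (simp add: x_def y_def)
        have "ennreal (norm (u y - u x - (g y - g x) *\<^sub>R f s))
            \<le> (\<integral>\<^sup>+z. ennreal (norm (f z - f s)) \<partial>stieltjes_on g {x..<y})"
          unfolding u_diff[OF xy]
          by (rule norm_Bochner_integral_stieltjes_le[OF derivator integrable_Ico[OF xy(1,3)] xy(2)])
        also have "\<dots> \<le> ennreal (e / 2 * (g y - g x))"
          by (rule r(2)[OF xy(1) sxy xy(3) \<open>y - x < r\<close>])
        finally have le: "norm (u y - u x - (g y - g x) *\<^sub>R f s) \<le> e / 2 * (g y - g x)"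
          using e m by (simp add: ennreal_le_iff)
        have "\<bar>norm (u y - u x) - norm ((g y - g x) *\<^sub>R f s)\<bar> \<le> norm (u y - u x - (g y - g x) *\<^sub>R f s)"
          by (rule norm_triangle_ineq3)
        then have "\<bar>norm (u y - u x) - (g y - g x) * norm (f s)\<bar> \<le> e / 2 * (g y - g x)"
          using le m by simp
        moreover have "norm (u y - u x) / (g y - g x) - norm (f s)
            = (norm (u y - u x) - (g y - g x) * norm (f s)) / (g y - g x)"
          using m by (simp add: field_simps)
        ultimately have "\<bar>norm (u y - u x) / (g y - g x) - norm (f s)\<bar> \<le> e / 2"
          using m by (simp add: abs_divide pos_divide_le_eq)
        then show ?thesis using e unfolding x_def y_def real_norm_def by linarith
      qed
      then show "\<exists>N. \<forall>n\<ge>N. norm (?q n (k n) / ?m n (k n) - norm (f s)) < e" by blast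
    qed
    then have "(\<lambda>n. \<phi> n s) \<longlonglongrightarrow> ennreal (norm (f s))"
      unfolding \<phi>_eq by (rule tendsto_ennrealI)
    then have "liminf (\<lambda>n. \<phi> n s) = ennreal (norm (f s))"
      by (intro lim_imp_Liminf) auto
    then show "ennreal (norm (f s)) \<le> liminf (\<lambda>n. \<phi> n s)" by simp
  qed
  then have "(\<integral>\<^sup>+s. ennreal (norm (f s)) \<partial>M) \<le> (\<integral>\<^sup>+s. liminf (\<lambda>n. \<phi> n s) \<partial>M)"
    by (rule nn_integral_mono_AE)
  also have "\<dots> \<le> liminf (\<lambda>n. \<integral>\<^sup>+s. \<phi> n s \<partial>M)"
  proof (rule nn_integral_liminf)
    show "\<phi> n \<in> borel_measurable M" for n
      unfolding \<phi>_def using cells by (intro borel_measurable_sum borel_measurable_times_ennreal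
          borel_measurable_const borel_measurable_indicator) auto
  qed
  also have "\<dots> \<le> liminf (\<lambda>n. variation a b u)"
    by (intro Liminf_mono always_eventually allI int_\<phi>)
  also have "\<dots> = variation a b u" by (simp add: Liminf_const)
  finally show ?thesis .
qed

end

context indefinite_integral
begin

text \<open>The lower bound \<open>integral_le_variation\<close> is applied with \<open>t\<close> in place of \<open>b\<close>.\<close>

lemma variation_eq:
  assumes t: "t \<in> {a..b}"
  shows "variation a t u = ennreal (W t)"
proof (rule antisym[OF variation_le[OF t]])
  interpret \<rho>: finite_measure \<rho> by (rule finite_\<rho>)
  show "ennreal (W t) \<le> variation a t u"
  proof (cases "t = a")
    case True
    then show ?thesis by (simp add: W_def)
  next
    case False
    then interpret I: indefinite_integral g a t u f
    proof unfold_locales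
      show "Bochner_integrable (stieltjes_on g {a..<t}) f" using t by (intro integrable_Ico) auto
      show "u s = u a + Bochner_integral (stieltjes_on g {a..<s}) f" if "s \<in> {a..t}" for s
        using that t by (intro u) auto
    qed (use t False derivator in auto)
    have "ennreal (W t) = (\<integral>\<^sup>+s. ennreal (norm (f s)) \<partial>stieltjes_on g {a..<t})"
      using emeasure_\<rho>_Ico[of a t] t by (simp add: W_def \<rho>.emeasure_eq_measure)
    also have "\<dots> \<le> variation a t u" by (rule I.integral_le_variation)
    finally show ?thesis .
  qed
qed

lemma enn2real_variation: "t \<in> {a..b} \<Longrightarrow> enn2real (variation a t u) = W t"
  by (simp add: variation_eq W_def)

text \<open>Since \<open>\<bar>\<parallel>f(s)\<parallel> - \<parallel>c\<parallel>\<bar> \<le> \<parallel>f(s) - c\<parallel>\<close>, a Lebesgue point of \<open>f\<close> is good enough for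
  differentiating the indefinite integral of \<open>\<parallel>f\<parallel>\<close>.\<close>

lemma W_increment_error:
  assumes xy: "a \<le> x" "x \<le> y" "y \<le> b"
  shows "ennreal \<bar>W y - W x - (g y - g x) * norm c\<bar> \<le> (\<integral>\<^sup>+s. ennreal (norm (f s - c)) \<partial>stieltjes_on g {x..<y})"
    (is "_ \<le> ?J")
proof (cases "?J = \<infinity>")
  case False
  interpret \<rho>: finite_measure \<rho> by (rule finite_\<rho>)
  let ?N = "stieltjes_on g {x..<y}"
  interpret N: finite_measure ?N by (rule finite_stieltjes_on[OF derivator])
  have complete: "complete_measure ?N" by (rule complete_stieltjes_on) simp
  have sm: "strongly_measurable ?N f"
    using integrable_Ico[OF xy(1,3)] by (simp add: Bochner_integrable_def)
  note [measurable] = complete_measure.borel_measurable_norm_strongly_measurable[OF complete sm]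
    complete_measure.borel_measurable_norm_strongly_measurable[OF complete
      strongly_measurable_diff[OF sm strongly_measurable_const[OF N.finite_measure_axioms, of c]]]
  have L: "(\<integral>\<^sup>+s. ennreal (norm (f s)) \<partial>?N) = ennreal (W y - W x)"
    using emeasure_\<rho>_Ico[OF xy(1,3)] W_diff[OF xy] by (simp add: \<rho>.emeasure_eq_measure)
  have g0: "0 \<le> g y - g x" using derivatorD(1)[OF derivator xy(2)] by simp
  have em: "emeasure ?N {x..<y} = ennreal (g y - g x)"
    using emeasure_stieltjes_Ico[OF derivator xy(2)] by (simp add: emeasure_restrict_space borel_sets_stieltjes)
  have const: "(\<integral>\<^sup>+s. ennreal (norm c) \<partial>?N) = ennreal ((g y - g x) * norm c)"
    using g0 by (simp add: em ennreal_mult mult.commute)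
  obtain j where j: "?J = ennreal j" "0 \<le> j" using False by (cases ?J) auto
  have W0: "0 \<le> W y - W x" using W_diff[OF xy] by (metis measure_nonneg)
  have "ennreal (W y - W x) \<le> (\<integral>\<^sup>+s. ennreal (norm (f s - c)) + ennreal (norm c) \<partial>?N)"
    unfolding L[symmetric]
  proof (rule nn_integral_mono)
    fix s
    show "ennreal (norm (f s)) \<le> ennreal (norm (f s - c)) + ennreal (norm c)"
      using norm_triangle_ineq[of "f s - c" c] by (simp flip: ennreal_plus)
  qed
  also have "\<dots> = ?J + (\<integral>\<^sup>+s. ennreal (norm c) \<partial>?N)" by (rule nn_integral_add) measurable
  also have "\<dots> = ennreal (j + (g y - g x) * norm c)" unfolding const j(1) using j(2) g0 by simp
  finally have 1: "W y - W x \<le> j + (g y - g x) * norm c"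
    using j(2) g0 by (subst (asm) ennreal_le_iff) auto
  have "ennreal ((g y - g x) * norm c) \<le> (\<integral>\<^sup>+s. ennreal (norm (f s - c)) + ennreal (norm (f s)) \<partial>?N)"
    unfolding const[symmetric]
  proof (rule nn_integral_mono)
    fix s
    show "ennreal (norm c) \<le> ennreal (norm (f s - c)) + ennreal (norm (f s))"
      using norm_triangle_ineq4[of "f s" "f s - c"] by (simp flip: ennreal_plus)
  qed
  also have "\<dots> = ?J + (\<integral>\<^sup>+s. ennreal (norm (f s)) \<partial>?N)" by (rule nn_integral_add) measurable
  also have "\<dots> = ennreal (j + (W y - W x))" unfolding L j(1) using j(2) W0 by simp
  finally have 2: "(g y - g x) * norm c \<le> j + (W y - W x)"
    using j(2) W0 by (subst (asm) ennreal_le_iff) auto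
  show ?thesis unfolding j(1) using 1 2 by (intro ennreal_leI) linarith
qed simp

theorem variation_finite: "t \<in> {a..b} \<Longrightarrow> variation a t u < \<infinity>"
  by (simp add: variation_eq)

theorem AC_g_variation: "AC_g g a b (\<lambda>t. enn2real (variation a t u))"
proof (rule AC_g_dominated)
  fix x y assume xy: "a \<le> x" "x \<le> y" "y \<le> b"
  have "0 \<le> W y - W x" using W_diff[OF xy] by (metis measure_nonneg)
  then show "norm (enn2real (variation a y u) - enn2real (variation a x u)) \<le> W y - W x"
    using xy by (simp add: enn2real_variation)
qed

theorem AE_has_g_derivative_variation:
  "AE t in M. has_g_derivative g a b (\<lambda>t. enn2real (variation a t u)) t (norm (f t))"
  using AE_Lebesgue_point[OF derivator integrable] AE_not_exceptional[OF derivator atLeastLessThan_borel[of a b]] AE_space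
proof eventually_elim
  fix t
  assume leb: "\<forall>\<epsilon>>0. \<exists>r>0. \<forall>x y. a \<le> x \<longrightarrow> x \<le> t \<longrightarrow> t < y \<longrightarrow> y \<le> b \<longrightarrow> y - x < r \<longrightarrow>
      (\<integral>\<^sup>+s. ennreal (norm (f s - f t)) \<partial>stieltjes_on g {x..<y}) \<le> ennreal (\<epsilon> * (g y - g x))"
    and exc: "t \<notin> const_set g \<union> const_endpoints g" and t: "t \<in> space M"
  show "has_g_derivative g a b (\<lambda>t. enn2real (variation a t u)) t (norm (f t))"
  proof (rule has_g_derivative_at_Lebesgue_point[OF derivator, where J = "\<lambda>x y. \<integral>\<^sup>+s. ennreal (norm (f s - f t)) \<partial>stieltjes_on g {x..<y}"])
    fix x y assume xy: "a \<le> x" "x \<le> t" "t \<le> y" "y \<le> b"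
    have "enn2real (variation a y u) = W y" "enn2real (variation a x u) = W x"
      using xy by (simp_all add: enn2real_variation)
    then show "ennreal (norm (enn2real (variation a y u) - enn2real (variation a x u) - (g y - g x) *\<^sub>R norm (f t)))
        \<le> (\<integral>\<^sup>+s. ennreal (norm (f s - f t)) \<partial>stieltjes_on g {x..<y})"
      using W_increment_error[of x y "f t"] xy by simp
  next
    fix \<epsilon> :: real assume "0 < \<epsilon>"
    with leb show "\<exists>r>0. \<forall>x y. a \<le> x \<longrightarrow> x \<le> t \<longrightarrow> t < y \<longrightarrow> y \<le> b \<longrightarrow> y - x < r \<longrightarrow>
      (\<integral>\<^sup>+s. ennreal (norm (f s - f t)) \<partial>stieltjes_on g {x..<y}) \<le> ennreal (\<epsilon> * (g y - g x))"
      by blast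
  next
    fix x y assume "t \<le> y"
    then show "(\<integral>\<^sup>+s. ennreal (norm (f s - f t)) \<partial>stieltjes_on g {x..<t})
        \<le> (\<integral>\<^sup>+s. ennreal (norm (f s - f t)) \<partial>stieltjes_on g {x..<y})"
      by (intro nn_integral_stieltjes_on_mono_set) auto
  qed (use exc t in simp_all)
qed

end

section \<open>The fundamental theorem of calculus\<close>

lemma AE_stieltjes_on_subset:
  assumes "AE t in stieltjes_on g B. P t" "A \<in> sets borel" "B \<in> sets borel" "A \<subseteq> B"
  shows "AE t in stieltjes_on g A. P t"
proof -
  have "AE t in stieltjes_measure g. t \<in> B \<longrightarrow> P t"
    using assms(1,3) by (subst (asm) AE_restrict_space_iff) (auto simp: borel_sets_stieltjes)
  then have "AE t in stieltjes_measure g. t \<in> A \<longrightarrow> P t"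
    by eventually_elim (use assms(4) in blast)
  then show ?thesis
    using assms(2) by (subst AE_restrict_space_iff) (auto simp: borel_sets_stieltjes)
qed

theorem theorem3p4:
  fixes g :: "real \<Rightarrow> real" and a b :: real and u :: "real \<Rightarrow> 'y::banach"
  assumes "derivator g" and "a < b" and "Radon_Nikodym_property TYPE('y)"
  shows "(AC_g g a b u \<longleftrightarrow>
            (AE t in stieltjes_on g {a..<b}. \<exists>y. has_g_derivative g a b u t y) \<and>
            Bochner_integrable (stieltjes_on g {a..<b}) (g_derivative g a b u) \<and>
            (\<forall>t\<in>{a..b}. u t = u a + Bochner_integral (stieltjes_on g {a..<t}) (g_derivative g a b u)))
       \<and> (AC_g g a b u \<longrightarrow>
            (\<forall>t\<in>{a..b}. variation a t u < \<infinity>) \<and>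
            AC_g g a b (\<lambda>t. enn2real (variation a t u)) \<and>
            (AE t in stieltjes_on g {a..<b}.
               has_g_derivative g a b (\<lambda>t. enn2real (variation a t u)) t (norm (g_derivative g a b u t))))"
proof -
  let ?M = "stieltjes_on g {a..<b}"
  let ?f = "g_derivative g a b u"
  let ?FTC = "(AE t in ?M. \<exists>y. has_g_derivative g a b u t y) \<and> Bochner_integrable ?M ?f \<and>
      (\<forall>t\<in>{a..b}. u t = u a + Bochner_integral (stieltjes_on g {a..<t}) ?f)"
  have *: "?FTC" if "AC_g g a b u"
  proof -
    interpret AC_function g a b u using assms that by unfold_locales
    obtain v where v: "Bochner_integrable ?M v"
      "\<And>t. t \<in> {a..b} \<Longrightarrow> u t = u a + Bochner_integral (stieltjes_on g {a..<t}) v"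
      using ex_density[OF assms(3)] by blast
    have deriv: "AE t in ?M. has_g_derivative g a b u t (v t)"
      by (rule AE_has_g_derivative_Bochner_integral[OF assms(1) v])
    then have eq: "AE t in ?M. v t = ?f t"
      by eventually_elim (simp add: g_derivative_eq)
    have "u t = u a + Bochner_integral (stieltjes_on g {a..<t}) ?f" if t: "t \<in> {a..b}" for t
    proof -
      have "AE s in stieltjes_on g {a..<t}. v s = ?f s"
        using t by (intro AE_stieltjes_on_subset[OF eq]) auto
      then show ?thesis using v(2)[OF t] Bochner_integral_cong_AE by metis
    qed
    moreover have "AE t in ?M. \<exists>y. has_g_derivative g a b u t y"
      using deriv by eventually_elim blast
    ultimately show ?thesis using Bochner_integrable_cong_AE[OF v(1) eq] by blast
  qed
  have int: "indefinite_integral g a b u ?f" if "?FTC"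
    using that assms(1,2) by unfold_locales blast+
  show ?thesis
  proof (intro conjI[OF iffI impI])
    assume "AC_g g a b u"
    then show ?FTC by (rule *)
  next
    assume ?FTC
    then show "AC_g g a b u" by (rule indefinite_integral.AC_g_indefinite_integral[OF int])
  next
    assume "AC_g g a b u"
    then interpret indefinite_integral g a b u ?f by (rule int[OF *])
    show "(\<forall>t\<in>{a..b}. variation a t u < \<infinity>) \<and> AC_g g a b (\<lambda>t. enn2real (variation a t u)) \<and>
        (AE t in ?M. has_g_derivative g a b (\<lambda>t. enn2real (variation a t u)) t (norm (?f t)))"
      by (intro conjI ballI variation_finite AC_g_variation AE_has_g_derivative_variation)
  qed
qed

end
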